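(* There is an algorithm that, given a graph $G$ together with a path decomposition of $G$ of width $w$, determines in time $2^{O(w^2\log w)}\cdot|V(G)|$ an integer $d\in\mathbb N$ such that $d\le\mathrm{box}(G)\le d+1$.
   Context: The boxicity $\mathrm{box}(G)$ is the least $d$ such that $G$ is the intersection graph of axis-aligned boxes (Cartesian products of $d$ closed real intervals) in $\mathbb R^d$, with distinct vertices adjacent iff their boxes intersect. A path decomposition of $G$ is a sequence of bags $W_1,\dots,W_t\subseteq V(G)$ whose union is $V(G)$, such that each edge lies in some bag and if $v\in W_i\cap W_j$ then $v\in W_k$ for all $i\le k\le j$; its width is $\max_i|W_i|-1$. *)

theory Defs
  imports Complex_Main "HOL-Library.FuncSet" "HOL-Library.Landau_Symbols"
begin

definition simple_graph :: "'a set \<Rightarrow> 'a set set \<Rightarrow> bool" where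
  "simple_graph V E \<longleftrightarrow> finite V \<and> (\<forall>e\<in>E. e \<subseteq> V \<and> card e = 2)"


definition aligned_box :: "nat \<Rightarrow> (nat \<Rightarrow> real) \<Rightarrow> (nat \<Rightarrow> real) \<Rightarrow> (nat \<Rightarrow> real) set" where
  "aligned_box d a b = (\<Pi>\<^sub>E i\<in>{..<d}. {a i..b i})"

definition box_representation ::
    "'a set \<Rightarrow> 'a set set \<Rightarrow> nat \<Rightarrow> ('a \<Rightarrow> nat \<Rightarrow> real) \<Rightarrow> ('a \<Rightarrow> nat \<Rightarrow> real) \<Rightarrow> bool" where
  "box_representation V E d a b \<longleftrightarrow>
     (\<forall>v\<in>V. \<forall>i<d. a v i \<le> b v i) \<and>
     (\<forall>u\<in>V. \<forall>v\<in>V. u \<noteq> v \<longrightarrow>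
        ({u, v} \<in> E \<longleftrightarrow> aligned_box d (a u) (b u) \<inter> aligned_box d (a v) (b v) \<noteq> {}))"

text \<open>\<open>d = 0\<close> is allowed: \<open>\<real>\<^sup>0\<close> is a single point, so complete graphs have boxicity 0.\<close>

definition boxicity :: "'a set \<Rightarrow> 'a set set \<Rightarrow> nat" where
  "boxicity V E = (LEAST d. \<exists>a b. box_representation V E d a b)"


definition path_decomposition :: "'a set \<Rightarrow> 'a set set \<Rightarrow> 'a set list \<Rightarrow> bool" where
  "path_decomposition V E Ws \<longleftrightarrow>
     \<Union>(set Ws) = V \<and>
     (\<forall>e\<in>E. \<exists>W\<in>set Ws. e \<subseteq> W) \<and>
     (\<forall>i j k. i \<le> k \<and> k \<le> j \<and> j < length Ws \<longrightarrow> Ws ! i \<inter> Ws ! j \<subseteq> Ws ! k)"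

text \<open>The subtraction does not truncate when the graph has a vertex, since then some bag is nonempty.\<close>

definition width :: "'a set list \<Rightarrow> nat" where
  "width Ws = Max (card ` set Ws) - 1"


text \<open>
  The model of computation is the unit-cost random access machine on natural numbers with
  addition and truncated subtraction (no multiplication) and indirect addressing, programmed with
  structured control flow. A state is a pair of registers and memory; every elementary
  instruction and every evaluation of a test costs one step.
\<close>

datatype prog =
    Skip
  | Const nat nat
  | Add nat nat nat
  | Sub nat nat nat
  | Load nat nat
  | Store nat nat
  | Seq prog prog
  | IfNonzero nat prog prog
  | WhileNonzero nat prog

type_synonym state = "(nat \<Rightarrow> nat) \<times> (nat \<Rightarrow> nat)"

text \<open>\<open>exec c s k s'\<close>: program \<open>c\<close> started in \<open>s\<close> halts in \<open>s'\<close> after exactly \<open>k\<close> steps.\<close>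

inductive exec :: "prog \<Rightarrow> state \<Rightarrow> nat \<Rightarrow> state \<Rightarrow> bool" where
  Skip: "exec Skip s 1 s"
| Const: "exec (Const x n) (r, m) 1 (r(x := n), m)"
| Add: "exec (Add x y z) (r, m) 1 (r(x := r y + r z), m)"
| Sub: "exec (Sub x y z) (r, m) 1 (r(x := r y - r z), m)"
| Load: "exec (Load x y) (r, m) 1 (r(x := m (r y)), m)"
| Store: "exec (Store x y) (r, m) 1 (r, m(r x := r y))"
| Seq: "exec c s k s' \<Longrightarrow> exec c' s' k' s'' \<Longrightarrow> exec (Seq c c') s (k + k') s''"
| IfTrue: "fst s x \<noteq> 0 \<Longrightarrow> exec c s k s' \<Longrightarrow> exec (IfNonzero x c c') s (k + 1) s'"
| IfFalse: "fst s x = 0 \<Longrightarrow> exec c' s k s' \<Longrightarrow> exec (IfNonzero x c c') s (k + 1) s'"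
| WhileFalse: "fst s x = 0 \<Longrightarrow> exec (WhileNonzero x c) s 1 s"
| WhileTrue: "fst s x \<noteq> 0 \<Longrightarrow> exec c s k s' \<Longrightarrow> exec (WhileNonzero x c) s' k' s'' \<Longrightarrow>
    exec (WhileNonzero x c) s (k + k' + 1) s''"

inductive_cases exec_elims:
  "exec Skip s k s'" "exec (Const x n) s k s'" "exec (Add x y z) s k s'"
  "exec (Sub x y z) s k s'" "exec (Load x y) s k s'" "exec (Store x y) s k s'"
  "exec (Seq c c') s k s'" "exec (IfNonzero x c c') s k s'" "exec (WhileNonzero x c) s k s'"

lemma exec_deterministic:
  "exec c s k s' \<Longrightarrow> exec c s l t \<Longrightarrow> l = k \<and> t = s'"
proof (induction arbitrary: l t rule: exec.induct)
  case (Seq c s k s' c' k' s'')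
  from Seq.prems obtain a u b where "l = a + b" and 1: "exec c s a u" and 2: "exec c' u b t"
    by (rule exec_elims)
  moreover have "a = k \<and> u = s'" by (rule Seq.IH(1)[OF 1])
  moreover from this 2 have "b = k' \<and> t = s''" by (intro Seq.IH(2)) (simp only:)
  ultimately show ?case by (simp only: simp_thms)
next
  case (IfTrue s x c k s' c')
  from IfTrue.prems IfTrue.hyps obtain a where "l = a + 1" and 1: "exec c s a t"
    by (elim exec_elims) simp_all
  moreover have "a = k \<and> t = s'" by (rule IfTrue.IH[OF 1])
  ultimately show ?case by (simp only: simp_thms)
next
  case (IfFalse s x c' k s' c)
  from IfFalse.prems IfFalse.hyps obtain a where "l = a + 1" and 1: "exec c' s a t"
    by (elim exec_elims) simp_all
  moreover have "a = k \<and> t = s'" by (rule IfFalse.IH[OF 1])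
  ultimately show ?case by (simp only: simp_thms)
next
  case (WhileFalse s x c)
  from WhileFalse.prems show ?case by (rule exec_elims) (use WhileFalse.hyps in simp_all)
next
  case (WhileTrue s x c k s' k' s'')
  from WhileTrue.prems obtain a u b where "l = a + b + 1"
    and 1: "exec c s a u" and 2: "exec (WhileNonzero x c) u b t"
    by (rule exec_elims) (use WhileTrue.hyps in simp_all)
  moreover have "a = k \<and> u = s'" by (rule WhileTrue.IH(1)[OF 1])
  moreover from this 2 have "b = k' \<and> t = s''" by (intro WhileTrue.IH(2)) (simp only:)
  ultimately show ?case by (simp only: simp_thms)
qed (erule exec_elims; simp)+

definition initial_state :: "nat list \<Rightarrow> state" where
  "initial_state xs = (\<lambda>_. 0, \<lambda>i. if i < length xs then xs ! i else 0)"

definition result :: "state \<Rightarrow> nat" where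
  "result s = fst s 0"


definition adjacency_lists :: "nat \<Rightarrow> nat set set \<Rightarrow> nat list list \<Rightarrow> bool" where
  "adjacency_lists n E As \<longleftrightarrow>
     length As = n \<and> (\<forall>v<n. distinct (As ! v) \<and> set (As ! v) = {u. {v, u} \<in> E})"

text \<open>
  Immediate repetitions of a bag are not written down. The length of a sequence of bags with
  repetitions is not bounded by any function of the number of vertices and the width, so it could
  not even be read within a time bound in terms of these; without repetitions there are at most
  \<open>2 * n + 1\<close> bags.
\<close>

definition bag_lists :: "nat set list \<Rightarrow> nat list list \<Rightarrow> bool" where
  "bag_lists Ws Bs \<longleftrightarrow> map set Bs = remdups_adj Ws \<and> (\<forall>B\<in>set Bs. distinct B)"

definition encode_input :: "nat list list \<Rightarrow> nat list list \<Rightarrow> nat list" where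
  "encode_input As Bs = length As # length Bs # concat (map (\<lambda>xs. length xs # xs) (As @ Bs))"

definition is_encoding :: "nat list \<Rightarrow> nat \<Rightarrow> nat set set \<Rightarrow> nat set list \<Rightarrow> bool" where
  "is_encoding xs n E Ws \<longleftrightarrow>
     (\<exists>As Bs. adjacency_lists n E As \<and> bag_lists Ws Bs \<and> xs = encode_input As Bs)"

end

theory Submission
  imports Defs "HOL-Library.Nat_Bijection"
begin

text \<open>
  The vertices' bag intervals of a path decomposition give an interval supergraph that separates all pairs
  of vertices sharing no bag. Hence the boxicity is, up to an additive one, the least number \<open>d\<close> of
  interval supergraphs needed to separate the nonadjacent pairs that do share a bag; this \<open>d\<close> is at most
  the maximal bag size \<open>b\<close>. Such a \<open>d\<close>-tuple of supergraphs exists iff every bag can be given the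
  order type of its \<open>2b\<close> interval endpoints in each of the \<open>d\<close> dimensions so that consecutive bags
  agree on their common vertices: order types can be amalgamated along the path because the reals are dense.
  A dynamic program over the bags decides this with \<open>(2b)\<^bsup>2bd\<^esup>\<close> states per bag; any running time
  polynomial in the number of states is affordable, so the states are numbers and the set of
  reachable states is a single register holding a bit set.
\<close>

section \<open>Expressions and their compilation\<close>

datatype exp =
    Var nat
  | Lit nat
  | Plus exp exp
  | Minus exp exp
  | Mem exp
  | Ite exp exp exp
  | Fold nat nat exp exp exp

primrec eval :: "exp \<Rightarrow> (nat \<Rightarrow> nat) \<Rightarrow> (nat \<Rightarrow> nat) \<Rightarrow> nat" where
  "eval (Var i) r m = r i"
| "eval (Lit c) r m = c"
| "eval (Plus e f) r m = eval e r m + eval f r m"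
| "eval (Minus e f) r m = eval e r m - eval f r m"
| "eval (Mem e) r m = m (eval e r m)"
| "eval (Ite c e f) r m = (if eval c r m \<noteq> 0 then eval e r m else eval f r m)"
| "eval (Fold a x n i e) r m =
     rec_nat (eval i r m) (\<lambda>j v. eval e (r(x := j, a := v)) m) (eval n r m)"

text \<open>\<open>Fold a x\<close> binds the registers \<open>a\<close> and \<open>x\<close>; the compiled code restores them, so that
  evaluation changes no register below \<open>h\<close>.\<close>

primrec compile :: "nat \<Rightarrow> exp \<Rightarrow> prog" where
  "compile h (Var i) = Seq (Const h 0) (Add h i h)"
| "compile h (Lit c) = Const h c"
| "compile h (Plus e f) = Seq (compile h e) (Seq (compile (Suc h) f) (Add h h (Suc h)))"
| "compile h (Minus e f) = Seq (compile h e) (Seq (compile (Suc h) f) (Sub h h (Suc h)))"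
| "compile h (Mem e) = Seq (compile h e) (Load h h)"
| "compile h (Ite c e f) = Seq (compile h c) (IfNonzero h (compile h e) (compile h f))"
| "compile h (Fold a x n i e) =
     Seq (Seq (compile h n) (compile (h + 1) i))
    (Seq (Seq (Const (h + 4) 0) (Seq (Add (h + 2) a (h + 4)) (Seq (Add (h + 3) x (h + 4))
              (Seq (Add a (h + 1) (h + 4)) (Const x 0)))))
    (Seq (WhileNonzero h
            (Seq (compile (h + 4) e)
              (Seq (Const (h + 5) 0) (Seq (Add a (h + 4) (h + 5)) (Seq (Const (h + 5) 1)
              (Seq (Add x x (h + 5)) (Sub h h (h + 5))))))))
         (Seq (Const (h + 4) 0) (Seq (Add h a (h + 4)) (Seq (Add a (h + 2) (h + 4))
              (Add x (h + 3) (h + 4)))))))"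

text \<open>\<open>h\<close> is the first scratch register: an expression may read and bind only
  registers below \<open>h\<close>, and these are the ones that code compiled at \<open>h\<close>
  leaves as they were.\<close>

primrec wf_exp :: "nat \<Rightarrow> exp \<Rightarrow> bool" where
  "wf_exp h (Var i) \<longleftrightarrow> i < h"
| "wf_exp h (Lit c) \<longleftrightarrow> True"
| "wf_exp h (Plus e f) \<longleftrightarrow> wf_exp h e \<and> wf_exp h f"
| "wf_exp h (Minus e f) \<longleftrightarrow> wf_exp h e \<and> wf_exp h f"
| "wf_exp h (Mem e) \<longleftrightarrow> wf_exp h e"
| "wf_exp h (Ite c e f) \<longleftrightarrow> wf_exp h c \<and> wf_exp h e \<and> wf_exp h f"
| "wf_exp h (Fold a x n i e) \<longleftrightarrow> a < h \<and> x < h \<and> a \<noteq> x \<and> wf_exp h n \<and> wf_exp h i \<and> wf_exp h e"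

text \<open>The body of a fold is checked for every accumulator value \<open>v\<close>, so that loop
  lengths can be verified without knowing the intermediate results.\<close>

primrec loops_bounded :: "nat \<Rightarrow> exp \<Rightarrow> (nat \<Rightarrow> nat) \<Rightarrow> (nat \<Rightarrow> nat) \<Rightarrow> bool" where
  "loops_bounded K (Var i) r m \<longleftrightarrow> True"
| "loops_bounded K (Lit c) r m \<longleftrightarrow> True"
| "loops_bounded K (Plus e f) r m \<longleftrightarrow> loops_bounded K e r m \<and> loops_bounded K f r m"
| "loops_bounded K (Minus e f) r m \<longleftrightarrow> loops_bounded K e r m \<and> loops_bounded K f r m"
| "loops_bounded K (Mem e) r m \<longleftrightarrow> loops_bounded K e r m"
| "loops_bounded K (Ite c e f) r m \<longleftrightarrow> loops_bounded K c r m \<and>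
     (if eval c r m \<noteq> 0 then loops_bounded K e r m else loops_bounded K f r m)"
| "loops_bounded K (Fold a x n i e) r m \<longleftrightarrow> loops_bounded K n r m \<and> loops_bounded K i r m \<and>
     eval n r m \<le> K \<and> (\<forall>j<eval n r m. \<forall>v. loops_bounded K e (r(x := j, a := v)) m)"

text \<open>A function of the expression and of \<open>K\<close> alone: registers and memory
  influence the time only through loop lengths. An iteration of a fold adds five instructions and a
  test to its body; the \<open>10\<close> counts five instructions of setup, the last test and four
  instructions that restore registers.\<close>

primrec exp_time :: "nat \<Rightarrow> exp \<Rightarrow> nat" where
  "exp_time K (Var i) = 2"
| "exp_time K (Lit c) = 1"
| "exp_time K (Plus e f) = exp_time K e + exp_time K f + 1"
| "exp_time K (Minus e f) = exp_time K e + exp_time K f + 1"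
| "exp_time K (Mem e) = exp_time K e + 1"
| "exp_time K (Ite c e f) = exp_time K c + exp_time K e + exp_time K f + 1"
| "exp_time K (Fold a x n i e) = exp_time K n + exp_time K i + K * (exp_time K e + 6) + 10"

lemma wf_exp_mono: "wf_exp h e \<Longrightarrow> h \<le> h' \<Longrightarrow> wf_exp h' e"
  by (induction e) auto

lemma eval_cong:
  "wf_exp h e \<Longrightarrow> (\<And>i. i < h \<Longrightarrow> r i = r' i) \<Longrightarrow> eval e r m = eval e r' m"
proof (induction e arbitrary: r r')
  case (Fold a x n i e)
  have "eval e (r(x := j, a := v)) m = eval e (r'(x := j, a := v)) m" for j v
    using Fold.prems by (intro Fold.IH) auto
  moreover have "eval n r m = eval n r' m" "eval i r m = eval i r' m"
    using Fold.prems by (auto intro!: Fold.IH)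
  ultimately show ?case by simp
next
  case (Ite e1 e2 e3)
  then show ?case by (metis eval.simps(6) wf_exp.simps(6))
next
  case (Plus e f)
  have "eval e r m = eval e r' m" "eval f r m = eval f r' m"
    using Plus.prems by (auto intro!: Plus.IH)
  then show ?case by simp
next
  case (Minus e f)
  have "eval e r m = eval e r' m" "eval f r m = eval f r' m"
    using Minus.prems by (auto intro!: Minus.IH)
  then show ?case by simp
next
  case (Mem e)
  have "eval e r m = eval e r' m"
    using Mem.prems by (auto intro!: Mem.IH)
  then show ?case by simp
qed simp_all

lemma loops_bounded_cong:
  "wf_exp h e \<Longrightarrow> (\<And>i. i < h \<Longrightarrow> r i = r' i) \<Longrightarrow> loops_bounded K e r m = loops_bounded K e r' m"
proof (induction e arbitrary: r r')
  case (Fold a x n i e)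
  have "loops_bounded K e (r(x := j, a := v)) m = loops_bounded K e (r'(x := j, a := v)) m" for j v
    using Fold.prems by (intro Fold.IH) auto
  moreover have "loops_bounded K n r m = loops_bounded K n r' m"
    "loops_bounded K i r m = loops_bounded K i r' m"
    using Fold.prems by (auto intro!: Fold.IH)
  moreover have "eval n r m = eval n r' m"
    using Fold.prems by (auto intro!: eval_cong[of h])
  ultimately show ?case by simp
next
  case (Ite e1 e2 e3)
  have "eval e1 r m = eval e1 r' m"
    using Ite.prems by (auto intro!: eval_cong[of h])
  with Ite show ?case by (metis loops_bounded.simps(6) wf_exp.simps(6))
next
  case (Plus e f)
  then show ?case by (metis loops_bounded.simps(3) wf_exp.simps(3))
next
  case (Minus e f)
  then show ?case by (metis loops_bounded.simps(4) wf_exp.simps(4))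
next
  case (Mem e)
  then show ?case by (metis loops_bounded.simps(5) wf_exp.simps(5))
qed simp_all

section \<open>Total correctness with time bounds\<close>

definition run :: "prog \<Rightarrow> state \<Rightarrow> nat \<Rightarrow> (state \<Rightarrow> bool) \<Rightarrow> bool" where
  "run c s t Q \<longleftrightarrow> (\<exists>k s'. exec c s k s' \<and> k \<le> t \<and> Q s')"

lemma run_mono: "run c s t Q \<Longrightarrow> t \<le> t' \<Longrightarrow> (\<And>s. Q s \<Longrightarrow> Q' s) \<Longrightarrow> run c s t' Q'"
  unfolding run_def using le_trans by blast

lemma run_Seq:
  "run c s t R \<Longrightarrow> (\<And>s'. R s' \<Longrightarrow> run c' s' t' Q) \<Longrightarrow> run (Seq c c') s (t + t') Q"
  unfolding run_def using exec.Seq add_mono by blast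

lemma run_Const: "Q (r(x := n), m) \<Longrightarrow> 1 \<le> t \<Longrightarrow> run (Const x n) (r, m) t Q"
  unfolding run_def using exec.Const by blast

lemma run_Add: "Q (r(x := r y + r z), m) \<Longrightarrow> 1 \<le> t \<Longrightarrow> run (Add x y z) (r, m) t Q"
  unfolding run_def using exec.Add by blast

lemma run_Sub: "Q (r(x := r y - r z), m) \<Longrightarrow> 1 \<le> t \<Longrightarrow> run (Sub x y z) (r, m) t Q"
  unfolding run_def using exec.Sub by blast

lemma run_Load: "Q (r(x := m (r y)), m) \<Longrightarrow> 1 \<le> t \<Longrightarrow> run (Load x y) (r, m) t Q"
  unfolding run_def using exec.Load by blast

lemma run_Store: "Q (r, m(r x := r y)) \<Longrightarrow> 1 \<le> t \<Longrightarrow> run (Store x y) (r, m) t Q"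
  unfolding run_def using exec.Store by blast

lemma run_Seq_Const:
  "run c (r(x := n), m) t Q \<Longrightarrow> t + 1 \<le> t' \<Longrightarrow> run (Seq (Const x n) c) (r, m) t' Q"
  by (rule run_mono[OF run_Seq[OF run_Const[of "\<lambda>s. s = (r(x := n), m)" r x n m 1]]]) auto

lemma run_Seq_Add:
  "run c (r(x := r y + r z), m) t Q \<Longrightarrow> t + 1 \<le> t' \<Longrightarrow> run (Seq (Add x y z) c) (r, m) t' Q"
  by (rule run_mono[OF run_Seq[OF run_Add[of "\<lambda>s. s = (r(x := r y + r z), m)" r x y z m 1]]]) auto

lemma run_If:
  assumes "fst s x \<noteq> 0 \<Longrightarrow> run c s t Q" "fst s x = 0 \<Longrightarrow> run c' s t' Q"
  shows "run (IfNonzero x c c') s (t + t' + 1) Q"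
proof (cases "fst s x = 0")
  case True
  with assms(2) obtain k s' where "exec c' s k s'" "k \<le> t'" "Q s'"
    unfolding run_def by blast
  with True show ?thesis unfolding run_def
    by (intro exI[of _ "k + 1"] exI[of _ s'] conjI exec.IfFalse) linarith+
next
  case False
  with assms(1) obtain k s' where "exec c s k s'" "k \<le> t" "Q s'"
    unfolding run_def by blast
  with False show ?thesis unfolding run_def
    by (intro exI[of _ "k + 1"] exI[of _ s'] conjI exec.IfTrue) linarith+
qed

text \<open>The number \<open>N\<close> of iterations is known in advance, so an invariant indexed
  by the iteration replaces a termination measure. The bound \<open>t i\<close> may vary with the
  iteration because adjacency lists differ in length.\<close>

lemma run_While:
  assumes "\<And>i s. i < N \<Longrightarrow> I i s \<Longrightarrow> fst s x \<noteq> 0 \<and> run c s (t i) (I (Suc i))"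
    and "\<And>s. I N s \<Longrightarrow> fst s x = 0" and "I i s" "i \<le> N"
  shows "run (WhileNonzero x c) s ((\<Sum>j\<in>{i..<N}. t j + 1) + 1) (I N)"
  using assms(4,3)
proof (induction i arbitrary: s rule: inc_induct)
  case base
  show ?case unfolding run_def
    using base by (intro exI[of _ 1] exI[of _ s] conjI exec.WhileFalse assms(2)) simp_all
next
  case (step i)
  from assms(1)[OF \<open>i < N\<close> step.prems] obtain k s' where
    s': "fst s x \<noteq> 0" "exec c s k s'" "k \<le> t i" "I (Suc i) s'"
    unfolding run_def by blast
  from step.IH[OF s'(4)] obtain k' s'' where
    s'': "exec (WhileNonzero x c) s' k' s''" "k' \<le> (\<Sum>j\<in>{Suc i..<N}. t j + 1) + 1" "I N s''"
    unfolding run_def by blast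
  have "exec (WhileNonzero x c) s (k + k' + 1) s''"
    using s' s'' exec.WhileTrue by blast
  moreover have "k + k' + 1 \<le> (\<Sum>j\<in>{i..<N}. t j + 1) + 1"
    using s'(3) s''(2) \<open>i < N\<close> by (subst sum.atLeast_Suc_lessThan) auto
  ultimately show ?case using s''(3) unfolding run_def by blast
qed

text \<open>A value left in register \<open>h\<close> survives because the next operand is compiled
  at \<open>h + 1\<close>. The intermediate state agrees with \<open>r\<close> below
  \<open>h\<close>, so by the congruence lemmas the next operand has the same value and the same
  loop bounds there as in \<open>r\<close>.\<close>

lemma run_compile:
  "wf_exp h e \<Longrightarrow> loops_bounded K e r m \<Longrightarrow>
   run (compile h e) (r, m) (exp_time K e)
     (\<lambda>s. snd s = m \<and> fst s h = eval e r m \<and> (\<forall>i<h. fst s i = r i))"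
proof (induction e arbitrary: h r)
  case (Var i)
  have "run (compile h (Var i)) (r, m) (1 + 1)
     (\<lambda>s. snd s = m \<and> fst s h = eval (Var i) r m \<and> (\<forall>i<h. fst s i = r i))"
    unfolding compile.simps using Var
    by - (rule run_Seq_Const[where t=1], rule run_Add, (auto)+)
  then show ?case by (simp add: numeral_2_eq_2)
next
  case (Lit c)
  show ?case by (auto intro: run_Const)
next
  case (Plus e f)
  have "run (compile h (Plus e f)) (r, m) (exp_time K e + (exp_time K f + 1))
     (\<lambda>s. snd s = m \<and> fst s h = eval (Plus e f) r m \<and> (\<forall>i<h. fst s i = r i))"
    unfolding compile.simps
  proof (intro run_Seq[OF Plus.IH(1)])
    fix s assume s: "snd s = m \<and> fst s h = eval e r m \<and> (\<forall>i<h. fst s i = r i)"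
    then obtain r1 where r1: "s = (r1, m)" by (metis prod.collapse)
    have f: "loops_bounded K f r1 m" "eval f r1 m = eval f r m"
      using Plus.prems s r1 loops_bounded_cong[of h f r1 r] eval_cong[of h f r1 r] by auto
    show "run (Seq (compile (Suc h) f) (Add h h (Suc h))) s (exp_time K f + 1)
      (\<lambda>s. snd s = m \<and> fst s h = eval (Plus e f) r m \<and> (\<forall>i<h. fst s i = r i))"
      unfolding r1 using Plus.prems f s r1
      by (intro run_Seq[OF Plus.IH(2)]) (auto intro!: run_Add intro: wf_exp_mono)
  qed (use Plus.prems in auto)
  then show ?case by (simp add: add.assoc)
next
  case (Minus e f)
  have "run (compile h (Minus e f)) (r, m) (exp_time K e + (exp_time K f + 1))
     (\<lambda>s. snd s = m \<and> fst s h = eval (Minus e f) r m \<and> (\<forall>i<h. fst s i = r i))"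
    unfolding compile.simps
  proof (intro run_Seq[OF Minus.IH(1)])
    fix s assume s: "snd s = m \<and> fst s h = eval e r m \<and> (\<forall>i<h. fst s i = r i)"
    then obtain r1 where r1: "s = (r1, m)" by (metis prod.collapse)
    have f: "loops_bounded K f r1 m" "eval f r1 m = eval f r m"
      using Minus.prems s r1 loops_bounded_cong[of h f r1 r] eval_cong[of h f r1 r] by auto
    show "run (Seq (compile (Suc h) f) (Sub h h (Suc h))) s (exp_time K f + 1)
      (\<lambda>s. snd s = m \<and> fst s h = eval (Minus e f) r m \<and> (\<forall>i<h. fst s i = r i))"
      unfolding r1 using Minus.prems f s r1
      by (intro run_Seq[OF Minus.IH(2)]) (auto intro!: run_Sub intro: wf_exp_mono)
  qed (use Minus.prems in auto)
  then show ?case by (simp add: add.assoc)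
next
  case (Mem e)
  have "run (compile h (Mem e)) (r, m) (exp_time K e + 1)
     (\<lambda>s. snd s = m \<and> fst s h = eval (Mem e) r m \<and> (\<forall>i<h. fst s i = r i))"
    unfolding compile.simps using Mem.prems
    by (intro run_Seq[OF Mem.IH]) (auto intro!: run_Load)
  then show ?case by simp
next
  case (Ite c e f)
  let ?Q = "\<lambda>s. snd s = m \<and> fst s h = eval (Ite c e f) r m \<and> (\<forall>i<h. fst s i = r i)"
  have "run (compile h (Ite c e f)) (r, m) (exp_time K c + (exp_time K e + exp_time K f + 1)) ?Q"
    unfolding compile.simps
  proof (intro run_Seq[OF Ite.IH(1)])
    fix s assume s: "snd s = m \<and> fst s h = eval c r m \<and> (\<forall>i<h. fst s i = r i)"
    then obtain r1 where r1: "s = (r1, m)" by (metis prod.collapse)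
    have f: "loops_bounded K f r1 m = loops_bounded K f r m" "eval f r1 m = eval f r m"
       "loops_bounded K e r1 m = loops_bounded K e r m" "eval e r1 m = eval e r m"
      using Ite.prems s r1 loops_bounded_cong[of h f r1 r] eval_cong[of h f r1 r]
         loops_bounded_cong[of h e r1 r] eval_cong[of h e r1 r] by auto
    show "run (IfNonzero h (compile h e) (compile h f)) s (exp_time K e + exp_time K f + 1) ?Q"
      unfolding r1
    proof (rule run_If)
      assume "fst (r1, m) h \<noteq> 0"
      then show "run (compile h e) (r1, m) (exp_time K e) ?Q"
        using Ite.prems f s r1 by (intro run_mono[OF Ite.IH(2)]) auto
    next
      assume "fst (r1, m) h = 0"
      then show "run (compile h f) (r1, m) (exp_time K f) ?Q"
        using Ite.prems f s r1 by (intro run_mono[OF Ite.IH(3)]) auto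
    qed
  qed (use Ite.prems in auto)
  then show ?case by (simp add: add.assoc)
next
  case (Fold a x n i e)
  note ax = Fold.prems(1)
  let ?N = "eval n r m"
  define F where "F = rec_nat (eval i r m) (\<lambda>j v. eval e (r(x := j, a := v)) m)"
  let ?Q = "\<lambda>s. snd s = m \<and> fst s h = F ?N \<and> (\<forall>i<h. fst s i = r i)"
  \<comment> \<open>Register \<open>h\<close> counts the remaining iterations down;
    \<open>h + 2\<close> and \<open>h + 3\<close> keep the outer values of \<open>a\<close> and
    \<open>x\<close>. The body is compiled at \<open>h + 4\<close> and therefore spares all of
    them.\<close>
  define I where "I j s \<longleftrightarrow> snd s = m \<and> fst s h = ?N - j \<and> fst s (h + 2) = r a \<and> fst s (h + 3) = r x \<and>
      (\<forall>i<h. fst s i = (r(x := j, a := F j)) i)" for j and s :: state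
  have body: "run (Seq (compile (h + 4) e)
              (Seq (Const (h + 5) 0) (Seq (Add a (h + 4) (h + 5)) (Seq (Const (h + 5) 1)
              (Seq (Add x x (h + 5)) (Sub h h (h + 5)))))))
              s (exp_time K e + (1 + (1 + (1 + (1 + 1))))) (I (Suc j))"
    if j: "j < ?N" and Ij: "I j s" for j s
  proof -
    obtain r1 where r1: "s = (r1, m)" using Ij I_def by (metis prod.collapse)
    have e: "loops_bounded K e r1 m" "eval e r1 m = F (Suc j)"
      using Fold.prems Ij j loops_bounded_cong[of h e r1 "r(x := j, a := F j)"]
        eval_cong[of h e r1 "r(x := j, a := F j)"]
      by (auto simp: I_def r1 F_def)
    have wf: "wf_exp (h + 4) e" using ax wf_exp_mono[of h e] by auto
    show ?thesis
      unfolding r1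
    proof (rule run_Seq[OF Fold.IH(3)[OF wf e(1)]])
      fix s' assume s': "snd s' = m \<and> fst s' (h + 4) = eval e r1 m \<and> (\<forall>i<h + 4. fst s' i = r1 i)"
      obtain r2 where r2: "s' = (r2, m)" using s' by (metis prod.collapse)
      define r3 where "r3 = r2(h + 5 := 0, a := F (Suc j), h + 5 := 1, x := r2 x + 1, h := r2 h - 1)"
      have "I (Suc j) (r3, m)"
        using s' Ij ax unfolding I_def r1 r2 r3_def by auto
      then show "run (Seq (Const (h + 5) 0) (Seq (Add a (h + 4) (h + 5)) (Seq (Const (h + 5) 1)
              (Seq (Add x x (h + 5)) (Sub h h (h + 5))))))
              s' (1 + (1 + (1 + (1 + 1)))) (I (Suc j))"
        unfolding r2 using s' ax e(2)
        by - (rule run_Seq_Const[where t=4], rule run_Seq_Add[where t=3], rule run_Seq_Const[where t=2],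
            rule run_Seq_Add[where t=1], rule run_Sub, (auto simp: r2 r3_def)+)
    qed
  qed
  have "run (compile h (Fold a x n i e)) (r, m)
     ((exp_time K n + exp_time K i) + ((1 + (1 + (1 + (1 + 1)))) +
     (((\<Sum>j\<in>{0..<?N}. (exp_time K e + (1 + (1 + (1 + (1 + 1))))) + 1) + 1) + (1 + (1 + (1 + 1)))))) ?Q"
    unfolding compile.simps
  proof (rule run_Seq)
    show "run (Seq (compile h n) (compile (h + 1) i)) (r, m) (exp_time K n + exp_time K i)
      (\<lambda>s. snd s = m \<and> fst s h = ?N \<and> fst s (h + 1) = F 0 \<and> (\<forall>i<h. fst s i = r i))"
    proof (rule run_Seq[OF Fold.IH(1)])
      fix s assume s: "snd s = m \<and> fst s h = ?N \<and> (\<forall>i<h. fst s i = r i)"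
      then obtain r1 where r1: "s = (r1, m)" by (metis prod.collapse)
      have f: "loops_bounded K i r1 m" "eval i r1 m = eval i r m"
        using Fold.prems s r1 loops_bounded_cong[of h i r1 r] eval_cong[of h i r1 r] by auto
      show "run (compile (h + 1) i) s (exp_time K i)
        (\<lambda>s. snd s = m \<and> fst s h = ?N \<and> fst s (h + 1) = F 0 \<and> (\<forall>i<h. fst s i = r i))"
        unfolding r1 using Fold.prems f s r1
        by (intro run_mono[OF Fold.IH(2)]) (auto intro: wf_exp_mono simp: F_def)
    qed (use Fold.prems in auto)
    fix s assume s: "snd s = m \<and> fst s h = ?N \<and> fst s (h + 1) = F 0 \<and> (\<forall>i<h. fst s i = r i)"
    then obtain r1 where r1: "s = (r1, m)" by (metis prod.collapse)
    define r2 where "r2 = r1(h + 4 := 0, h + 2 := r a, h + 3 := r x, a := F 0, x := 0)"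
    have "I 0 (r2, m)" using s ax unfolding r1 r2_def I_def by auto
    then have I0: "run (Seq (Const (h + 4) 0) (Seq (Add (h + 2) a (h + 4)) (Seq (Add (h + 3) x (h + 4))
              (Seq (Add a (h + 1) (h + 4)) (Const x 0))))) s (1 + (1 + (1 + (1 + 1)))) (I 0)"
      unfolding r1 using s ax
      by - (rule run_Seq_Const[where t=4], rule run_Seq_Add[where t=3], rule run_Seq_Add[where t=2],
          rule run_Seq_Add[where t=1], rule run_Const, (auto simp: r1 r2_def)+)
    show "run (Seq (Seq (Const (h + 4) 0) (Seq (Add (h + 2) a (h + 4)) (Seq (Add (h + 3) x (h + 4))
              (Seq (Add a (h + 1) (h + 4)) (Const x 0)))))
        (Seq (WhileNonzero h
            (Seq (compile (h + 4) e)
              (Seq (Const (h + 5) 0) (Seq (Add a (h + 4) (h + 5)) (Seq (Const (h + 5) 1)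
              (Seq (Add x x (h + 5)) (Sub h h (h + 5))))))))
         (Seq (Const (h + 4) 0) (Seq (Add h a (h + 4)) (Seq (Add a (h + 2) (h + 4))
              (Add x (h + 3) (h + 4))))))) s
        ((1 + (1 + (1 + (1 + 1)))) +
     (((\<Sum>j\<in>{0..<?N}. (exp_time K e + (1 + (1 + (1 + (1 + 1))))) + 1) + 1) + (1 + (1 + (1 + 1))))) ?Q"
    proof (intro run_Seq[OF I0] run_Seq[OF run_While[where N="?N" and I=I]])
      fix s assume "I 0 s" then show "I 0 s" .
    next
      fix j s assume "j < ?N" "I j s"
      then show "fst s h \<noteq> 0 \<and> run (Seq (compile (h + 4) e)
              (Seq (Const (h + 5) 0) (Seq (Add a (h + 4) (h + 5)) (Seq (Const (h + 5) 1)
              (Seq (Add x x (h + 5)) (Sub h h (h + 5)))))))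
              s (exp_time K e + (1 + (1 + (1 + (1 + 1))))) (I (Suc j))"
        using body unfolding I_def by auto
    next
      fix s assume "I ?N s"
      then show "fst s h = 0" by (simp add: I_def)
    next
      fix s assume IN: "I ?N s"
      then obtain r1 where r1: "s = (r1, m)" unfolding I_def by (metis prod.collapse)
      show "run (Seq (Const (h + 4) 0) (Seq (Add h a (h + 4)) (Seq (Add a (h + 2) (h + 4))
              (Add x (h + 3) (h + 4))))) s (1 + (1 + (1 + 1))) ?Q"
        unfolding r1 using IN ax
        by - (rule run_Seq_Const[where t=3], rule run_Seq_Add[where t=2], rule run_Seq_Add[where t=1],
            rule run_Add, (auto simp: r1 I_def)+)
    qed simp_all
  qed
  moreover have "?N * (exp_time K e + 6) \<le> K * (exp_time K e + 6)"
    using Fold.prems by (intro mult_right_mono) auto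
  ultimately show ?case
    by (elim run_mono) (auto simp: F_def algebra_simps)
qed

text \<open>Bounds of this shape are closed under sums and under multiplication by \<open>K\<close>,
  and \<open>exp_time\<close> is built from constants by these two operations. The base
  \<open>K + 1\<close> is at least one, so exponents can be raised freely.\<close>

lemma exp_time_polynomial: "\<exists>A D. \<forall>K. exp_time K e \<le> A * (K + 1) ^ D"
proof (induction e)
  have add: "\<exists>A D. \<forall>K. f K + g K \<le> A * (K + 1) ^ D"
    if "\<exists>A D. \<forall>K. f K \<le> A * (K + 1) ^ D" "\<exists>A D. \<forall>K. g K \<le> A * (K + 1) ^ D"
    for f g :: "nat \<Rightarrow> nat"
  proof -
    from that obtain A D B F where AD: "\<And>K. f K \<le> A * (K + 1) ^ D" and BF: "\<And>K. g K \<le> B * (K + 1) ^ F"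
      by blast
    have "f K + g K \<le> (A + B) * (K + 1) ^ (D + F)" for K
    proof -
      have "A * (K + 1) ^ D \<le> A * (K + 1) ^ (D + F)" "B * (K + 1) ^ F \<le> B * (K + 1) ^ (D + F)"
        by (auto intro!: mult_left_mono power_increasing)
      then show ?thesis using AD[of K] BF[of K] by (simp only: distrib_right)
    qed
    then show ?thesis by blast
  qed
  have const: "\<exists>A D. \<forall>K. c \<le> A * (K + 1) ^ D" for c :: nat
    by (intro exI[of _ c] exI[of _ 0]) simp
  have mult: "\<exists>A D. \<forall>K. K * f K \<le> A * (K + 1) ^ D"
    if "\<exists>A D. \<forall>K. f K \<le> A * (K + 1) ^ D" for f :: "nat \<Rightarrow> nat"
  proof -
    from that obtain A D where AD: "\<And>K. f K \<le> A * (K + 1) ^ D" by blast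
    have "K * f K \<le> A * (K + 1) ^ Suc D" for K
      using mult_mono[of K "K + 1" "f K" "A * (K + 1) ^ D"] AD[of K] by (simp add: mult.left_commute)
    then show ?thesis by blast
  qed
  {
    case (Var i) show ?case unfolding exp_time.simps by (rule const)
  next
    case (Lit c) show ?case unfolding exp_time.simps by (rule const)
  next
    case (Plus e f) then show ?case unfolding exp_time.simps by (intro add const)
  next
    case (Minus e f) then show ?case unfolding exp_time.simps by (intro add const)
  next
    case (Mem e) then show ?case unfolding exp_time.simps by (intro add const)
  next
    case (Ite c e f) then show ?case unfolding exp_time.simps by (intro add const)
  next
    case (Fold a x n i e) then show ?case unfolding exp_time.simps by (intro add mult const)
  }
qed

section \<open>Local boxicity\<close>

text \<open>\<open>f k 0 v\<close> and \<open>f k 1 v\<close> are the ends of the interval of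
  \<open>v\<close> in dimension \<open>k\<close>. The case \<open>u = v\<close> makes the intervals
  nonempty; pairs that share no bag are left free.\<close>

definition local_representation ::
    "nat set set \<Rightarrow> nat set list \<Rightarrow> nat \<Rightarrow> (nat \<Rightarrow> nat \<Rightarrow> nat \<Rightarrow> real) \<Rightarrow> bool" where
  "local_representation E Ws d f \<longleftrightarrow>
     (\<forall>W\<in>set Ws. \<forall>u\<in>W. \<forall>v\<in>W.
        (u = v \<or> {u, v} \<in> E) \<longleftrightarrow> (\<forall>k<d. f k 0 u \<le> f k 1 v \<and> f k 0 v \<le> f k 1 u))"

definition local_boxicity_le :: "nat set set \<Rightarrow> nat set list \<Rightarrow> nat \<Rightarrow> bool" where
  "local_boxicity_le E Ws d \<longleftrightarrow> (\<exists>f. local_representation E Ws d f)"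

lemma aligned_boxes_meet_iff:
  assumes "\<forall>i<d. a i \<le> b i" "\<forall>i<d. a' i \<le> b' i"
  shows "aligned_box d a b \<inter> aligned_box d a' b' \<noteq> {} \<longleftrightarrow> (\<forall>i<d. a i \<le> b' i \<and> a' i \<le> b i)"
proof -
  have "aligned_box d a b \<inter> aligned_box d a' b' = (\<Pi>\<^sub>E i\<in>{..<d}. {a i..b i} \<inter> {a' i..b' i})"
    unfolding aligned_box_def by (rule PiE_Int)
  then show ?thesis using assms by (auto simp: PiE_eq_empty_iff Int_atLeastAtMost)
qed

lemma box_representation_imp_local:
  assumes "path_decomposition V E Ws" "box_representation V E d a b"
  shows "local_representation E Ws d (\<lambda>k e v. if e = 0 then a v k else b v k)"
proof -
  have "(u = v \<or> {u, v} \<in> E) \<longleftrightarrow> (\<forall>k<d. a u k \<le> b v k \<and> a v k \<le> b u k)"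
    if "u \<in> V" "v \<in> V" for u v
  proof (cases "u = v")
    case True
    then show ?thesis using assms(2) that unfolding box_representation_def by auto
  next
    case False
    then show ?thesis
      using assms(2) that aligned_boxes_meet_iff[of d "a u" "b u" "a v" "b v"]
      unfolding box_representation_def by auto
  qed
  moreover have "W \<subseteq> V" if "W \<in> set Ws" for W
    using assms(1) that unfolding path_decomposition_def by auto
  ultimately show ?thesis unfolding local_representation_def by (auto; blast)
qed

section \<open>Bag intervals and the comparison with the boxicity\<close>

definition first_bag :: "nat set list \<Rightarrow> nat \<Rightarrow> nat" where
  "first_bag Ws v = Min {i. i < length Ws \<and> v \<in> Ws ! i}"

definition last_bag :: "nat set list \<Rightarrow> nat \<Rightarrow> nat" where
  "last_bag Ws v = Max {i. i < length Ws \<and> v \<in> Ws ! i}"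

lemma bag_interval:
  assumes "path_decomposition V E Ws" "v \<in> V"
  shows "first_bag Ws v < length Ws" "v \<in> Ws ! first_bag Ws v"
    "last_bag Ws v < length Ws" "v \<in> Ws ! last_bag Ws v"
    "\<And>i. i < length Ws \<Longrightarrow> v \<in> Ws ! i \<longleftrightarrow> first_bag Ws v \<le> i \<and> i \<le> last_bag Ws v"
proof -
  let ?I = "{i. i < length Ws \<and> v \<in> Ws ! i}"
  have fin: "finite ?I" by simp
  have ne: "?I \<noteq> {}" using assms unfolding path_decomposition_def by (auto simp: in_set_conv_nth)
  have first: "first_bag Ws v \<in> ?I" unfolding first_bag_def using fin ne by (rule Min_in)
  have last: "last_bag Ws v \<in> ?I" unfolding last_bag_def using fin ne by (rule Max_in)
  show "first_bag Ws v < length Ws" "v \<in> Ws ! first_bag Ws v"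
    "last_bag Ws v < length Ws" "v \<in> Ws ! last_bag Ws v"
    using first last by auto
  fix i assume i: "i < length Ws"
  show "v \<in> Ws ! i \<longleftrightarrow> first_bag Ws v \<le> i \<and> i \<le> last_bag Ws v"
  proof
    assume "v \<in> Ws ! i"
    then show "first_bag Ws v \<le> i \<and> i \<le> last_bag Ws v"
      unfolding first_bag_def last_bag_def using fin i by auto
  next
    assume "first_bag Ws v \<le> i \<and> i \<le> last_bag Ws v"
    then show "v \<in> Ws ! i"
      using assms(1) first last unfolding path_decomposition_def by blast
  qed
qed

lemma share_bag_iff:
  assumes "path_decomposition V E Ws" "u \<in> V" "v \<in> V"
  shows "(\<exists>W\<in>set Ws. u \<in> W \<and> v \<in> W) \<longleftrightarrow>
    first_bag Ws u \<le> last_bag Ws v \<and> first_bag Ws v \<le> last_bag Ws u"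
proof
  assume "\<exists>W\<in>set Ws. u \<in> W \<and> v \<in> W"
  then obtain i where "i < length Ws" "u \<in> Ws ! i" "v \<in> Ws ! i" by (auto simp: in_set_conv_nth)
  then show "first_bag Ws u \<le> last_bag Ws v \<and> first_bag Ws v \<le> last_bag Ws u"
    using bag_interval(5)[OF assms(1,2)] bag_interval(5)[OF assms(1,3)] by force
next
  assume *: "first_bag Ws u \<le> last_bag Ws v \<and> first_bag Ws v \<le> last_bag Ws u"
  let ?i = "max (first_bag Ws u) (first_bag Ws v)"
  have "first_bag Ws u \<le> last_bag Ws u" "first_bag Ws v \<le> last_bag Ws v"
    using bag_interval[OF assms(1,2)] bag_interval[OF assms(1,3)] by auto
  then have "?i < length Ws" "u \<in> Ws ! ?i" "v \<in> Ws ! ?i"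
    using * bag_interval[OF assms(1,2)] bag_interval[OF assms(1,3)] by auto
  then show "\<exists>W\<in>set Ws. u \<in> W \<and> v \<in> W" by (meson nth_mem)
qed

text \<open>The bags containing a vertex form an interval; this one extra dimension separates all pairs
  of vertices that share no bag.\<close>

lemma local_imp_box_representation:
  assumes pd: "path_decomposition V E Ws" and loc: "local_representation E Ws d f"
  shows "box_representation V E (Suc d)
    (\<lambda>v k. if k < d then f k 0 v else real (first_bag Ws v))
    (\<lambda>v k. if k < d then f k 1 v else real (last_bag Ws v))"
proof -
  define a where "a v k = (if k < d then f k 0 v else real (first_bag Ws v))" for v k
  define b where "b v k = (if k < d then f k 1 v else real (last_bag Ws v))" for v k
  have le: "a v k \<le> b v k" if "v \<in> V" for v k
  proof -
    have "v \<in> \<Union>(set Ws)" using pd that unfolding path_decomposition_def by simp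
    then obtain W where "W \<in> set Ws" "v \<in> W" by blast
    then have "\<forall>k<d. f k 0 v \<le> f k 1 v"
      using loc unfolding local_representation_def by blast
    moreover have "first_bag Ws v \<le> last_bag Ws v" using bag_interval[OF pd that] by auto
    ultimately show ?thesis by (auto simp: a_def b_def)
  qed
  moreover have "{u, v} \<in> E \<longleftrightarrow>
      aligned_box (Suc d) (a u) (b u) \<inter> aligned_box (Suc d) (a v) (b v) \<noteq> {}"
    if uv: "u \<in> V" "v \<in> V" "u \<noteq> v" for u v
  proof -
    have "\<forall>k<Suc d. a u k \<le> b u k" "\<forall>k<Suc d. a v k \<le> b v k"
      using le[OF uv(1)] le[OF uv(2)] by blast+
    then have "aligned_box (Suc d) (a u) (b u) \<inter> aligned_box (Suc d) (a v) (b v) \<noteq> {} \<longleftrightarrow>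
        (\<forall>k<Suc d. a u k \<le> b v k \<and> a v k \<le> b u k)"
      by (rule aligned_boxes_meet_iff)
    also have "\<dots> \<longleftrightarrow> (\<forall>k<d. f k 0 u \<le> f k 1 v \<and> f k 0 v \<le> f k 1 u) \<and>
        (\<exists>W\<in>set Ws. u \<in> W \<and> v \<in> W)"
      using share_bag_iff[OF pd uv(1,2)] by (simp add: All_less_Suc a_def b_def) blast
    also have "\<dots> \<longleftrightarrow> {u, v} \<in> E"
    proof -
      have "\<forall>e\<in>E. \<exists>W\<in>set Ws. e \<subseteq> W"
        using pd unfolding path_decomposition_def by simp
      then have "\<exists>W\<in>set Ws. u \<in> W \<and> v \<in> W" if "{u, v} \<in> E"
        using that by (metis insert_subset)
      moreover have "{u, v} \<in> E \<longleftrightarrow> (\<forall>k<d. f k 0 u \<le> f k 1 v \<and> f k 0 v \<le> f k 1 u)"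
        if "W \<in> set Ws" "u \<in> W" "v \<in> W" for W
        using loc uv(3) that unfolding local_representation_def by blast
      ultimately show ?thesis by blast
    qed
    finally show ?thesis by simp
  qed
  ultimately have "box_representation V E (Suc d) a b" unfolding box_representation_def by blast
  then show ?thesis by (simp add: a_def[abs_def] b_def[abs_def])
qed

lemma local_boxicity_le_Suc:
  assumes "local_boxicity_le E Ws d" shows "local_boxicity_le E Ws (Suc d)"
proof -
  obtain f where f: "local_representation E Ws d f"
    using assms unfolding local_boxicity_le_def by blast
  \<comment> \<open>All intervals of the added dimension are the point 0, so it separates
    nothing.\<close>
  have "local_representation E Ws (Suc d) (\<lambda>k e v. if k < d then f k e v else 0)"
    using f unfolding local_representation_def by (simp add: All_less_Suc)
  then show ?thesis unfolding local_boxicity_le_def by blast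
qed

lemma local_boxicity_le_mono:
  "local_boxicity_le E Ws d \<Longrightarrow> d \<le> d' \<Longrightarrow> local_boxicity_le E Ws d'"
  by (rule dec_induct[of d d']) (auto intro: local_boxicity_le_Suc)

text \<open>A box representation yields a local one of the same dimension, which gives the lower
  bound. A local one becomes global at the price of one dimension, which gives the upper bound and
  shows that the minimum in \<open>boxicity\<close> is attained.\<close>

lemma boxicity_approximation:
  assumes pd: "path_decomposition V E Ws" and d: "local_boxicity_le E Ws d"
    and least: "\<And>d'. local_boxicity_le E Ws d' \<Longrightarrow> d \<le> d'"
  shows "d \<le> boxicity V E" "boxicity V E \<le> d + 1"
proof -
  have ex: "\<exists>a b. box_representation V E (Suc d) a b"
    using local_imp_box_representation[OF pd] d unfolding local_boxicity_le_def by blast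
  then show "boxicity V E \<le> d + 1" unfolding boxicity_def by (simp add: Least_le)
  have "\<exists>a b. box_representation V E (boxicity V E) a b"
    unfolding boxicity_def by (rule LeastI) (rule ex)
  then show "d \<le> boxicity V E"
    using box_representation_imp_local[OF pd] least unfolding local_boxicity_le_def by blast
qed

section \<open>The bag size bounds the local boxicity\<close>

lemma inj_on_extend_finite:
  fixes b :: nat
  assumes "finite X" "C \<subseteq> X" "inj_on f C" "f ` C \<subseteq> {..<b}" "card X \<le> b"
  obtains g where "inj_on g X" "g ` X \<subseteq> {..<b}" "\<And>x. x \<in> C \<Longrightarrow> g x = f x"
proof -
  have "finite C" using assms finite_subset by blast
  have "card (X - C) \<le> card ({..<b} - f ` C)"
    using assms \<open>finite C\<close> by (simp add: card_Diff_subset card_image)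
  then obtain h where h: "h ` (X - C) \<subseteq> {..<b} - f ` C" "inj_on h (X - C)"
    using card_le_inj[of "X - C" "{..<b} - f ` C"] assms(1) by auto
  show thesis
  proof (rule that[of "\<lambda>x. if x \<in> C then f x else h x"])
    show "inj_on (\<lambda>x. if x \<in> C then f x else h x) X"
      using assms(3) h unfolding inj_on_def by (auto; blast)
  qed (use assms h in auto)
qed

text \<open>Greedy colouring along the path. By \<open>conv\<close> the vertices of a new bag that
  are already coloured all lie in the bag before it, where their colours are distinct; as the new
  bag has at most \<open>b\<close> vertices, enough colours remain for the others.\<close>

lemma bag_coloring:
  assumes conv: "\<And>i j k. i \<le> k \<Longrightarrow> k \<le> j \<Longrightarrow> j < length Ws \<Longrightarrow> Ws ! i \<inter> Ws ! j \<subseteq> Ws ! k"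
    and card: "\<And>W. W \<in> set Ws \<Longrightarrow> finite W \<and> card W \<le> b"
  shows "\<exists>c. \<forall>W\<in>set Ws. inj_on c W \<and> c ` W \<subseteq> {..<b}"
proof -
  have "\<exists>c. \<forall>i<t. inj_on c (Ws ! i) \<and> c ` (Ws ! i) \<subseteq> {..<b}" if "t \<le> length Ws" for t
    using that
  proof (induction t)
    case (Suc t)
    then obtain c where c: "\<And>i. i < t \<Longrightarrow> inj_on c (Ws ! i) \<and> c ` (Ws ! i) \<subseteq> {..<b}" by auto
    define C where "C = (if t = 0 then {} else Ws ! (t - 1) \<inter> Ws ! t)"
    have C: "inj_on c C" "c ` C \<subseteq> {..<b}"
      using c[of "t - 1"] by (auto simp: C_def inj_on_def image_subset_iff)
    have "finite (Ws ! t)" "card (Ws ! t) \<le> b" "C \<subseteq> Ws ! t"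
      using card[of "Ws ! t"] Suc.prems by (auto simp: C_def)
    then obtain g where g: "inj_on g (Ws ! t)" "g ` (Ws ! t) \<subseteq> {..<b}" "\<And>x. x \<in> C \<Longrightarrow> g x = c x"
      using inj_on_extend_finite[OF _ _ C] by blast
    define c' where "c' x = (if x \<in> Ws ! t then g x else c x)" for x
    have "inj_on c' (Ws ! i) \<and> c' ` (Ws ! i) \<subseteq> {..<b}" if "i < Suc t" for i
    proof (cases "i = t")
      case True
      then show ?thesis using g(1,2) by (auto simp: c'_def inj_on_def)
    next
      case False
      then have "i < t" using that by simp
      \<comment> \<open>An earlier bag meets bag \<open>t\<close> only inside \<open>C\<close>,
        where \<open>g\<close> extends \<open>c\<close>, so its colours do not change.\<close>
      then have "Ws ! i \<inter> Ws ! t \<subseteq> C"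
        using conv[of i "t - 1" t] Suc.prems by (auto simp: C_def)
      then have "c' x = c x" if "x \<in> Ws ! i" for x
        using g(3) that by (auto simp: c'_def)
      then show ?thesis using c[OF \<open>i < t\<close>] by (auto simp: inj_on_def)
    qed
    then show ?case by blast
  qed simp
  from this[of "length Ws"] show ?thesis by (metis in_set_conv_nth order_refl)
qed

text \<open>Colour the vertices so that no bag repeats a colour, and order them by first appearance. In the
  dimension of colour \<open>c\<close> the vertices of colour \<open>c\<close> are distinct points, ordered by appearance, and any
  other vertex is a ray to the right: it meets all \<open>c\<close>-vertices that appear later, and of those
  that appear earlier at most one shares a bag with it, so the start of the ray can be chosen according to
  that single adjacency.\<close>

lemma local_boxicity_le_bag_size:
  assumes pd: "path_decomposition {..<n} E Ws"
    and card: "\<And>W. W \<in> set Ws \<Longrightarrow> card W \<le> b"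
  shows "local_boxicity_le E Ws b"
proof -
  have sub: "W \<subseteq> {..<n}" if "W \<in> set Ws" for W
    using pd that unfolding path_decomposition_def by auto
  have conv: "Ws ! i \<inter> Ws ! j \<subseteq> Ws ! k" if "i \<le> k" "k \<le> j" "j < length Ws" for i j k
    using pd that unfolding path_decomposition_def by blast
  have fin: "finite W \<and> card W \<le> b" if "W \<in> set Ws" for W
    using card[OF that] finite_subset[OF sub[OF that]] by simp
  have "\<exists>c. \<forall>W\<in>set Ws. inj_on c W \<and> c ` W \<subseteq> {..<b}"
    using conv fin by (rule bag_coloring)
  then obtain c where "\<forall>W\<in>set Ws. inj_on c W \<and> c ` W \<subseteq> {..<b}" ..
  then have c: "inj_on c W" "c ` W \<subseteq> {..<b}" if "W \<in> set Ws" for W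
    using that by simp_all
  \<comment> \<open>A lexicographic code of first bag and vertex, which breaks ties between vertices
    with the same first bag.\<close>
  define pos where "pos v = first_bag Ws v * n + v" for v
  have pos_inj: "u = v" if "pos u = pos v" "u < n" "v < n" for u v
  proof -
    have "pos u mod n = u" "pos v mod n = v" using that(2,3) by (simp_all add: pos_def)
    then show ?thesis using that(1) by metis
  qed
  have pos_first: "first_bag Ws v \<le> first_bag Ws u" if "pos v \<le> pos u" "u < n" "v < n" for u v
  proof -
    have "pos u div n = first_bag Ws u" "pos v div n = first_bag Ws v"
      using that(2,3) by (simp_all add: pos_def)
    then show ?thesis using div_le_mono[OF that(1), of n] by metis
  qed
  define near where "near u v \<longleftrightarrow> (\<exists>W\<in>set Ws. u \<in> W \<and> v \<in> W)" for u v
  \<comment> \<open>A vertex \<open>v\<close> that is no later than \<open>u\<close> and shares a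
    bag with it is present when \<open>u\<close> first appears. All such \<open>v\<close> lie in
    that one bag, so no two of them have the same colour.\<close>
  have near_first: "v \<in> Ws ! first_bag Ws u" "first_bag Ws u < length Ws" "u \<in> Ws ! first_bag Ws u"
    if uv: "near u v" "pos v \<le> pos u" for u v
  proof -
    have V: "u < n" "v < n" using uv(1) sub by (auto simp: near_def)
    then have "first_bag Ws u \<le> last_bag Ws v"
      using share_bag_iff[OF pd, of u v] uv(1) by (auto simp: near_def)
    then show "v \<in> Ws ! first_bag Ws u" "first_bag Ws u < length Ws" "u \<in> Ws ! first_bag Ws u"
      using bag_interval[OF pd, of u] bag_interval[OF pd, of v] pos_first[OF uv(2) V] V by auto
  qed
  have uniq: "v = v'" if "near u v" "pos v \<le> pos u" "near u v'" "pos v' \<le> pos u" "c v = c v'" for u v v'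
    using near_first[OF that(1,2)] near_first[OF that(3,4)] c(1) that(5) by (meson inj_onD nth_mem)
  \<comment> \<open>By \<open>uniq\<close> the choice by \<open>SOME\<close> is unambiguous.
    Starting at the neighbour's point makes the ray meet it; the default \<open>pos u\<close> lies
    strictly to the right of every earlier point.\<close>
  define start where "start k u = (if \<exists>v. near u v \<and> pos v < pos u \<and> c v = k \<and> {u, v} \<in> E
      then pos (SOME v. near u v \<and> pos v < pos u \<and> c v = k \<and> {u, v} \<in> E) else pos u)" for k u
  have start_le: "start k u \<le> pos u" for k u
    unfolding start_def by (smt (verit, best) less_imp_le order_refl someI_ex)
  have start_adj: "start k u = pos v" if "near u v" "pos v < pos u" "c v = k" "{u, v} \<in> E" for u v k
  proof -
    let ?P = "\<lambda>v. near u v \<and> pos v < pos u \<and> c v = k \<and> {u, v} \<in> E"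
    have "?P (SOME v. ?P v)" using that by (intro someI[of ?P v]) simp
    then have "(SOME v. ?P v) = v" using uniq that by (meson less_imp_le)
    then show ?thesis unfolding start_def using that by auto
  qed
  have start_nonadj: "pos v < start k u" if "near u v" "pos v < pos u" "c v = k" "{u, v} \<notin> E" for u v k
  proof -
    have "\<not> (\<exists>v'. near u v' \<and> pos v' < pos u \<and> c v' = k \<and> {u, v'} \<in> E)"
      using uniq that by (metis less_imp_le)
    then show ?thesis unfolding start_def using that by auto
  qed
  \<comment> \<open>A finite stand-in for the infinite end of the rays.\<close>
  define top where "top = (length Ws) * n + n"
  have pos_top: "pos v \<le> top" if "v < n" for v
    using bag_interval(1)[OF pd, of v] that unfolding pos_def top_def
    by (intro add_mono mult_right_mono) auto
  define f where "f k e v = real (if c v = k then pos v else if e = 0 then start k v else top)"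
    for k e v :: nat
  have main: "{u, v} \<in> E \<longleftrightarrow> (\<forall>k<b. f k 0 u \<le> f k 1 v \<and> f k 0 v \<le> f k 1 u)"
    if uv: "near u v" "pos v < pos u" for u v
  proof -
    have V: "u < n" "v < n" using uv(1) sub by (auto simp: near_def)
    have "c v \<noteq> c u"
      using uv c(1) by (auto simp: near_def dest: inj_onD)
    have cv: "c v < b" using uv(1) c(2) by (auto simp: near_def)
    have st: "start k u \<le> top" "start k v \<le> top" "start k v \<le> pos u" for k
      using start_le[of k u] start_le[of k v] pos_top V uv(2) by (meson le_trans less_imp_le)+
    show ?thesis
    proof
      assume e: "{u, v} \<in> E"
      show "\<forall>k<b. f k 0 u \<le> f k 1 v \<and> f k 0 v \<le> f k 1 u"
        using start_adj[OF uv refl e] \<open>c v \<noteq> c u\<close> st pos_top V by (auto simp: f_def)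
    next
      assume *: "\<forall>k<b. f k 0 u \<le> f k 1 v \<and> f k 0 v \<le> f k 1 u"
      \<comment> \<open>The dimension of the colour of the earlier vertex \<open>v\<close> suffices:
        there \<open>v\<close> is a point and \<open>u\<close> is a ray.\<close>
      then have "f (c v) 0 u \<le> f (c v) 1 v" using cv by blast
      then have "start (c v) u \<le> pos v" using \<open>c v \<noteq> c u\<close> by (simp add: f_def)
      then show "{u, v} \<in> E" using start_nonadj[OF uv refl] by fastforce
    qed
  qed
  have "local_representation E Ws b f"
    unfolding local_representation_def
  proof (intro ballI)
    fix W u v assume W: "W \<in> set Ws" "u \<in> W" "v \<in> W"
    then have near: "near u v" "near v u" "u < n" "v < n" using sub by (auto simp: near_def)
    consider "u = v" | "pos v < pos u" | "pos u < pos v"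
      using pos_inj near(3,4) by (meson linorder_neqE_nat)
    then show "(u = v \<or> {u, v} \<in> E) \<longleftrightarrow> (\<forall>k<b. f k 0 u \<le> f k 1 v \<and> f k 0 v \<le> f k 1 u)"
    proof cases
      case 1
      then show ?thesis
        using start_le[of _ v] pos_top[OF near(4)] by (auto simp: f_def intro: le_trans)
    next
      case 2
      then show ?thesis using main[OF near(1)] by auto
    next
      case 3
      then show ?thesis using main[OF near(2)] by (auto simp: insert_commute)
    qed
  qed
  then show ?thesis unfolding local_boxicity_le_def by blast
qed

section \<open>Dynamic programming over the bags\<close>

lemma between_finite_sets:
  fixes A B :: "real set"
  assumes "finite A" "finite B" "\<And>a b. a \<in> A \<Longrightarrow> b \<in> B \<Longrightarrow> a < b"
  obtains z where "\<And>a. a \<in> A \<Longrightarrow> a < z" "\<And>b. b \<in> B \<Longrightarrow> z < b"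
proof (cases "A = {} \<or> B = {}")
  case True
  \<comment> \<open>Inserting 0 keeps \<open>Max\<close> and \<open>Min\<close> meaningful when both
    sets are empty.\<close>
  have "a < Max (insert 0 A) + 1" if "a \<in> A" for a
    by (rule le_less_trans[OF Max_ge less_add_one]) (use that assms(1) in auto)
  moreover have "Min (insert 0 B) - 1 < b" if "b \<in> B" for b
  proof -
    have "Min (insert 0 B) \<le> b" using that assms(2) by (intro Min_le) auto
    then show ?thesis by linarith
  qed
  ultimately show thesis
    using True that[of "Max (insert 0 A) + 1"] that[of "Min (insert 0 B) - 1"] by blast
next
  case False
  then have "Max A < Min B" using assms by simp
  then obtain z where "Max A < z" "z < Min B" using dense by blast
  then show thesis using that[of z] assms(1,2) False by auto
qed

text \<open>\<open>h\<close> prescribes a weak order that \<open>f\<close> realizes on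
  \<open>C\<close>. The points of \<open>X\<close> are placed one by one: a point tied with a placed
  one takes its value, any other goes into the gap between the finitely many values below and above
  it. Ties matter, since closed intervals may meet in a common endpoint.\<close>

lemma order_embedding_extend:
  fixes h :: "'a \<Rightarrow> nat" and f :: "'a \<Rightarrow> real"
  assumes "finite X" "\<And>x y. x \<in> C \<Longrightarrow> y \<in> C \<Longrightarrow> f x < f y \<longleftrightarrow> h x < h y" "finite C"
  shows "\<exists>g. (\<forall>x\<in>C. g x = f x) \<and> (\<forall>x\<in>C \<union> X. \<forall>y\<in>C \<union> X. g x < g y \<longleftrightarrow> h x < h y)"
  using assms(1)
proof (induction X rule: finite_induct)
  case empty
  show ?case using assms(2) by (intro exI[of _ f]) auto
next
  case (insert z X)
  then obtain g where g: "\<And>x. x \<in> C \<Longrightarrow> g x = f x"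
      "\<And>x y. x \<in> C \<union> X \<Longrightarrow> y \<in> C \<union> X \<Longrightarrow> g x < g y \<longleftrightarrow> h x < h y" by auto
  show ?case
  proof (cases "z \<in> C \<union> X")
    case True
    then have "C \<union> insert z X = C \<union> X" by auto
    then show ?thesis using g by (intro exI[of _ g]) auto
  next
    case False
    obtain p where p: "\<And>x. x \<in> C \<union> X \<Longrightarrow> g x < p \<longleftrightarrow> h x < h z" "\<And>x. x \<in> C \<union> X \<Longrightarrow> p < g x \<longleftrightarrow> h z < h x"
    proof (cases "\<exists>x\<in>C \<union> X. h x = h z")
      case True
      then obtain x where "x \<in> C \<union> X" "h x = h z" by blast
      then show ?thesis using that[of "g x"] g(2) by metis
    next
      case False
      obtain p where "\<And>a. a \<in> g ` {x \<in> C \<union> X. h x < h z} \<Longrightarrow> a < p"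
        "\<And>b. b \<in> g ` {x \<in> C \<union> X. h z < h x} \<Longrightarrow> p < b"
        by (rule between_finite_sets[of "g ` {x \<in> C \<union> X. h x < h z}" "g ` {x \<in> C \<union> X. h z < h x}"])
           (use insert.hyps assms(3) g(2) in auto)
      then have "h x < h z \<Longrightarrow> g x < p" "h z < h x \<Longrightarrow> p < g x" "h x \<noteq> h z" if "x \<in> C \<union> X" for x
        using False that by auto
      then show ?thesis using that[of p] by (metis less_asym linorder_neqE_nat)
    qed
    define g' where "g' = g(z := p)"
    have "\<forall>x\<in>C. g' x = f x" using g(1) False by (auto simp: g'_def)
    moreover have "\<forall>x\<in>C \<union> insert z X. \<forall>y\<in>C \<union> insert z X. g' x < g' y \<longleftrightarrow> h x < h y"
      using g(2) p False by (auto simp: g'_def)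
    ultimately show ?thesis by blast
  qed
qed

lemma digits_exist:
  fixes N :: nat
  assumes "\<And>q. q < L \<Longrightarrow> \<delta> q < N"
  shows "\<exists>s<N ^ L. \<forall>q<L. s div N ^ q mod N = \<delta> q"
  using assms
proof (induction L)
  case (Suc L)
  then obtain s where s: "s < N ^ L" "\<And>q. q < L \<Longrightarrow> s div N ^ q mod N = \<delta> q" by auto
  have L: "\<delta> L < N" using Suc.prems by simp
  then have N: "N > 0" by simp
  let ?s = "s + \<delta> L * N ^ L"
  have "?s < N ^ L + \<delta> L * N ^ L" using s(1) by simp
  also have "\<dots> = Suc (\<delta> L) * N ^ L" by simp
  also have "\<dots> \<le> N * N ^ L" using L by (intro mult_right_mono) auto
  finally have "?s < N ^ Suc L" by simp
  moreover have "?s div N ^ q mod N = \<delta> q" if "q < Suc L" for q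
  proof (cases "q = L")
    case True
    then show ?thesis using s(1) L by simp
  next
    case False
    then have q: "q < L" using that by simp
    then have "L = q + Suc (L - q - 1)" by simp
    then have "N ^ L = N ^ q * (N * N ^ (L - q - 1))" by (metis power_Suc power_add)
    then have "?s = s + (\<delta> L * (N * N ^ (L - q - 1))) * N ^ q" by simp
    then have "?s div N ^ q = s div N ^ q + \<delta> L * (N * N ^ (L - q - 1))"
      using N by (simp only: div_mult_self1 power_not_zero neq0_conv add.commute simp_thms)
    then show ?thesis using s(2)[OF q] by (simp add: mult.left_commute)
  qed
  ultimately show ?case by blast
qed simp

text \<open>A state of a bag is a number below \<open>(2b)\<^bsup>2bd\<^esup>\<close>: its digits in base \<open>2b\<close> are the
  positions of the left (\<open>e = 0\<close>) and right (\<open>e = 1\<close>) endpoints of the interval of the \<open>i\<close>-th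
  vertex of the bag in dimension \<open>k\<close>.\<close>

definition endpoint :: "nat \<Rightarrow> nat \<Rightarrow> nat \<Rightarrow> nat \<Rightarrow> nat \<Rightarrow> nat" where
  "endpoint b s k e i = s div (2 * b) ^ (2 * b * k + e * b + i) mod (2 * b)"

definition valid_state :: "nat set set \<Rightarrow> nat \<Rightarrow> nat \<Rightarrow> nat list \<Rightarrow> nat \<Rightarrow> bool" where
  "valid_state E d b B s \<longleftrightarrow> (\<forall>i<length B. \<forall>j<length B.
     (B ! i = B ! j \<or> {B ! i, B ! j} \<in> E) \<longleftrightarrow>
     (\<forall>k<d. endpoint b s k 0 i \<le> endpoint b s k 1 j \<and> endpoint b s k 0 j \<le> endpoint b s k 1 i))"

text \<open>Positions express only an order within one bag, so a common vertex may carry different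
  digits in the two states; what has to agree is the order. Separate indices for the two bags are
  used because a vertex may stand at different places in the two lists.\<close>

definition compatible_states :: "nat \<Rightarrow> nat \<Rightarrow> nat list \<Rightarrow> nat \<Rightarrow> nat list \<Rightarrow> nat \<Rightarrow> bool" where
  "compatible_states d b B s B' s' \<longleftrightarrow>
     (\<forall>i<length B. \<forall>i'<length B. \<forall>j<length B'. \<forall>j'<length B'.
       B ! i = B' ! j \<and> B ! i' = B' ! j' \<longrightarrow>
       (\<forall>k<d. \<forall>e<2. \<forall>e'<2.
          endpoint b s k e i < endpoint b s k e' i' \<longleftrightarrow>
          endpoint b s' k e j < endpoint b s' k e' j'))"

definition prev_bag :: "nat list list \<Rightarrow> nat \<Rightarrow> nat list" where
  "prev_bag Bs t = (if t = 0 then [] else Bs ! (t - 1))"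

text \<open>Stage \<open>Suc t\<close> consists of states of bag \<open>t\<close>. Stage
  \<open>0\<close> is a dummy state of the empty bag in front of the path, with which every state is
  compatible.\<close>

primrec reachable :: "nat set set \<Rightarrow> nat \<Rightarrow> nat \<Rightarrow> nat list list \<Rightarrow> nat \<Rightarrow> nat set" where
  "reachable E d b Bs 0 = {0}"
| "reachable E d b Bs (Suc t) = {s'. s' < (2 * b) ^ (2 * b * d) \<and> valid_state E d b (Bs ! t) s' \<and>
     (\<exists>s\<in>reachable E d b Bs t. compatible_states d b (prev_bag Bs t) s (Bs ! t) s')}"

text \<open>An equivalence for strict comparisons of all pairs fixes ties as well, hence also the
  comparisons by \<open>\<le>\<close> that decide adjacency.\<close>

definition realizes :: "nat \<Rightarrow> nat \<Rightarrow> (nat \<Rightarrow> nat \<Rightarrow> nat \<Rightarrow> real) \<Rightarrow> nat list \<Rightarrow> nat \<Rightarrow> bool" where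
  "realizes d b f B s \<longleftrightarrow> (\<forall>k<d. \<forall>e<2. \<forall>e'<2. \<forall>i<length B. \<forall>i'<length B.
     endpoint b s k e i < endpoint b s k e' i' \<longleftrightarrow> f k e (B ! i) < f k e' (B ! i'))"

lemma realizes_le:
  "realizes d b f B s \<Longrightarrow> k < d \<Longrightarrow> e < 2 \<Longrightarrow> e' < 2 \<Longrightarrow> i < length B \<Longrightarrow> i' < length B \<Longrightarrow>
   endpoint b s k e i \<le> endpoint b s k e' i' \<longleftrightarrow> f k e (B ! i) \<le> f k e' (B ! i')"
  unfolding realizes_def by (meson not_less)

lemma realizes_valid_iff:
  assumes "realizes d b f B s"
  shows "valid_state E d b B s \<longleftrightarrow> local_representation E [set B] d f"
proof -
  have "(\<forall>k<d. endpoint b s k 0 i \<le> endpoint b s k 1 j \<and> endpoint b s k 0 j \<le> endpoint b s k 1 i) \<longleftrightarrow>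
      (\<forall>k<d. f k 0 (B ! i) \<le> f k 1 (B ! j) \<and> f k 0 (B ! j) \<le> f k 1 (B ! i))"
    if "i < length B" "j < length B" for i j
    using realizes_le[OF assms] that by auto
  then show ?thesis
    unfolding valid_state_def local_representation_def by (auto simp: all_set_conv_all_nth)
qed

text \<open>Only the order of the endpoints matters, so the rank of each of the at most \<open>2b\<close> endpoints in a
  dimension can serve as its position.\<close>

lemma realizing_state_exists:
  assumes b: "length B \<le> b" "0 < b"
  shows "\<exists>s<(2 * b) ^ (2 * b * d). realizes d b f B s"
proof -
  define P where "P k = (\<lambda>(e, i). f k e (B ! i)) ` ({..<2} \<times> {..<length B})" for k
  define rank where "rank k x = card {y \<in> P k. y < x}" for k x
  have fin: "finite (P k)" for k by (simp add: P_def)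
  have "card (P k) \<le> 2 * b" for k
    using card_image_le[of "{..<2::nat} \<times> {..<length B}" "\<lambda>(e, i). f k e (B ! i)"] b
    by (auto simp: P_def)
  then have rank_less: "rank k x < 2 * b" if "x \<in> P k" for k x
    using psubset_card_mono[OF fin, of "{y \<in> P k. y < x}" k] that unfolding rank_def
    by (metis (no_types, lifting) less_irrefl less_le_trans mem_Collect_eq psubsetI subsetI)
  have rank_iff: "rank k x < rank k y \<longleftrightarrow> x < y" if "x \<in> P k" "y \<in> P k" for k x y
  proof -
    have mono: "rank k x < rank k y" if "x < y" "x \<in> P k" for x y
      unfolding rank_def using that fin by (intro psubset_card_mono) auto
    show ?thesis using mono[of x y] mono[of y x] that by (metis less_asym linorder_neqE less_irrefl)
  qed
  \<comment> \<open>Inverts \<open>q = 2 * b * k + e * b + i\<close>, the digit position that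
    \<open>endpoint\<close> reads; digits that belong to no vertex of the bag are 0.\<close>
  define \<delta> where "\<delta> q = (let i = q mod b; e = q div b mod 2; k = q div (2 * b) in
     if i < length B then rank k (f k e (B ! i)) else 0)" for q
  have mem: "f k e (B ! i) \<in> P k" if "e < 2" "i < length B" for k e i
    using that by (auto simp: P_def)
  have "\<delta> q < 2 * b" for q
    using rank_less[OF mem] b by (auto simp: \<delta>_def Let_def)
  then obtain s where s: "s < (2 * b) ^ (2 * b * d)"
      "\<And>q. q < 2 * b * d \<Longrightarrow> s div (2 * b) ^ q mod (2 * b) = \<delta> q"
    using digits_exist[of "2 * b * d" \<delta> "2 * b"] by blast
  have "endpoint b s k e i = rank k (f k e (B ! i))" if "k < d" "e < 2" "i < length B" for k e i
  proof -
    let ?q = "2 * b * k + e * b + i"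
    have i: "i < b" using that b by simp
    have "e * b + i < 2 * b" using that(2) i by (cases "e = 0") (auto simp: less_2_cases_iff)
    moreover have "2 * b * Suc k \<le> 2 * b * d" using that(1) by (intro mult_left_mono) auto
    ultimately have q: "?q < 2 * b * d" by simp
    have "?q = i + b * (e + 2 * k)" by (simp add: algebra_simps)
    then have "?q mod b = i" "?q div b = e + 2 * k" using i by auto
    moreover from this have "?q div (2 * b) = k"
      using that(2) by (simp only: mult.commute[of 2 b] div_mult2_eq)
    ultimately have "\<delta> ?q = rank k (f k e (B ! i))"
      using that by (simp add: \<delta>_def Let_def)
    then show ?thesis using s(2)[OF q] by (simp add: endpoint_def)
  qed
  then have "realizes d b f B s"
    unfolding realizes_def using rank_iff[OF mem mem] by simp
  then show ?thesis using s(1) by blast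
qed

text \<open>Amalgamation with one more bag: common vertices keep their values, and those of new ones
  are chosen by density. Vertices outside \<open>B'\<close> keep their values too, so that the bags
  treated before are not disturbed.\<close>

lemma realization_extend:
  assumes f: "realizes d b f B s" and comp: "compatible_states d b B s B' s'" and dist: "distinct B'"
  shows "\<exists>f'. realizes d b f' B' s' \<and> (\<forall>k e v. v \<in> set B \<or> v \<notin> set B' \<longrightarrow> f' k e v = f k e v)"
proof -
  define C where "C = {..<2::nat} \<times> {j. j < length B' \<and> B' ! j \<in> set B}"
  define X where "X = {..<2::nat} \<times> {..<length B'}"
  define F where "F k = (\<lambda>(e, j). f k e (B' ! j))" for k
  define H where "H k = (\<lambda>(e, j). endpoint b s' k e j)" for k
  have "\<exists>g. (\<forall>x\<in>C. g x = F k x) \<and> (\<forall>x\<in>C \<union> X. \<forall>y\<in>C \<union> X. g x < g y \<longleftrightarrow> H k x < H k y)"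
    if k: "k < d" for k
  proof (rule order_embedding_extend)
    fix x y assume "x \<in> C" "y \<in> C"
    then obtain e j e' j' i i' where xy: "x = (e, j)" "y = (e', j')" "e < 2" "e' < 2"
        "j < length B'" "j' < length B'" "i < length B" "i' < length B" "B ! i = B' ! j" "B ! i' = B' ! j'"
      by (auto simp: C_def in_set_conv_nth)
    then show "F k x < F k y \<longleftrightarrow> H k x < H k y"
      using f comp k unfolding realizes_def compatible_states_def F_def H_def by simp
  qed (auto simp: C_def X_def)
  then obtain g where g: "\<And>k x. k < d \<Longrightarrow> x \<in> C \<Longrightarrow> g k x = F k x"
      "\<And>k x y. k < d \<Longrightarrow> x \<in> C \<union> X \<Longrightarrow> y \<in> C \<union> X \<Longrightarrow> g k x < g k y \<longleftrightarrow> H k x < H k y"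
    by metis
  define idx where "idx v = (THE j. j < length B' \<and> B' ! j = v)" for v
  have idx: "idx (B' ! j) = j" if "j < length B'" for j
    unfolding idx_def using that dist by (intro the_equality) (auto simp: nth_eq_iff_index_eq)
  define f' where "f' k e v = (if k < d \<and> e < 2 \<and> v \<in> set B' then g k (e, idx v) else f k e v)" for k e v
  have "realizes d b f' B' s'"
    unfolding realizes_def
  proof (intro allI impI)
    fix k e e' i i' :: nat
    assume *: "k < d" "e < 2" "e' < 2" "i < length B'" "i' < length B'"
    then show "endpoint b s' k e i < endpoint b s' k e' i' \<longleftrightarrow> f' k e (B' ! i) < f' k e' (B' ! i')"
      using g(2)[of k "(e, i)" "(e', i')"] idx by (simp add: f'_def X_def H_def)
  qed
  moreover have "f' k e v = f k e v" if "v \<in> set B \<or> v \<notin> set B'" for k e v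
  proof (cases "k < d \<and> e < 2 \<and> v \<in> set B'")
    case True
    then obtain j where j: "j < length B'" "B' ! j = v" by (auto simp: in_set_conv_nth)
    then have "(e, j) \<in> C" using True that by (auto simp: C_def)
    then show ?thesis using True g(1)[of k "(e, j)"] idx[OF j(1)] j by (simp add: f'_def F_def)
  next
    case False
    then show ?thesis by (simp only: f'_def if_False)
  qed
  ultimately show ?thesis by blast
qed

lemma local_representation_append:
  "local_representation E (Ws @ Ws') d f \<longleftrightarrow>
   local_representation E Ws d f \<and> local_representation E Ws' d f"
  unfolding local_representation_def set_append by (rule ball_Un)

lemma local_representation_cong:
  assumes "local_representation E Ws d f"
    and "\<And>k e v. v \<in> \<Union>(set Ws) \<Longrightarrow> f' k e v = f k e v"
  shows "local_representation E Ws d f'"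
  unfolding local_representation_def
proof (intro ballI)
  fix W u v assume W: "W \<in> set Ws" "u \<in> W" "v \<in> W"
  then have "f' k e u = f k e u" "f' k e v = f k e v" for k e using assms(2) by blast+
  then show "(u = v \<or> {u, v} \<in> E) \<longleftrightarrow> (\<forall>k<d. f' k 0 u \<le> f' k 1 v \<and> f' k 0 v \<le> f' k 1 u)"
    using assms(1) W unfolding local_representation_def by simp
qed

text \<open>From states to reals, a realization of all bags read so far is carried along a chain of
  states and extended at each step. From reals to states, the state of ranks of one fixed
  representation is taken in every bag; consecutive ones are compatible because both record the
  order of the same reals.\<close>

lemma reachable_nonempty_iff:
  assumes conv: "\<And>i j k. i \<le> k \<Longrightarrow> k \<le> j \<Longrightarrow> j < length Bs \<Longrightarrow> set (Bs ! i) \<inter> set (Bs ! j) \<subseteq> set (Bs ! k)"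
    and dist: "\<And>B. B \<in> set Bs \<Longrightarrow> distinct B"
    and len: "\<And>B. B \<in> set Bs \<Longrightarrow> length B \<le> b" and b: "0 < b"
  shows "reachable E d b Bs (length Bs) \<noteq> {} \<longleftrightarrow> local_boxicity_le E (map set Bs) d"
proof
  have "\<exists>f. local_representation E (map set (take t Bs)) d f \<and> realizes d b f (prev_bag Bs t) s"
    if "t \<le> length Bs" "s \<in> reachable E d b Bs t" for t s
    using that
  proof (induction t arbitrary: s)
    case 0
    show ?case by (simp add: local_representation_def realizes_def prev_bag_def)
  next
    case (Suc t)
    then obtain s0 where s0: "s0 \<in> reachable E d b Bs t" "valid_state E d b (Bs ! t) s"
        "compatible_states d b (prev_bag Bs t) s0 (Bs ! t) s" by auto
    obtain f where f: "local_representation E (map set (take t Bs)) d f" "realizes d b f (prev_bag Bs t) s0"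
      using Suc.IH[OF _ s0(1)] Suc.prems by auto
    have t: "t < length Bs" using Suc.prems by simp
    obtain f' where f': "realizes d b f' (Bs ! t) s"
        "\<And>k e v. v \<in> set (prev_bag Bs t) \<or> v \<notin> set (Bs ! t) \<Longrightarrow> f' k e v = f k e v"
      using realization_extend[OF f(2) s0(3)] dist[OF nth_mem[OF t]] by blast
    have "local_representation E (map set (take t Bs)) d f'"
    proof (rule local_representation_cong[OF f(1)])
      fix k e v assume "v \<in> \<Union>(set (map set (take t Bs)))"
      then obtain B where "B \<in> set (take t Bs)" "v \<in> set B" by auto
      then obtain i where i: "i < t" "v \<in> set (Bs ! i)"
        by (metis in_set_conv_nth length_take min_less_iff_conj nth_take)
      \<comment> \<open>A vertex of an earlier bag that occurs in bag \<open>t\<close> lies in the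
        previous bag too, so \<open>f'\<close> keeps its value.\<close>
      then have "set (Bs ! i) \<inter> set (Bs ! t) \<subseteq> set (Bs ! (t - 1))"
        using t by (intro conv) auto
      then have "v \<in> set (prev_bag Bs t) \<or> v \<notin> set (Bs ! t)"
        using i by (auto simp: prev_bag_def)
      then show "f' k e v = f k e v" by (rule f'(2))
    qed
    moreover have "local_representation E [set (Bs ! t)] d f'"
      using realizes_valid_iff[OF f'(1)] s0(2) by simp
    ultimately have "local_representation E (map set (take (Suc t) Bs)) d f'"
      using t by (simp add: take_Suc_conv_app_nth local_representation_append)
    then show ?case using f'(1) by (auto simp: prev_bag_def)
  qed
  from this[of "length Bs"] show "local_boxicity_le E (map set Bs) d"
    if "reachable E d b Bs (length Bs) \<noteq> {}"
    using that unfolding local_boxicity_le_def by (metis ex_in_conv order_refl take_all)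
next
  assume "local_boxicity_le E (map set Bs) d"
  then obtain f where f: "local_representation E (map set Bs) d f"
    unfolding local_boxicity_le_def by blast
  have "\<exists>s\<in>reachable E d b Bs t. realizes d b f (prev_bag Bs t) s" if "t \<le> length Bs" for t
    using that
  proof (induction t)
    case 0
    show ?case by (simp add: realizes_def prev_bag_def)
  next
    case (Suc t)
    then have t: "t < length Bs" by simp
    obtain s where s: "s \<in> reachable E d b Bs t" "realizes d b f (prev_bag Bs t) s"
      using Suc by auto
    obtain s' where s': "s' < (2 * b) ^ (2 * b * d)" "realizes d b f (Bs ! t) s'"
      using realizing_state_exists[OF len b, of "Bs ! t"] t by auto
    have "set (Bs ! t) \<in> set (map set Bs)" using t by simp
    from f[unfolded local_representation_def, THEN bspec, OF this]
    have "local_representation E [set (Bs ! t)] d f"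
      unfolding local_representation_def by simp
    then have "valid_state E d b (Bs ! t) s'" using realizes_valid_iff[OF s'(2)] by simp
    moreover have "compatible_states d b (prev_bag Bs t) s (Bs ! t) s'"
      unfolding compatible_states_def
    proof (intro allI impI)
      fix i i' j j' k and e e' :: nat
      assume *: "i < length (prev_bag Bs t)" "i' < length (prev_bag Bs t)" "j < length (Bs ! t)"
        "j' < length (Bs ! t)" "prev_bag Bs t ! i = Bs ! t ! j \<and> prev_bag Bs t ! i' = Bs ! t ! j'"
        "k < d" "e < 2" "e' < 2"
      then show "endpoint b s k e i < endpoint b s k e' i' \<longleftrightarrow> endpoint b s' k e j < endpoint b s' k e' j'"
        using s(2) s'(2) unfolding realizes_def by simp
    qed
    ultimately have "s' \<in> reachable E d b Bs (Suc t)" using s'(1) s(1) by auto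
    then show ?case using s'(2)
      by (intro bexI[of _ s']) (simp_all add: prev_bag_def del: reachable.simps)
  qed
  then show "reachable E d b Bs (length Bs) \<noteq> {}" by blast
qed

section \<open>Derived expressions\<close>

text \<open>Derived expressions bind fixed registers without renaming; freshness of their arguments
  excludes capture. Only free occurrences count, and in a fold the number of rounds and the initial
  value lie outside the scope of the binders.\<close>

primrec fresh :: "nat \<Rightarrow> exp \<Rightarrow> bool" where
  "fresh z (Var i) \<longleftrightarrow> z \<noteq> i"
| "fresh z (Lit c) \<longleftrightarrow> True"
| "fresh z (Plus e f) \<longleftrightarrow> fresh z e \<and> fresh z f"
| "fresh z (Minus e f) \<longleftrightarrow> fresh z e \<and> fresh z f"
| "fresh z (Mem e) \<longleftrightarrow> fresh z e"
| "fresh z (Ite c e f) \<longleftrightarrow> fresh z c \<and> fresh z e \<and> fresh z f"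
| "fresh z (Fold a x n i e) \<longleftrightarrow> fresh z n \<and> fresh z i \<and> (z = a \<or> z = x \<or> fresh z e)"

lemma eval_fresh: "fresh z e \<Longrightarrow> eval e (r(z := v)) m = eval e r m"
proof (induction e arbitrary: r)
  case (Fold a x n i e)
  have "eval e (r(z := v, x := j, a := w)) m = eval e (r(x := j, a := w)) m" for j w
  proof (cases "z = a \<or> z = x")
    case True
    then have "r(z := v, x := j, a := w) = r(x := j, a := w)" by auto
    then show ?thesis by simp
  next
    case False
    then have "r(z := v, x := j, a := w) = r(x := j, a := w, z := v)" by auto
    moreover have "fresh z e" using Fold.prems False by simp
    ultimately show ?thesis by (simp only: Fold.IH(3))
  qed
  moreover have "eval n (r(z := v)) m = eval n r m" "eval i (r(z := v)) m = eval i r m"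
    using Fold.prems by (simp_all only: Fold.IH fresh.simps)
  ultimately show "eval (Fold a x n i e) (r(z := v)) m = eval (Fold a x n i e) r m" by simp
qed auto

lemma loops_bounded_fresh: "fresh z e \<Longrightarrow> loops_bounded K e (r(z := v)) m = loops_bounded K e r m"
proof (induction e arbitrary: r)
  case (Fold a x n i e)
  have "loops_bounded K e (r(z := v, x := j, a := w)) m = loops_bounded K e (r(x := j, a := w)) m" for j w
  proof (cases "z = a \<or> z = x")
    case True
    then have "r(z := v, x := j, a := w) = r(x := j, a := w)" by auto
    then show ?thesis by simp
  next
    case False
    then have "r(z := v, x := j, a := w) = r(x := j, a := w, z := v)" by auto
    moreover have "fresh z e" using Fold.prems False by simp
    ultimately show ?thesis by (simp only: Fold.IH(3))
  qed
  moreover have "loops_bounded K n (r(z := v)) m = loops_bounded K n r m"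
      "loops_bounded K i (r(z := v)) m = loops_bounded K i r m" "eval n (r(z := v)) m = eval n r m"
    using Fold.prems by (simp_all only: Fold.IH eval_fresh fresh.simps)
  ultimately show "loops_bounded K (Fold a x n i e) (r(z := v)) m = loops_bounded K (Fold a x n i e) r m"
    by simp
qed (auto simp: eval_fresh)

text \<open>Sums and quantifiers, nested ones included, share the accumulator 39: a fold restores
  it, and an expression counts as fresh for a register that it binds.\<close>

definition sum_exp :: "nat \<Rightarrow> exp \<Rightarrow> exp \<Rightarrow> exp" where
  "sum_exp x n e = Fold 39 x n (Lit 0) (Plus (Var 39) e)"

definition all_exp :: "nat \<Rightarrow> exp \<Rightarrow> exp \<Rightarrow> exp" where
  "all_exp x n e = Fold 39 x n (Lit 1) (Ite e (Var 39) (Lit 0))"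

definition ex_exp :: "nat \<Rightarrow> exp \<Rightarrow> exp \<Rightarrow> exp" where
  "ex_exp x n e = Fold 39 x n (Lit 0) (Ite e (Lit 1) (Var 39))"

definition le_exp :: "exp \<Rightarrow> exp \<Rightarrow> exp" where
  "le_exp e f = Minus (Lit 1) (Minus e f)"

definition less_exp :: "exp \<Rightarrow> exp \<Rightarrow> exp" where
  "less_exp e f = le_exp (Plus e (Lit 1)) f"

definition eq_exp :: "exp \<Rightarrow> exp \<Rightarrow> exp" where
  "eq_exp e f = Minus (Lit 1) (Plus (Minus e f) (Minus f e))"

definition and_exp :: "exp \<Rightarrow> exp \<Rightarrow> exp" where
  "and_exp e f = Ite e f (Lit 0)"

definition mult_exp :: "exp \<Rightarrow> exp \<Rightarrow> exp" where
  "mult_exp e f = sum_exp 30 e f"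

text \<open>\<open>mult_exp\<close> loops over its first factor, which is the base here. A power
  therefore costs about exponent times base iterations, however large its value; this matters for
  the powers of two that exceed \<open>K\<close>.\<close>

definition power_exp :: "exp \<Rightarrow> exp \<Rightarrow> exp" where
  "power_exp e q = Fold 35 32 q (Lit 1) (mult_exp e (Var 35))"

text \<open>\<open>s div t\<close> is the number of \<open>j < s\<close> with \<open>(j + 1) * t \<le> s\<close>.\<close>

definition div_exp :: "exp \<Rightarrow> exp \<Rightarrow> exp" where
  "div_exp s t = sum_exp 31 s (le_exp (mult_exp (Plus (Var 31) (Lit 1)) t) s)"

definition mod_exp :: "exp \<Rightarrow> exp \<Rightarrow> exp" where
  "mod_exp s t = Minus s (mult_exp (div_exp s t) t)"

text \<open>The number \<open>X\<close> has up to \<open>M\<close> bits, where \<open>M\<close> itself is the size of a state space, so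
  its bits are found by subtracting powers of two from the top: this takes time polynomial in \<open>M\<close>.\<close>

definition bit_exp :: "exp \<Rightarrow> exp \<Rightarrow> exp \<Rightarrow> exp" where
  "bit_exp M X s = le_exp (power_exp (Lit 2) s)
     (Fold 34 33 (Minus M (Plus s (Lit 1))) X
       (Ite (le_exp (power_exp (Lit 2) (Minus M (Plus (Var 33) (Lit 1)))) (Var 34))
            (Minus (Var 34) (power_exp (Lit 2) (Minus M (Plus (Var 33) (Lit 1)))))
            (Var 34)))"

lemma fresh_sugar [simp]:
  "fresh z (sum_exp x n e) \<longleftrightarrow> fresh z n \<and> (z = 39 \<or> z = x \<or> fresh z e)"
  "fresh z (all_exp x n e) \<longleftrightarrow> fresh z n \<and> (z = 39 \<or> z = x \<or> fresh z e)"
  "fresh z (ex_exp x n e) \<longleftrightarrow> fresh z n \<and> (z = 39 \<or> z = x \<or> fresh z e)"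
  "fresh z (le_exp e f) \<longleftrightarrow> fresh z e \<and> fresh z f"
  "fresh z (less_exp e f) \<longleftrightarrow> fresh z e \<and> fresh z f"
  "fresh z (eq_exp e f) \<longleftrightarrow> fresh z e \<and> fresh z f"
  "fresh z (and_exp e f) \<longleftrightarrow> fresh z e \<and> fresh z f"
  "fresh z (mult_exp e f) \<longleftrightarrow> fresh z e \<and> (z = 39 \<or> z = 30 \<or> fresh z f)"
  "fresh z (power_exp e f) \<longleftrightarrow> fresh z f \<and> (z = 35 \<or> z = 32 \<or> fresh z e)"
  "fresh z (div_exp e f) \<longleftrightarrow> fresh z e \<and> (z = 39 \<or> z = 31 \<or> z = 30 \<or> fresh z f)"
  "fresh z (mod_exp e f) \<longleftrightarrow> fresh z e \<and> (z = 39 \<or> z = 30 \<or> fresh z f)"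
  "fresh z (bit_exp M X s) \<longleftrightarrow> fresh z M \<and> fresh z X \<and> fresh z s"
  by (auto simp: sum_exp_def all_exp_def ex_exp_def le_exp_def less_exp_def eq_exp_def and_exp_def
      mult_exp_def power_exp_def div_exp_def mod_exp_def bit_exp_def)

lemma wf_exp_sugar [simp]:
  "wf_exp h (sum_exp x n e) \<longleftrightarrow> 39 < h \<and> x < h \<and> x \<noteq> 39 \<and> wf_exp h n \<and> wf_exp h e"
  "wf_exp h (all_exp x n e) \<longleftrightarrow> 39 < h \<and> x < h \<and> x \<noteq> 39 \<and> wf_exp h n \<and> wf_exp h e"
  "wf_exp h (ex_exp x n e) \<longleftrightarrow> 39 < h \<and> x < h \<and> x \<noteq> 39 \<and> wf_exp h n \<and> wf_exp h e"
  "wf_exp h (le_exp e f) \<longleftrightarrow> wf_exp h e \<and> wf_exp h f"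
  "wf_exp h (less_exp e f) \<longleftrightarrow> wf_exp h e \<and> wf_exp h f"
  "wf_exp h (eq_exp e f) \<longleftrightarrow> wf_exp h e \<and> wf_exp h f"
  "wf_exp h (and_exp e f) \<longleftrightarrow> wf_exp h e \<and> wf_exp h f"
  "wf_exp h (mult_exp e f) \<longleftrightarrow> 39 < h \<and> wf_exp h e \<and> wf_exp h f"
  "wf_exp h (power_exp e f) \<longleftrightarrow> 39 < h \<and> wf_exp h e \<and> wf_exp h f"
  "wf_exp h (div_exp e f) \<longleftrightarrow> 39 < h \<and> wf_exp h e \<and> wf_exp h f"
  "wf_exp h (mod_exp e f) \<longleftrightarrow> 39 < h \<and> wf_exp h e \<and> wf_exp h f"
  "wf_exp h (bit_exp M X s) \<longleftrightarrow> 39 < h \<and> wf_exp h M \<and> wf_exp h X \<and> wf_exp h s"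
  by (auto simp: sum_exp_def all_exp_def ex_exp_def le_exp_def less_exp_def eq_exp_def and_exp_def
      mult_exp_def power_exp_def div_exp_def mod_exp_def bit_exp_def)

lemma eval_sum_exp [simp]:
  assumes "fresh 39 e"
  shows "eval (sum_exp x n e) r m = (\<Sum>j<eval n r m. eval e (r(x := j)) m)"
proof -
  have "rec_nat 0 (\<lambda>j v. v + eval e (r(x := j)) m) N = (\<Sum>j<N. eval e (r(x := j)) m)" for N
    by (induction N) auto
  then show ?thesis using assms by (simp add: sum_exp_def eval_fresh)
qed

lemma eval_all_exp [simp]:
  assumes "fresh 39 e"
  shows "eval (all_exp x n e) r m = of_bool (\<forall>j<eval n r m. eval e (r(x := j)) m \<noteq> 0)"
proof -
  have "rec_nat (Suc 0) (\<lambda>j v. if 0 < eval e (r(x := j)) m then v else 0) N =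
    of_bool (\<forall>j<N. eval e (r(x := j)) m \<noteq> 0)" for N
    by (induction N) (auto simp: All_less_Suc)
  then show ?thesis using assms by (simp add: all_exp_def eval_fresh cong: if_cong)
qed

lemma eval_ex_exp [simp]:
  assumes "fresh 39 e"
  shows "eval (ex_exp x n e) r m = of_bool (\<exists>j<eval n r m. eval e (r(x := j)) m \<noteq> 0)"
proof -
  have "rec_nat 0 (\<lambda>j v. if 0 < eval e (r(x := j)) m then Suc 0 else v) N =
    of_bool (\<exists>j<N. eval e (r(x := j)) m \<noteq> 0)" for N
    by (induction N) (auto simp: Ex_less_Suc)
  then show ?thesis using assms by (simp add: ex_exp_def eval_fresh cong: if_cong)
qed

lemma eval_logic [simp]:
  "eval (le_exp e f) r m = of_bool (eval e r m \<le> eval f r m)"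
  "eval (less_exp e f) r m = of_bool (eval e r m < eval f r m)"
  "eval (eq_exp e f) r m = of_bool (eval e r m = eval f r m)"
  "eval (and_exp e f) r m = (if eval e r m \<noteq> 0 then eval f r m else 0)"
  by (auto simp: le_exp_def less_exp_def eq_exp_def and_exp_def)

lemma eval_mult_exp [simp]:
  "fresh 30 f \<Longrightarrow> fresh 39 f \<Longrightarrow> eval (mult_exp e f) r m = eval e r m * eval f r m"
  by (simp add: mult_exp_def eval_fresh)

lemma eval_power_exp [simp]:
  assumes "fresh 32 e" "fresh 35 e"
  shows "eval (power_exp e q) r m = eval e r m ^ eval q r m"
proof -
  have "rec_nat (Suc 0) (\<lambda>j v. eval e r m * v) N = eval e r m ^ N" for N
    by (induction N) auto
  then show ?thesis using assms by (simp add: power_exp_def eval_fresh)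
qed

lemma eval_div_exp [simp]:
  assumes "fresh 31 s" "fresh 39 s" "fresh 30 t" "fresh 31 t" "fresh 39 t" "0 < eval t r m"
  shows "eval (div_exp s t) r m = eval s r m div eval t r m"
proof -
  let ?s = "eval s r m" and ?t = "eval t r m"
  have "Suc j * ?t \<le> ?s \<longleftrightarrow> j < ?s div ?t" for j
    using assms(6) by (metis Suc_le_eq less_eq_div_iff_mult_less_eq)
  then have "{j. j < ?s \<and> Suc j * ?t \<le> ?s} = {..<?s div ?t}"
    using div_le_dividend[of ?s ?t] by (auto intro: less_le_trans simp del: div_le_dividend)
  moreover have "eval (div_exp s t) r m = (\<Sum>j<?s. of_bool (Suc j * ?t \<le> ?s))"
    using assms by (simp add: div_exp_def eval_fresh)
  moreover have "\<dots> = card {j. j < ?s \<and> Suc j * ?t \<le> ?s}"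
    by (subst sum_of_bool_eq) (auto simp: Int_def intro!: arg_cong[where f=card])
  ultimately show ?thesis by simp
qed

lemma eval_mod_exp [simp]:
  assumes "fresh 31 s" "fresh 39 s" "fresh 30 t" "fresh 31 t" "fresh 39 t" "0 < eval t r m"
  shows "eval (mod_exp s t) r m = eval s r m mod eval t r m"
  using assms by (simp add: mod_exp_def minus_div_mult_eq_mod)

section \<open>Binary digits by comparison and subtraction\<close>

lemma mod_two_power_Suc_eq:
  "(X::nat) mod 2 ^ Suc k = X mod 2 ^ k + (if odd (X div 2 ^ k) then 2 ^ k else 0)"
  using mod_mult2_eq[of X "2 ^ k" 2]
  by (simp add: mult.commute odd_iff_mod_2_eq_one even_iff_mod_2_eq_zero)

text \<open>If \<open>z\<close> is \<open>y\<close> or \<open>y + p\<close> with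
  \<open>y < p\<close>, then comparing \<open>z\<close> with \<open>p\<close> tells which case
  holds, and a subtraction recovers \<open>y\<close>.\<close>

lemma mod_two_power:
  "(X::nat) mod 2 ^ k = (if 2 ^ k \<le> X mod 2 ^ Suc k then X mod 2 ^ Suc k - 2 ^ k else X mod 2 ^ Suc k)"
proof -
  have "y = (if p \<le> z then z - p else z)" if "z = y + (if c then p else 0)" "y < p" for c and p y z :: nat
    using that by auto
  from this[OF mod_two_power_Suc_eq] show ?thesis by simp
qed

lemma two_power_le_mod_iff: "2 ^ k \<le> (X::nat) mod 2 ^ Suc k \<longleftrightarrow> k \<in> set_decode X"
proof -
  have "p \<le> z \<longleftrightarrow> c" if "z = y + (if c then p else 0)" "y < p" for c and p y z :: nat
    using that by auto
  from this[OF mod_two_power_Suc_eq] show ?thesis by (simp add: set_decode_def)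
qed

lemma eval_bit_exp [simp]:
  assumes "fresh 33 M" "fresh 34 M" 
    and X: "eval X r m < 2 ^ eval M r m" and s: "eval s r m < eval M r m"
  shows "eval (bit_exp M X s) r m = of_bool (eval s r m \<in> set_decode (eval X r m))"
proof -
  let ?M = "eval M r m" and ?X = "eval X r m" and ?s = "eval s r m"
  \<comment> \<open>Loop invariant: after \<open>N\<close> rounds the top \<open>N\<close> of the
    \<open>?M\<close> bits are gone. After \<open>?M - Suc ?s\<close> rounds bit \<open>?s\<close>
    is the leading position.\<close>
  have "rec_nat ?X (\<lambda>j v. if 2 ^ (?M - Suc j) \<le> v then v - 2 ^ (?M - Suc j) else v) N = ?X mod 2 ^ (?M - N)"
    if "N \<le> ?M" for N
    using that
  proof (induction N)
    case 0
    then show ?case using X by simp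
  next
    case (Suc N)
    then have "?M - N = Suc (?M - Suc N)" by simp
    then show ?case using Suc mod_two_power[of ?X "?M - Suc N"] by simp
  qed
  from this[of "?M - Suc ?s"]
  have "rec_nat ?X (\<lambda>j v. if 2 ^ (?M - Suc j) \<le> v then v - 2 ^ (?M - Suc j) else v) (?M - Suc ?s) =
      ?X mod 2 ^ Suc ?s"
    using s by simp
  then show ?thesis
    using assms two_power_le_mod_iff[of ?s ?X] by (simp add: bit_exp_def eval_fresh cong: if_cong)
qed

lemma loops_bounded_quantifiers [simp]:
  assumes "fresh 39 e"
  shows "loops_bounded K (sum_exp x n e) r m \<longleftrightarrow> loops_bounded K n r m \<and> eval n r m \<le> K \<and>
     (\<forall>j<eval n r m. loops_bounded K e (r(x := j)) m)"
    "loops_bounded K (all_exp x n e) r m \<longleftrightarrow> loops_bounded K n r m \<and> eval n r m \<le> K \<and>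
     (\<forall>j<eval n r m. loops_bounded K e (r(x := j)) m)"
    "loops_bounded K (ex_exp x n e) r m \<longleftrightarrow> loops_bounded K n r m \<and> eval n r m \<le> K \<and>
     (\<forall>j<eval n r m. loops_bounded K e (r(x := j)) m)"
  using assms by (simp_all add: sum_exp_def all_exp_def ex_exp_def loops_bounded_fresh eval_fresh)

lemma loops_bounded_logic [simp]:
  "loops_bounded K (le_exp e f) r m \<longleftrightarrow> loops_bounded K e r m \<and> loops_bounded K f r m"
  "loops_bounded K (less_exp e f) r m \<longleftrightarrow> loops_bounded K e r m \<and> loops_bounded K f r m"
  "loops_bounded K (eq_exp e f) r m \<longleftrightarrow> loops_bounded K e r m \<and> loops_bounded K f r m"
  "loops_bounded K (and_exp e f) r m \<longleftrightarrow> loops_bounded K e r m \<and>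
     (eval e r m \<noteq> 0 \<longrightarrow> loops_bounded K f r m)"
  by (auto simp: le_exp_def less_exp_def eq_exp_def and_exp_def)

lemma loops_bounded_mult_exp:
  "fresh 30 f \<Longrightarrow> fresh 39 f \<Longrightarrow> loops_bounded K e r m \<Longrightarrow> loops_bounded K f r m \<Longrightarrow>
   eval e r m \<le> K \<Longrightarrow> loops_bounded K (mult_exp e f) r m"
  by (simp add: mult_exp_def loops_bounded_fresh)

lemma loops_bounded_power_exp:
  "fresh 32 e \<Longrightarrow> fresh 35 e \<Longrightarrow> loops_bounded K e r m \<Longrightarrow> loops_bounded K q r m \<Longrightarrow>
   eval e r m \<le> K \<Longrightarrow> eval q r m \<le> K \<Longrightarrow> loops_bounded K (power_exp e q) r m"
  by (auto simp add: power_exp_def loops_bounded_fresh eval_fresh intro!: loops_bounded_mult_exp)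

lemma loops_bounded_div_exp:
  "fresh 31 s \<Longrightarrow> fresh 39 s \<Longrightarrow> fresh 30 t \<Longrightarrow> fresh 31 t \<Longrightarrow> fresh 39 t \<Longrightarrow>
   loops_bounded K s r m \<Longrightarrow> loops_bounded K t r m \<Longrightarrow>
   eval s r m \<le> K \<Longrightarrow> loops_bounded K (div_exp s t) r m"
  by (auto simp add: div_exp_def loops_bounded_fresh eval_fresh intro!: loops_bounded_mult_exp)

lemma loops_bounded_mod_exp:
  "fresh 31 s \<Longrightarrow> fresh 39 s \<Longrightarrow> fresh 30 t \<Longrightarrow> fresh 31 t \<Longrightarrow> fresh 39 t \<Longrightarrow>
   loops_bounded K s r m \<Longrightarrow> loops_bounded K t r m \<Longrightarrow> 0 < eval t r m \<Longrightarrow>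
   eval s r m \<le> K \<Longrightarrow> loops_bounded K (mod_exp s t) r m"
  using div_le_dividend[of "eval s r m" "eval t r m"]
  by (auto simp add: mod_exp_def intro!: loops_bounded_mult_exp loops_bounded_div_exp
      simp del: div_le_dividend)

lemma loops_bounded_bit_exp:
  "fresh 33 M \<Longrightarrow> fresh 34 M \<Longrightarrow> loops_bounded K M r m \<Longrightarrow> loops_bounded K X r m \<Longrightarrow>
   loops_bounded K s r m \<Longrightarrow> eval M r m \<le> K \<Longrightarrow> eval s r m \<le> K \<Longrightarrow> 2 \<le> K \<Longrightarrow>
   loops_bounded K (bit_exp M X s) r m"
  by (auto simp add: bit_exp_def loops_bounded_fresh eval_fresh intro!: loops_bounded_power_exp)

section \<open>One step of the dynamic program\<close>

definition stores_list :: "(nat \<Rightarrow> nat) \<Rightarrow> nat \<Rightarrow> nat list \<Rightarrow> bool" where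
  "stores_list m p B \<longleftrightarrow> m p = length B \<and> (\<forall>i<length B. m (p + 1 + i) = B ! i)"

text \<open>Rows are reached through a table of their addresses, so a lookup takes no
  multiplication. The nonzero diagonal matches the case \<open>u = v\<close> in
  \<open>local_representation\<close>.\<close>

definition stores_graph :: "(nat \<Rightarrow> nat) \<Rightarrow> nat \<Rightarrow> nat \<Rightarrow> nat set set \<Rightarrow> bool" where
  "stores_graph m p n E \<longleftrightarrow> (\<forall>u<n. \<forall>v<n. m (m (p + u) + v) \<noteq> 0 \<longleftrightarrow> u = v \<or> {u, v} \<in> E)"

text \<open>Registers: \<open>0\<close> result, \<open>1\<close> number of vertices, \<open>2\<close> number of bags, \<open>3\<close> input pointer (current bag),
  \<open>4\<close> address of the first bag, \<open>5\<close> address of the table of matrix rows, \<open>6\<close> current matrix row,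
  \<open>7\<close> current vertex, \<open>8\<close> maximal bag size \<open>b\<close>, \<open>9\<close> dimension \<open>d\<close>, \<open>10\<close> set of reachable states,
  \<open>11\<close> previous bag, \<open>13\<close> number of states, \<open>14\<close> and \<open>15\<close> loop counters, \<open>16\<close> \<open>2 * b\<close>,
  \<open>17\<close> pointer into an adjacency list; \<open>20\<close> to \<open>39\<close> are bound in expressions.\<close>

definition endpoint_exp :: "nat \<Rightarrow> nat \<Rightarrow> exp \<Rightarrow> nat \<Rightarrow> exp" where
  "endpoint_exp s k e i = mod_exp (div_exp (Var s) (power_exp (Var 16)
     (Plus (Plus (mult_exp (Var 16) (Var k)) (mult_exp e (Var 8))) (Var i)))) (Var 16)"

definition bag_exp :: "nat \<Rightarrow> nat \<Rightarrow> exp" where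
  "bag_exp p i = Mem (Plus (Plus (Var p) (Lit 1)) (Var i))"

text \<open>\<open>eq_exp\<close> compares truth values as numbers, so \<open>le_exp (Lit 1)\<close>
  first turns the matrix entry into 0 or 1.\<close>

definition separation_exp :: exp where
  "separation_exp = eq_exp
     (le_exp (Lit 1) (Mem (Plus (Mem (Plus (Var 5) (bag_exp 3 23))) (bag_exp 3 24))))
     (all_exp 27 (Var 9) (and_exp
        (le_exp (endpoint_exp 21 27 (Lit 0) 23) (endpoint_exp 21 27 (Lit 1) 24))
        (le_exp (endpoint_exp 21 27 (Lit 0) 24) (endpoint_exp 21 27 (Lit 1) 23))))"

definition valid_exp :: exp where
  "valid_exp = all_exp 23 (Mem (Var 3)) (all_exp 24 (Mem (Var 3)) separation_exp)"

definition same_order_exp :: exp where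
  "same_order_exp =
     Ite (and_exp (eq_exp (bag_exp 11 23) (bag_exp 3 25)) (eq_exp (bag_exp 11 24) (bag_exp 3 26)))
       (all_exp 27 (Var 9) (all_exp 28 (Lit 2) (all_exp 29 (Lit 2) (eq_exp
         (less_exp (endpoint_exp 22 27 (Var 28) 23) (endpoint_exp 22 27 (Var 29) 24))
         (less_exp (endpoint_exp 21 27 (Var 28) 25) (endpoint_exp 21 27 (Var 29) 26))))))
       (Lit 1)"

definition compatible_exp :: exp where
  "compatible_exp = all_exp 23 (Mem (Var 11)) (all_exp 24 (Mem (Var 11))
     (all_exp 25 (Mem (Var 3)) (all_exp 26 (Mem (Var 3)) same_order_exp)))"

text \<open>The powers of two of the admissible states add up to \<open>set_encode\<close> of the
  next reachable set, so a single sum produces the whole set.\<close>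

definition step_exp :: exp where
  "step_exp = sum_exp 21 (Var 13) (Ite
     (and_exp valid_exp (ex_exp 22 (Var 13) (and_exp (bit_exp (Var 13) (Var 10) (Var 22)) compatible_exp)))
     (power_exp (Lit 2) (Var 21)) (Lit 0))"

lemma fresh_bag_exps [simp]:
  "fresh z (endpoint_exp s k e i) \<longleftrightarrow>
     z \<noteq> s \<and> (z \<in> {30, 31, 39} \<or> z \<noteq> 16 \<and> z \<noteq> i \<and> z \<noteq> k \<and> z \<noteq> 8 \<and> fresh z e)"
  "fresh z (bag_exp p i) \<longleftrightarrow> z \<noteq> p \<and> z \<noteq> i"
  by (auto simp: endpoint_exp_def bag_exp_def)

lemma eval_bag_exp [simp]: "eval (bag_exp p i) r m = m (Suc (r p + r i))"
  by (simp add: bag_exp_def)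

lemma eval_endpoint_exp:
  assumes "r 8 = b" "r 16 = 2 * b" "0 < b"
    and "s \<notin> {30, 31, 32, 35, 39}" "k \<notin> {30, 31, 32, 35, 39}" "i \<notin> {30, 31, 32, 35, 39}" "fresh 30 e" "fresh 31 e" "fresh 39 e"
  shows "eval (endpoint_exp s k e i) r m = endpoint b (r s) (r k) (eval e r m) (r i)"
  using assms by (simp add: endpoint_exp_def endpoint_def)

lemma loops_bounded_endpoint_exp:
  assumes "r 8 = b" "r 16 = 2 * b" "0 < b"
    and "s \<notin> {30, 31, 32, 35, 39}" "k \<notin> {30, 31, 32, 35, 39}" "i \<notin> {30, 31, 32, 35, 39}" "fresh 30 e" "fresh 31 e" "fresh 39 e"
    and "loops_bounded K e r m" "r s \<le> K" "2 * b * r k + eval e r m * b + r i \<le> K" "2 * b \<le> K" "eval e r m \<le> K"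
  shows "loops_bounded K (endpoint_exp s k e i) r m"
proof -
  \<comment> \<open>The remainder is computed by multiplying the quotient back, in a loop as long as
    the quotient.\<close>
  have "r s div (2 * b) ^ (2 * b * r k + eval e r m * b + r i) \<le> K"
    using assms(11) div_le_dividend le_trans by blast
  then show ?thesis
    using assms unfolding endpoint_exp_def
    by (intro loops_bounded_mod_exp loops_bounded_div_exp loops_bounded_power_exp)
       (auto intro!: loops_bounded_mult_exp)
qed

definition step_context ::
    "nat \<Rightarrow> nat set set \<Rightarrow> nat \<Rightarrow> nat \<Rightarrow> nat list \<Rightarrow> nat list \<Rightarrow> (nat \<Rightarrow> nat) \<Rightarrow> (nat \<Rightarrow> nat) \<Rightarrow> bool" where
  "step_context n E d b B B' r m \<longleftrightarrow> r 8 = b \<and> r 16 = 2 * b \<and> 0 < b \<and> r 9 = d \<and>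
     stores_graph m (r 5) n E \<and> stores_list m (r 11) B \<and> stores_list m (r 3) B' \<and> set B' \<subseteq> {..<n}"

lemma eval_valid_exp:
  assumes "step_context n E d b B B' r m"
  shows "eval valid_exp r m = of_bool (valid_state E d b B' (r 21))"
proof -
  note c = assms[unfolded step_context_def]
  have len: "m (r 3) = length B'" and nth: "\<And>i. i < length B' \<Longrightarrow> m (Suc (r 3 + i)) = B' ! i"
    using c by (auto simp: stores_list_def)
  define P where "P i j \<longleftrightarrow> ((B' ! i = B' ! j \<or> {B' ! i, B' ! j} \<in> E) \<longleftrightarrow>
     (\<forall>k<d. endpoint b (r 21) k 0 i \<le> endpoint b (r 21) k 1 j \<and>
            endpoint b (r 21) k 0 j \<le> endpoint b (r 21) k 1 i))" for i j
  have "eval separation_exp (r(23 := i, 24 := j)) m = of_bool (P i j)"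
    if "i < length B'" "j < length B'" for i j
  proof -
    have "B' ! i < n" "B' ! j < n" using c that nth_mem by blast+
    moreover define adjacent where "adjacent \<longleftrightarrow> B' ! i = B' ! j \<or> {B' ! i, B' ! j} \<in> E"
    ultimately have adj: "Suc 0 \<le> m (m (r 5 + B' ! i) + B' ! j) \<longleftrightarrow> adjacent"
      using c by (simp add: stores_graph_def Suc_le_eq)
    have conj: "0 < (if x then y else 0) \<longleftrightarrow> x \<and> 0 < y" for x and y :: nat by simp
    show ?thesis
      using c that by (simp add: separation_exp_def P_def adjacent_def[symmetric] eval_endpoint_exp[where b=b]
          nth adj conj of_bool_eq_iff split del: split_of_bool if_split)
  qed
  moreover have "fresh 39 separation_exp" by (simp add: separation_exp_def)
  ultimately show ?thesis
    unfolding valid_state_def P_def[symmetric] by (simp add: valid_exp_def len)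
qed

lemma eval_compatible_exp:
  assumes "step_context n E d b B B' r m"
  shows "eval compatible_exp r m = of_bool (compatible_states d b B (r 22) B' (r 21))"
proof -
  note c = assms[unfolded step_context_def]
  have len: "m (r 3) = length B'" and nth: "\<And>i. i < length B' \<Longrightarrow> m (Suc (r 3 + i)) = B' ! i"
    and len': "m (r 11) = length B" and nth': "\<And>i. i < length B \<Longrightarrow> m (Suc (r 11 + i)) = B ! i"
    using c by (auto simp: stores_list_def)
  define P where "P i i' j j' \<longleftrightarrow> (B ! i = B' ! j \<and> B ! i' = B' ! j' \<longrightarrow>
       (\<forall>k<d. \<forall>e<2. \<forall>e'<2.
          endpoint b (r 22) k e i < endpoint b (r 22) k e' i' \<longleftrightarrow>
          endpoint b (r 21) k e j < endpoint b (r 21) k e' j'))" for i i' j j'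
  have "eval same_order_exp (r(23 := i, 24 := i', 25 := j, 26 := j')) m = of_bool (P i i' j j')"
    if "i < length B" "i' < length B" "j < length B'" "j' < length B'" for i i' j j'
    using c that by (simp add: same_order_exp_def P_def eval_endpoint_exp[where b=b] nth nth' of_bool_eq_iff
        split del: split_of_bool)
  moreover have "fresh 39 same_order_exp" by (simp add: same_order_exp_def)
  ultimately show ?thesis
    unfolding compatible_states_def P_def[symmetric] by (simp add: compatible_exp_def len len')
qed

lemma step_context_update:
  "step_context n E d b B B' (r(x := v)) m \<longleftrightarrow> step_context n E d b B B' r m"
  if "x \<notin> {3, 5, 8, 9, 11, 16}"
  using that by (auto simp: step_context_def)

lemma fresh_state_exps [simp]:
  "fresh 39 valid_exp" "fresh 39 compatible_exp"
  by (simp_all add: valid_exp_def compatible_exp_def separation_exp_def same_order_exp_def)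

lemma set_encode_less_power:
  assumes "A \<subseteq> {..<M}" shows "set_encode A < 2 ^ M"
proof -
  have "set_encode A \<le> set_encode {..<M}"
    unfolding set_encode_def using assms by (intro sum_mono2) auto
  also have "\<dots> < 2 ^ M"
    unfolding set_encode_def by (induction M) (auto simp: lessThan_Suc)
  finally show ?thesis .
qed

lemma eval_step_exp:
  assumes c: "step_context n E d b B B' r m" and A: "r 10 = set_encode A" "A \<subseteq> {..<r 13}"
  shows "eval step_exp r m = set_encode {s'. s' < r 13 \<and> valid_state E d b B' s' \<and>
    (\<exists>s\<in>A. compatible_states d b B s B' s')}"
proof -
  have decode: "set_decode (set_encode A) = A"
    using A(2) finite_subset by (intro set_encode_inverse) blast
  have 1: "eval valid_exp (r(21 := s')) m = of_bool (valid_state E d b B' s')" for s'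
    using c by (subst eval_valid_exp) (auto simp: step_context_update)
  have 2: "eval compatible_exp (r(21 := s', 22 := s)) m = of_bool (compatible_states d b B s B' s')" for s s'
    using c by (subst eval_compatible_exp) (auto simp: step_context_update)
  have "eval step_exp r m = (\<Sum>s'<r 13. if valid_state E d b B' s' \<and>
      (\<exists>s\<in>A. compatible_states d b B s B' s') then 2 ^ s' else 0)"
    unfolding step_exp_def using A set_encode_less_power[OF A(2)]
    by (auto simp: 1 2 decode intro!: sum.cong) (use A(2) in blast)+
  also have "\<dots> = set_encode {s'. s' < r 13 \<and> valid_state E d b B' s' \<and>
    (\<exists>s\<in>A. compatible_states d b B s B' s')}"
    unfolding set_encode_def by (subst sum.inter_filter[symmetric]) (auto intro: sum.cong)
  finally show ?thesis .
qed

lemma wf_step_exp: "wf_exp 40 step_exp"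
  by (simp add: step_exp_def valid_exp_def compatible_exp_def separation_exp_def same_order_exp_def endpoint_exp_def bag_exp_def)

text \<open>Loops run over states, positions in bags, dimensions, factors and exponents. The number
  of states also bounds the dividends in \<open>endpoint_exp\<close> and the exponents of two; the
  exponents of \<open>2 * b\<close> are digit positions, which stay below
  \<open>2 * b * d\<close>.\<close>

lemma loops_bounded_step_exp:
  assumes c: "step_context n E d b B B' r m" and A: "r 10 = set_encode A" "A \<subseteq> {..<r 13}"
    and len: "length B \<le> b" "length B' \<le> b" and K: "r 13 \<le> K" "2 * b * d \<le> K" "2 * b \<le> K"
  shows "loops_bounded K step_exp r m"
proof -
  note c' = c[unfolded step_context_def]
  have lens: "m (r 3) = length B'" "m (r 11) = length B"
    using c' by (auto simp: stores_list_def)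
  have "2 \<le> K" "b \<le> K" "d \<le> K" using K c' mult_le_mono1[of 1 "2 * b" d] by linarith+
  have idx: "2 * b * k + e * b + i \<le> K" if "k < d" "e < 2" "i < b" for k e i
  proof -
    have "e * b + i < 2 * b" using that(2,3) by (cases "e = 0") (auto simp: less_2_cases_iff)
    moreover have "2 * b * Suc k \<le> 2 * b * d" using that(1) by (intro mult_left_mono) auto
    ultimately show ?thesis using K by simp
  qed
  have ep: "loops_bounded K (endpoint_exp s k e i) r' m"
    if "r' 8 = b" "r' 16 = 2 * b" "r' s < r 13" "r' k < d" "eval e r' m < 2" "r' i < b"
      "s \<notin> {30, 31, 32, 35, 39}" "k \<notin> {30, 31, 32, 35, 39}" "i \<notin> {30, 31, 32, 35, 39}"
      "fresh 30 e" "fresh 31 e" "fresh 39 e" "loops_bounded K e r' m" for r' s k e i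
    using that K \<open>2 \<le> K\<close> c' idx[of "r' k" "eval e r' m" "r' i"]
    by (intro loops_bounded_endpoint_exp[where b=b]) linarith+
  have rb: "r 8 = b" "r 16 = 2 * b" "r 9 = d" using c' by auto
  have valid: "loops_bounded K valid_exp (r(21 := s')) m" if "s' < r 13" for s'
    using that len \<open>b \<le> K\<close> \<open>d \<le> K\<close>
    by (simp add: valid_exp_def separation_exp_def lens bag_exp_def rb ep)
  have "loops_bounded K same_order_exp (r(21 := s', 22 := s, 23 := i, 24 := i', 25 := j, 26 := j')) m"
    if "s' < r 13" "s < r 13" "i < b" "i' < b" "j < b" "j' < b" for s s' i i' j j'
    using that \<open>2 \<le> K\<close> \<open>d \<le> K\<close> by (simp add: same_order_exp_def bag_exp_def rb ep)
  moreover have "fresh 39 same_order_exp" by (simp add: same_order_exp_def)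
  ultimately have comp: "loops_bounded K compatible_exp (r(21 := s', 22 := s)) m"
    if "s' < r 13" "s < r 13" for s s'
    using that len \<open>b \<le> K\<close> by (simp add: compatible_exp_def lens)
  let ?ex = "ex_exp 22 (Var 13) (and_exp (bit_exp (Var 13) (Var 10) (Var 22)) compatible_exp)"
  have state: "loops_bounded K (Ite (and_exp valid_exp ?ex) (power_exp (Lit 2) (Var 21)) (Lit 0)) (r(21 := s')) m"
    if s': "s' < r 13" for s'
  proof -
    have "loops_bounded K (and_exp (bit_exp (Var 13) (Var 10) (Var 22)) compatible_exp) (r(21 := s', 22 := s)) m"
      if "s < r 13" for s
    proof -
      have "loops_bounded K (bit_exp (Var 13) (Var 10) (Var 22)) (r(21 := s', 22 := s)) m"
        using that K(1) \<open>2 \<le> K\<close> by (intro loops_bounded_bit_exp) simp_all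
      then show ?thesis by (simp only: loops_bounded_logic comp[OF s' that] simp_thms)
    qed
    then have "loops_bounded K ?ex (r(21 := s')) m"
      using K(1) by (subst loops_bounded_quantifiers) simp_all
    moreover have "loops_bounded K (power_exp (Lit 2) (Var 21)) (r(21 := s')) m"
      using s' K(1) \<open>2 \<le> K\<close> by (intro loops_bounded_power_exp) simp_all
    ultimately show ?thesis
      by (simp only: loops_bounded.simps loops_bounded_logic valid[OF s'] simp_thms if_cancel)
  qed
  have fresh: "fresh 39 (Ite (and_exp valid_exp ?ex) (power_exp (Lit 2) (Var 21)) (Lit 0))" by simp
  show ?thesis
    unfolding step_exp_def loops_bounded_quantifiers(1)[OF fresh]
    by (intro conjI allI impI state) (use K(1) in simp_all)
qed

section \<open>The program\<close>

definition assign :: "nat \<Rightarrow> exp \<Rightarrow> prog" where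
  "assign x e = Seq (compile 40 e) (Seq (Const 41 0) (Add x 40 41))"

definition store_exp :: "exp \<Rightarrow> exp \<Rightarrow> prog" where
  "store_exp e f = Seq (compile 40 e) (Seq (compile 41 f) (Store 40 41))"

definition repeat_prog :: "nat \<Rightarrow> exp \<Rightarrow> prog \<Rightarrow> prog" where
  "repeat_prog y n c = Seq (assign y n) (WhileNonzero y (Seq c (assign y (Minus (Var y) (Lit 1)))))"

lemma run_assign:
  assumes "wf_exp 40 e" "x < 40" "loops_bounded K e r m"
    and Q: "\<And>r'. \<forall>i<40. r' i = (r(x := eval e r m)) i \<Longrightarrow> Q (r', m)"
  shows "run (assign x e) (r, m) (exp_time K e + 2) Q"
  unfolding assign_def
proof (rule run_Seq[OF run_compile[OF assms(1,3)]])
  fix s assume s: "snd s = m \<and> fst s 40 = eval e r m \<and> (\<forall>i<40. fst s i = r i)"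
  then obtain r1 where r1: "s = (r1, m)" by (metis prod.collapse)
  have "Q (r1(41 := 0, x := r1 40 + 0), m)" using s assms(2) by (intro Q) (auto simp: r1)
  then have "run (Add x 40 41) (r1(41 := 0), m) 1 Q" by (intro run_Add) simp_all
  then show "run (Seq (Const 41 0) (Add x 40 41)) s 2 Q"
    unfolding r1 by (rule run_Seq_Const) simp
qed

lemma run_store_exp:
  assumes "wf_exp 40 e" "wf_exp 40 f" "loops_bounded K e r m" "loops_bounded K f r m"
    and Q: "\<And>r'. \<forall>i<40. r' i = r i \<Longrightarrow> Q (r', m(eval e r m := eval f r m))"
  shows "run (store_exp e f) (r, m) (exp_time K e + (exp_time K f + 1)) Q"
  unfolding store_exp_def
proof (rule run_Seq[OF run_compile[OF assms(1,3)]])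
  fix s assume s: "snd s = m \<and> fst s 40 = eval e r m \<and> (\<forall>i<40. fst s i = r i)"
  then obtain r1 where r1: "s = (r1, m)" by (metis prod.collapse)
  have f: "eval f r1 m = eval f r m" "loops_bounded K f r1 m"
    using s assms(2,4) r1 eval_cong[of 40 f r1 r] loops_bounded_cong[of 40 f r1 r] by auto
  have wf: "wf_exp 41 f" using assms(2) by (rule wf_exp_mono) simp
  show "run (Seq (compile 41 f) (Store 40 41)) s (exp_time K f + 1) Q"
    unfolding r1
  proof (rule run_Seq[OF run_compile[OF wf f(2)]])
    fix s' assume s': "snd s' = m \<and> fst s' 41 = eval f r1 m \<and> (\<forall>i<41. fst s' i = r1 i)"
    then obtain r2 where r2: "s' = (r2, m)" by (metis prod.collapse)
    have "r2 40 = eval e r m" "r2 41 = eval f r m" "\<forall>i<40. r2 i = r i"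
      using s s' f by (auto simp: r1 r2)
    then have "Q (r2, m(r2 40 := r2 41))" using Q[of r2] by simp
    then show "run (Store 40 41) s' 1 Q" unfolding r2 by (rule run_Store) simp
  qed
qed

lemma run_Seq_assign:
  assumes "wf_exp 40 e" "x < 40" "loops_bounded K e r m"
    and "\<And>r'. \<forall>i<40. r' i = (r(x := eval e r m)) i \<Longrightarrow> run c (r', m) t Q"
  shows "run (Seq (assign x e) c) (r, m) (exp_time K e + 2 + t) Q"
  by (rule run_Seq[OF run_assign[OF assms(1-3),
      where Q="\<lambda>s. snd s = m \<and> (\<forall>i<40. fst s i = (r(x := eval e r m)) i)"]])
     (use assms(4) in auto)

lemma run_Seq_store_exp:
  assumes "wf_exp 40 e" "wf_exp 40 f" "loops_bounded K e r m" "loops_bounded K f r m"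
    and "\<And>r'. \<forall>i<40. r' i = r i \<Longrightarrow> run c (r', m(eval e r m := eval f r m)) t Q"
  shows "run (Seq (store_exp e f) c) (r, m) (exp_time K e + (exp_time K f + 1) + t) Q"
  by (rule run_Seq[OF run_store_exp[OF assms(1-4),
      where Q="\<lambda>s. snd s = m(eval e r m := eval f r m) \<and> (\<forall>i<40. fst s i = r i)"]])
     (use assms(5) in auto)

text \<open>By \<open>cong\<close> the invariant ignores the counter \<open>y\<close> and the
  scratch registers from 40 on, which the loop control overwrites. Decrementing the counter costs 6
  and the test 1, whence the \<open>7\<close>.\<close>

lemma run_repeat:
  assumes n: "wf_exp 40 n" "loops_bounded K n r m" "eval n r m = N" and y: "y < 40"
    and cong: "\<And>i r r' m. I i r m \<Longrightarrow> (\<And>j. j < 40 \<Longrightarrow> j \<noteq> y \<Longrightarrow> r' j = r j) \<Longrightarrow> I i r' m"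
    and init: "I 0 r m"
    and body: "\<And>i r m. i < N \<Longrightarrow> I i r m \<Longrightarrow>
      run c (r, m) (T i) (\<lambda>s. fst s y = r y \<and> I (Suc i) (fst s) (snd s))"
  shows "run (repeat_prog y n c) (r, m) (exp_time K n + 2 + ((\<Sum>i<N. T i + 7) + 1)) (\<lambda>s. I N (fst s) (snd s))"
  unfolding repeat_prog_def
proof (rule run_Seq_assign[OF n(1) y n(2)])
  fix r' assume r': "\<forall>i<40. r' i = (r(y := eval n r m)) i"
  define J where "J i s \<longleftrightarrow> fst s y = N - i \<and> I i (fst s) (snd s)" for i and s :: state
  have J0: "J 0 (r', m)"
    unfolding J_def using r' y n(3) cong[OF init, of r'] by auto
  have "run (WhileNonzero y (Seq c (assign y (Minus (Var y) (Lit 1))))) (r', m)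
      ((\<Sum>i\<in>{0..<N}. (T i + 6) + 1) + 1) (J N)"
  proof (rule run_While[where I=J])
    show "J 0 (r', m)" by (rule J0)
    fix i s assume i: "i < N" and J: "J i s"
    obtain r1 m1 where s: "s = (r1, m1)" by (cases s)
    have "run (Seq c (assign y (Minus (Var y) (Lit 1)))) s (T i + 6) (J (Suc i))"
      unfolding s
    proof (rule run_Seq[OF body[OF i]])
      show "I i r1 m1" using J by (simp add: J_def s)
      fix s' assume s': "fst s' y = r1 y \<and> I (Suc i) (fst s') (snd s')"
      obtain r2 m2 where s'': "s' = (r2, m2)" by (cases s')
      have "run (assign y (Minus (Var y) (Lit 1))) (r2, m2) (exp_time 0 (Minus (Var y) (Lit 1)) + 2) (J (Suc i))"
      proof (rule run_assign)
        fix r3 assume r3: "\<forall>i<40. r3 i = (r2(y := eval (Minus (Var y) (Lit 1)) r2 m2)) i"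
        have "I (Suc i) r2 m2" using s' s'' by simp
        then have "I (Suc i) r3 m2" by (rule cong) (use r3 in simp)
        moreover have "r3 y = N - Suc i" using r3 y s' J by (simp add: J_def s s'')
        ultimately show "J (Suc i) (r3, m2)" by (simp add: J_def)
      qed (use y in simp_all)
      then show "run (assign y (Minus (Var y) (Lit 1))) s' 6 (J (Suc i))" by (simp add: s'')
    qed
    then show "fst s y \<noteq> 0 \<and> run (Seq c (assign y (Minus (Var y) (Lit 1)))) s (T i + 6) (J (Suc i))"
      using i J by (simp add: J_def)
  qed (simp_all add: J_def)
  then show "run (WhileNonzero y (Seq c (assign y (Minus (Var y) (Lit 1))))) (r', m)
      ((\<Sum>i<N. T i + 7) + 1) (\<lambda>s. I N (fst s) (snd s))"
    by (rule run_mono) (auto simp: J_def atLeast0LessThan add.commute)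
qed

text \<open>The \<open>2\<close> skips the two counts at the start of the input; each list is
  preceded by a cell with its length.\<close>

definition address :: "nat list list \<Rightarrow> nat \<Rightarrow> nat" where
  "address Ls t = 2 + (\<Sum>i<t. 1 + length (Ls ! i))"

lemma address_0 [simp]: "address Ls 0 = 2"
  by (simp add: address_def)

lemma address_Suc: "address Ls (Suc t) = address Ls t + 1 + length (Ls ! t)"
  by (simp add: address_def)

lemma address_mono: "t \<le> t' \<Longrightarrow> address Ls t \<le> address Ls t'"
  unfolding address_def by (intro add_left_mono sum_mono2) auto

lemma address_eq_length:
  "t \<le> length Ls \<Longrightarrow> address Ls t = 2 + length (concat (map (\<lambda>xs. length xs # xs) (take t Ls)))"
  by (induction t) (auto simp: address_Suc take_Suc_conv_app_nth)

lemma encoded_memory: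
  fixes As Bs :: "nat list list"
  defines "m \<equiv> snd (initial_state (encode_input As Bs))" and "Ls \<equiv> As @ Bs"
  shows "m 0 = length As" "m 1 = length Bs"
    "\<And>t. t < length Ls \<Longrightarrow> stores_list m (address Ls t) (Ls ! t)"
    "\<And>a. address Ls (length Ls) \<le> a \<Longrightarrow> m a = 0"
proof -
  let ?f = "\<lambda>xs::nat list. length xs # xs"
  define xs where "xs = encode_input As Bs"
  have m: "m a = (if a < length xs then xs ! a else 0)" for a
    by (simp add: m_def initial_state_def xs_def)
  have xs: "xs = length As # length Bs # concat (map ?f Ls)"
    by (simp add: xs_def encode_input_def Ls_def)
  show "m 0 = length As" "m 1 = length Bs" by (simp_all add: m xs)
  have len: "length xs = address Ls (length Ls)" by (simp add: xs address_eq_length)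
  show "m a = 0" if "address Ls (length Ls) \<le> a" for a using that by (simp add: m len)
  fix t assume t: "t < length Ls"
  let ?pre = "length As # length Bs # concat (map ?f (take t Ls))"
  have split: "xs = ?pre @ ?f (Ls ! t) @ concat (map ?f (drop (Suc t) Ls))"
  proof -
    have "map ?f Ls = map ?f (take t Ls) @ ?f (Ls ! t) # map ?f (drop (Suc t) Ls)"
      using arg_cong[OF id_take_nth_drop[OF t], of "map ?f"] by (simp only: map_append list.map)
    then show ?thesis by (simp only: xs concat_append concat.simps append_Cons)
  qed
  have pre: "length ?pre = address Ls t" using t by (simp add: address_eq_length)
  have "xs ! (address Ls t + i) = ?f (Ls ! t) ! i \<and> address Ls t + i < length xs"
    if "i < Suc (length (Ls ! t))" for i
    using that unfolding split pre[symmetric] by (simp only: nth_append_length_plus nth_append) simp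
  from this[of 0] this[of "Suc _"] show "stores_list m (address Ls t) (Ls ! t)"
    by (simp add: stores_list_def m)
qed

lemma stores_list_cong:
  "stores_list m p B \<Longrightarrow> (\<And>a. a \<le> p + length B \<Longrightarrow> m' a = m a) \<Longrightarrow> stores_list m' p B"
  by (auto simp: stores_list_def)

definition advance :: prog where
  "advance = assign 3 (Plus (Plus (Var 3) (Lit 1)) (Mem (Var 3)))"

lemma run_advance:
  assumes "stores_list m (address Ls t) (Ls ! t)" "r 3 = address Ls t"
    and "\<And>r'. \<forall>i<40. r' i = (r(3 := address Ls (Suc t))) i \<Longrightarrow> Q (r', m)"
  shows "run advance (r, m) 10 Q"
proof -
  have "run advance (r, m) (exp_time 0 (Plus (Plus (Var 3) (Lit 1)) (Mem (Var 3))) + 2) Q"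
    unfolding advance_def using assms(1,2)
    by (intro run_assign assms(3)) (simp_all add: stores_list_def address_Suc)
  then show ?thesis by simp
qed

text \<open>The input does not say where the bags begin. Jumping from list to list by the stored
  lengths finds the place in time proportional to the number of lists; going on through the bags
  yields the maximal bag size.\<close>

definition scan_prog :: prog where
  "scan_prog = Seq (assign 1 (Mem (Lit 0))) (Seq (assign 2 (Mem (Lit 1))) (Seq (assign 3 (Lit 2))
    (Seq (repeat_prog 14 (Var 1) advance) (Seq (assign 4 (Var 3))
      (repeat_prog 14 (Var 2) (Seq (assign 8 (Ite (le_exp (Var 8) (Mem (Var 3))) (Mem (Var 3)) (Var 8))) advance))))))"

lemma run_scan_prog:
  fixes As Bs :: "nat list list"
  defines "s \<equiv> initial_state (encode_input As Bs)" and "Ls \<equiv> As @ Bs"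
  shows "run scan_prog s (60 + 17 * length As + 40 * length Bs)
    (\<lambda>s'. snd s' = snd s \<and> fst s' 0 = 0 \<and> fst s' 1 = length As \<and> fst s' 2 = length Bs \<and>
       fst s' 3 = address Ls (length Ls) \<and> fst s' 4 = address Ls (length As) \<and>
       fst s' 8 = Max (insert 0 (length ` set Bs)))"
proof -
  note mem = encoded_memory[where As=As and Bs=Bs, folded s_def Ls_def]
  obtain m where m: "s = (\<lambda>_. 0, m)" by (simp add: s_def initial_state_def)
  have len: "length Ls = length As + length Bs" by (simp add: Ls_def)
  define I where "I t r m' \<longleftrightarrow> m' = m \<and> r 0 = 0 \<and> r 1 = length As \<and> r 2 = length Bs \<and>
      r 3 = address Ls t \<and> r 8 = 0" for t and r m' :: "nat \<Rightarrow> nat"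
  define J where "J t r m' \<longleftrightarrow> m' = m \<and> r 0 = 0 \<and> r 1 = length As \<and> r 2 = length Bs \<and>
      r 3 = address Ls (length As + t) \<and> r 4 = address Ls (length As) \<and>
      r 8 = Max (insert 0 (length ` set (take t Bs)))" for t and r m' :: "nat \<Rightarrow> nat"
  have first: "run (repeat_prog 14 (Var 1) advance) (r, m)
      (exp_time 0 (Var 1) + 2 + ((\<Sum>i<length As. 10 + 7) + 1)) (\<lambda>s. I (length As) (fst s) (snd s))"
    if "I 0 r m" for r
  proof (rule run_repeat)
    fix t r m' assume t: "t < length As" and I: "I t r m'"
    then show "run advance (r, m') 10 (\<lambda>s. fst s 14 = r 14 \<and> I (Suc t) (fst s) (snd s))"
      using mem(3)[of t] by (intro run_advance[where Ls=Ls and t=t]) (auto simp: I_def m len)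
  qed (use that in \<open>auto simp: I_def\<close>)
  have second: "run (repeat_prog 14 (Var 2)
        (Seq (assign 8 (Ite (le_exp (Var 8) (Mem (Var 3))) (Mem (Var 3)) (Var 8))) advance)) (r, m)
      (exp_time 0 (Var 2) + 2 + ((\<Sum>i<length Bs. 30 + 7) + 1)) (\<lambda>s. J (length Bs) (fst s) (snd s))"
    if "J 0 r m" for r
  proof (rule run_repeat)
    fix t r m' assume t: "t < length Bs" and J: "J t r m'"
    let ?e = "Ite (le_exp (Var 8) (Mem (Var 3))) (Mem (Var 3)) (Var 8)"
    have st: "stores_list m' (address Ls (length As + t)) (Ls ! (length As + t))" "Ls ! (length As + t) = Bs ! t"
      using mem(3)[of "length As + t"] t J by (auto simp: J_def m len Ls_def)
    have "run (Seq (assign 8 ?e) advance) (r, m') (exp_time 0 ?e + 2 + 10)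
      (\<lambda>s. fst s 14 = r 14 \<and> J (Suc t) (fst s) (snd s))"
    proof (rule run_Seq_assign)
      fix r' assume r': "\<forall>i<40. r' i = (r(8 := eval ?e r m')) i"
      have "m' (r 3) = length (Bs ! t)" using st J by (simp add: J_def stores_list_def)
      then have "eval ?e r m' = max (length (Bs ! t)) (r 8)" by simp
      also have "\<dots> = Max (insert (length (Bs ! t)) (insert 0 (length ` set (take t Bs))))"
        using J by (subst Max_insert) (simp_all add: J_def)
      also have "insert (length (Bs ! t)) (insert 0 (length ` set (take t Bs))) =
          insert 0 (length ` set (take (Suc t) Bs))"
        using t by (auto simp: take_Suc_conv_app_nth)
      finally have "\<forall>i<40. r' i = (r(8 := Max (insert 0 (length ` set (take (Suc t) Bs))))) i"
        using r' by (simp only:)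
      then show "run advance (r', m') 10 (\<lambda>s. fst s 14 = r 14 \<and> J (Suc t) (fst s) (snd s))"
        using st J by (intro run_advance[where Ls=Ls and t="length As + t"]) (auto simp: J_def)
    qed simp_all
    then show "run (Seq (assign 8 ?e) advance) (r, m') 30
      (\<lambda>s. fst s 14 = r 14 \<and> J (Suc t) (fst s) (snd s))"
      by (rule run_mono) (simp_all add: le_exp_def)
  qed (use that in \<open>auto simp: J_def\<close>)
  let ?rest = "Seq (assign 4 (Var 3)) (repeat_prog 14 (Var 2)
      (Seq (assign 8 (Ite (le_exp (Var 8) (Mem (Var 3))) (Mem (Var 3)) (Var 8))) advance))"
  have rest: "run ?rest (r, m) (exp_time 0 (Var 3) + 2 +
      (exp_time 0 (Var 2) + 2 + ((\<Sum>i<length Bs. 30 + 7) + 1))) (\<lambda>s. J (length Bs) (fst s) (snd s))"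
    if "I (length As) r m" for r
    by (rule run_Seq_assign, simp, simp, simp, rule second) (use that in \<open>simp add: I_def J_def\<close>)
  have "run scan_prog s (exp_time 0 (Mem (Lit 0)) + 2 + (exp_time 0 (Mem (Lit 1)) + 2 +
      (exp_time 0 (Lit 2) + 2 + ((exp_time 0 (Var 1) + 2 + ((\<Sum>i<length As. 10 + 7) + 1)) +
      (exp_time 0 (Var 3) + 2 + (exp_time 0 (Var 2) + 2 + ((\<Sum>i<length Bs. 30 + 7) + 1)))))))
      (\<lambda>s. J (length Bs) (fst s) (snd s))"
    unfolding scan_prog_def m
  proof (rule run_Seq_assign, simp, simp, simp, rule run_Seq_assign, simp, simp, simp,
      rule run_Seq_assign, simp, simp, simp, rule run_Seq[OF first])
    fix r1 r2 r3 assume "\<forall>i<40. r1 i = ((\<lambda>_. 0)(1 := eval (Mem (Lit 0)) (\<lambda>_. 0) m)) i"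
      "\<forall>i<40. r2 i = (r1(2 := eval (Mem (Lit 1)) r1 m)) i" "\<forall>i<40. r3 i = (r2(3 := eval (Lit 2) r2 m)) i"
    then show "I 0 r3 m" using mem(1,2) by (simp add: I_def m)
    fix s' assume I: "I (length As) (fst s') (snd s')"
    then obtain r' where s': "s' = (r', m)" unfolding I_def by (metis prod.collapse)
    show "run ?rest s' (exp_time 0 (Var 3) + 2 +
      (exp_time 0 (Var 2) + 2 + ((\<Sum>i<length Bs. 30 + 7) + 1))) (\<lambda>s. J (length Bs) (fst s) (snd s))"
      unfolding s' by (rule rest) (use I in \<open>simp add: s'\<close>)
  qed
  then show ?thesis by (rule run_mono) (simp_all add: J_def len m)
qed

text \<open>From \<open>base\<close> on there are \<open>n\<close> row addresses, of which
  \<open>T\<close> are written, and then \<open>n\<close> rows of \<open>n\<close> cells with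
  \<open>S\<close> the set of nonzero entries. Clearing the rows would take quadratic time; they
  start as zero because the memory behind the input does.\<close>

definition matrix_memory ::
    "(nat \<Rightarrow> nat) \<Rightarrow> nat \<Rightarrow> nat \<Rightarrow> nat \<Rightarrow> (nat \<times> nat) set \<Rightarrow> (nat \<Rightarrow> nat) \<Rightarrow> bool" where
  "matrix_memory m0 base n T S m \<longleftrightarrow> (\<forall>a<base. m a = m0 a) \<and>
     (\<forall>v<T. m (base + v) = base + n + v * n) \<and>
     (\<forall>v<n. \<forall>w<n. m (base + n + v * n + w) \<noteq> 0 \<longleftrightarrow> (v, w) \<in> S) \<and>
     (\<forall>a\<ge>base + n + n * n. m a = 0)"

lemma matrix_index_eq_iff:
  fixes n :: nat
  assumes "w < n" "x < n"
  shows "v * n + w = u * n + x \<longleftrightarrow> v = u \<and> w = x"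
proof
  assume *: "v * n + w = u * n + x"
  have "(v * n + w) div n = v" "(u * n + x) div n = u" using assms by simp_all
  then have "v = u" using * by metis
  then show "v = u \<and> w = x" using * by simp
qed simp

lemma matrix_index_less:
  fixes n :: nat
  assumes "u < n" "x < n" shows "u * n + x < n * n"
proof -
  have "u * n + x < Suc u * n" using assms by simp
  also have "\<dots> \<le> n * n" using assms by (intro mult_right_mono) auto
  finally show ?thesis .
qed

lemma matrix_memory_set:
  assumes mm: "matrix_memory m0 base n T S m" and "u < n" "x < n" "T \<le> n"
  shows "matrix_memory m0 base n T (insert (u, x) S) (m(base + n + u * n + x := 1))"
proof -
  let ?a = "base + n + u * n + x"
  have a: "?a < base + n + n * n" using matrix_index_less[OF assms(2,3)] by linarith
  have idx: "base + n + v * n + w = ?a \<longleftrightarrow> v = u \<and> w = x" if "w < n" for v w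
    using matrix_index_eq_iff[OF that assms(3), of v u] by linarith
  show ?thesis
    unfolding matrix_memory_def
  proof (intro conjI allI impI)
    fix v assume "v < T"
    then have "base + v \<noteq> ?a" using assms(4) by linarith
    then show "(m(?a := 1)) (base + v) = base + n + v * n"
      using mm \<open>v < T\<close> by (simp add: matrix_memory_def)
  next
    fix v w assume "v < n" "w < n"
    then show "(m(?a := 1)) (base + n + v * n + w) \<noteq> 0 \<longleftrightarrow> (v, w) \<in> insert (u, x) S"
      using mm idx[of w v] by (auto simp: matrix_memory_def)
  qed (use mm a in \<open>simp_all add: matrix_memory_def\<close>)
qed

lemma matrix_memory_row:
  assumes mm: "matrix_memory m0 base n u S m" and "u < n"
  shows "matrix_memory m0 base n (Suc u) S (m(base + u := base + n + u * n))"
  unfolding matrix_memory_def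
proof (intro conjI allI impI)
  fix v assume "v < Suc u"
  then show "(m(base + u := base + n + u * n)) (base + v) = base + n + v * n"
    using mm by (cases "v = u") (simp_all add: matrix_memory_def)
qed (use assms in \<open>simp_all add: matrix_memory_def\<close>)

text \<open>Register 6 grows by \<open>n\<close> per row, which yields the row addresses without
  multiplication. Register 17 ends one cell behind the adjacency list, which is where the next list
  starts.\<close>

definition matrix_prog :: prog where
  "matrix_prog = Seq (assign 5 (Var 3)) (Seq (assign 6 (Plus (Var 5) (Var 1)))
     (Seq (assign 3 (Lit 2)) (Seq (assign 7 (Lit 0))
     (repeat_prog 14 (Var 1)
       (Seq (store_exp (Plus (Var 5) (Var 7)) (Var 6))
       (Seq (store_exp (Plus (Var 6) (Var 7)) (Lit 1))
       (Seq (assign 17 (Plus (Var 3) (Lit 1)))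
       (Seq (repeat_prog 15 (Mem (Var 3))
              (Seq (store_exp (Plus (Var 6) (Mem (Var 17))) (Lit 1)) (assign 17 (Plus (Var 17) (Lit 1)))))
       (Seq (assign 3 (Var 17))
       (Seq (assign 6 (Plus (Var 6) (Var 1))) (assign 7 (Plus (Var 7) (Lit 1)))))))))))))"

lemma run_matrix_prog:
  fixes As Bs :: "nat list list" and n b :: nat
  defines "m0 \<equiv> snd (initial_state (encode_input As Bs))" and "Ls \<equiv> As @ Bs"
  assumes adj: "adjacency_lists n E As" and graph: "simple_graph {..<n} E"
    and r: "r 0 = 0" "r 1 = n" "r 2 = length Bs" "r 3 = address Ls (length Ls)" "r 4 = address Ls n" "r 8 = b"
  shows "run matrix_prog (r, m0) (40 + (\<Sum>u<n. 70 + 25 * length (As ! u)))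
    (\<lambda>(r, m). (\<forall>t<length Ls. stores_list m (address Ls t) (Ls ! t)) \<and>
       stores_graph m (r 5) n E \<and> stores_list m (r 6) [] \<and>
       r 0 = 0 \<and> r 1 = n \<and> r 2 = length Bs \<and> r 4 = address Ls n \<and> r 8 = b)"
proof -
  note mem = encoded_memory[where As=As and Bs=Bs, folded m0_def Ls_def]
  define base where "base = address Ls (length Ls)"
  have setA: "set (As ! u) = {v. {u, v} \<in> E}" if "u < n" for u
    using adj that by (auto simp: adjacency_lists_def)
  have lenA: "length As = n" using adj by (simp add: adjacency_lists_def)
  have edge: "v < n" if "{u, v} \<in> E" for u v using graph that by (auto simp: simple_graph_def)
  have stores: "stores_list m (address Ls t) (Ls ! t)"
    if "t < length Ls" "\<forall>a<base. m a = m0 a" for t m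
  proof (rule stores_list_cong[OF mem(3)[OF that(1)]])
    have "address Ls (Suc t) \<le> base" unfolding base_def using that(1) by (intro address_mono) simp
    then show "m a = m0 a" if "a \<le> address Ls t + length (Ls ! t)" for a
      using that \<open>\<forall>a<base. m a = m0 a\<close> by (simp add: address_Suc)
  qed
  define S where "S u = {(v, w). v < u \<and> (v = w \<or> {v, w} \<in> E)}" for u
  define R where "R r \<longleftrightarrow> r 0 = 0 \<and> r 1 = n \<and> r 2 = length Bs \<and> r 4 = address Ls n \<and>
      r 5 = base \<and> r 8 = b" for r :: "nat \<Rightarrow> nat"
  define I where "I u r m \<longleftrightarrow> R r \<and> r 3 = address Ls u \<and> r 6 = base + n + u * n \<and> r 7 = u \<and>
      matrix_memory m0 base n u (S u) m" for u r m
  define J where "J u i r m \<longleftrightarrow> R r \<and> r 3 = address Ls u \<and> r 6 = base + n + u * n \<and> r 7 = u \<and>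
      r 17 = address Ls u + 1 + i \<and>
      matrix_memory m0 base n (Suc u) (insert (u, u) (S u) \<union> {u} \<times> set (take i (As ! u))) m" for u i r m
  have inner: "run (repeat_prog 15 (Mem (Var 3))
       (Seq (store_exp (Plus (Var 6) (Mem (Var 17))) (Lit 1)) (assign 17 (Plus (Var 17) (Lit 1))))) (r, m)
      (exp_time 0 (Mem (Var 3)) + 2 + ((\<Sum>i<length (As ! u). 16 + 7) + 1))
      (\<lambda>s. fst s 14 = r 14 \<and> J u (length (As ! u)) (fst s) (snd s))"
    if J0: "J u 0 r m" and u: "u < n" for u r m
  proof (rule run_repeat[where I="\<lambda>i r' m. r' 14 = r 14 \<and> J u i r' m"])
    have Lu: "Ls ! u = As ! u" using u lenA by (simp add: Ls_def nth_append)
    have stu: "stores_list m (address Ls u) (As ! u)" if "J u i r m" for i r m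
      using stores[of u m] that u lenA Lu by (auto simp: J_def matrix_memory_def Ls_def)
    show "eval (Mem (Var 3)) r m = length (As ! u)"
      using stu[OF J0] J0 by (simp add: stores_list_def J_def)
    fix i r1 m assume i: "i < length (As ! u)" and J: "r1 14 = r 14 \<and> J u i r1 m"
    have v: "m (r1 17) = As ! u ! i" using stu[of i r1 m] J i by (simp add: J_def stores_list_def)
    have vn: "As ! u ! i < n" using setA[OF u] edge i nth_mem by blast
    let ?m = "m(eval (Plus (Var 6) (Mem (Var 17))) r1 m := eval (Lit 1) r1 m)"
    have "matrix_memory m0 base n (Suc u) (insert (u, As ! u ! i)
        (insert (u, u) (S u) \<union> {u} \<times> set (take i (As ! u)))) ?m"
      using matrix_memory_set[of m0 base n "Suc u" _ m u "As ! u ! i"] u vn v J by (simp add: J_def add.assoc)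
    moreover have "insert (u, As ! u ! i) (insert (u, u) (S u) \<union> {u} \<times> set (take i (As ! u))) =
        insert (u, u) (S u) \<union> {u} \<times> set (take (Suc i) (As ! u))"
      using i by (auto simp: take_Suc_conv_app_nth)
    ultimately have mm: "matrix_memory m0 base n (Suc u)
        (insert (u, u) (S u) \<union> {u} \<times> set (take (Suc i) (As ! u))) ?m" by (simp only:)
    have "run (Seq (store_exp (Plus (Var 6) (Mem (Var 17))) (Lit 1)) (assign 17 (Plus (Var 17) (Lit 1)))) (r1, m)
       (exp_time 0 (Plus (Var 6) (Mem (Var 17))) + (exp_time 0 (Lit 1) + 1) + (exp_time 0 (Plus (Var 17) (Lit 1)) + 2))
       (\<lambda>s. fst s 15 = r1 15 \<and> fst s 14 = r 14 \<and> J u (Suc i) (fst s) (snd s))"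
    proof (rule run_Seq_store_exp, simp, simp, simp, simp, rule run_assign, simp, simp, simp)
      fix r2 r3 assume "\<forall>i<40. r2 i = r1 i" "\<forall>i<40. r3 i = (r2(17 := eval (Plus (Var 17) (Lit 1)) r2 ?m)) i"
      then show "fst (r3, ?m) 15 = r1 15 \<and> fst (r3, ?m) 14 = r 14 \<and> J u (Suc i) (fst (r3, ?m)) (snd (r3, ?m))"
        using J mm unfolding J_def R_def by simp
    qed
    then show "run (Seq (store_exp (Plus (Var 6) (Mem (Var 17))) (Lit 1)) (assign 17 (Plus (Var 17) (Lit 1)))) (r1, m)
       16 (\<lambda>s. fst s 15 = r1 15 \<and> fst s 14 = r 14 \<and> J u (Suc i) (fst s) (snd s))"
      by (rule run_mono) simp_all
  qed (use J0 in \<open>simp_all add: J_def R_def\<close>)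
  let ?tail = "Seq (assign 3 (Var 17)) (Seq (assign 6 (Plus (Var 6) (Var 1))) (assign 7 (Plus (Var 7) (Lit 1))))"
  have tail: "run ?tail (r, m) (exp_time 0 (Var 17) + 2 + (exp_time 0 (Plus (Var 6) (Var 1)) + 2 +
      (exp_time 0 (Plus (Var 7) (Lit 1)) + 2))) (\<lambda>s. fst s 14 = r 14 \<and> I (Suc u) (fst s) (snd s))"
    if J: "J u (length (As ! u)) r m" and u: "u < n" for u r m
  proof (rule run_Seq_assign, simp, simp, simp, rule run_Seq_assign, simp, simp, simp, rule run_assign, simp, simp, simp)
    fix r1 r2 r3 assume r: "\<forall>i<40. r1 i = (r(3 := eval (Var 17) r m)) i"
      "\<forall>i<40. r2 i = (r1(6 := eval (Plus (Var 6) (Var 1)) r1 m)) i"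
      "\<forall>i<40. r3 i = (r2(7 := eval (Plus (Var 7) (Lit 1)) r2 m)) i"
    have "insert (u, u) (S u) \<union> {u} \<times> set (take (length (As ! u)) (As ! u)) = S (Suc u)"
      using setA[OF u] by (auto simp: S_def less_Suc_eq)
    then have "matrix_memory m0 base n (Suc u) (S (Suc u)) m" using J by (simp add: J_def)
    moreover have "Ls ! u = As ! u" using u lenA by (simp add: Ls_def nth_append)
    ultimately show "fst (r3, m) 14 = r 14 \<and> I (Suc u) (fst (r3, m)) (snd (r3, m))"
      using J r unfolding J_def I_def R_def by (simp add: address_Suc)
  qed
  let ?body = "Seq (store_exp (Plus (Var 5) (Var 7)) (Var 6))
       (Seq (store_exp (Plus (Var 6) (Var 7)) (Lit 1))
       (Seq (assign 17 (Plus (Var 3) (Lit 1)))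
       (Seq (repeat_prog 15 (Mem (Var 3))
              (Seq (store_exp (Plus (Var 6) (Mem (Var 17))) (Lit 1)) (assign 17 (Plus (Var 17) (Lit 1))))) ?tail)))"
  have body: "run ?body (r, m) (60 + 25 * length (As ! u)) (\<lambda>s. fst s 14 = r 14 \<and> I (Suc u) (fst s) (snd s))"
    if I: "I u r m" and u: "u < n" for u r m
  proof -
    let ?t1 = "exp_time 0 (Mem (Var 3)) + 2 + ((\<Sum>i<length (As ! u). 16 + 7) + 1)"
    let ?t2 = "exp_time 0 (Var 17) + 2 + (exp_time 0 (Plus (Var 6) (Var 1)) + 2 + (exp_time 0 (Plus (Var 7) (Lit 1)) + 2))"
    have "run ?body (r, m) (exp_time 0 (Plus (Var 5) (Var 7)) + (exp_time 0 (Var 6) + 1) +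
      (exp_time 0 (Plus (Var 6) (Var 7)) + (exp_time 0 (Lit 1) + 1) +
      (exp_time 0 (Plus (Var 3) (Lit 1)) + 2 + (?t1 + ?t2)))) (\<lambda>s. fst s 14 = r 14 \<and> I (Suc u) (fst s) (snd s))"
    proof (rule run_Seq_store_exp, simp, simp, simp, simp, rule run_Seq_store_exp, simp, simp, simp, simp,
        rule run_Seq_assign, simp, simp, simp)
      fix r1 r2 r3
      let ?m1 = "m(eval (Plus (Var 5) (Var 7)) r m := eval (Var 6) r m)"
      let ?m2 = "?m1(eval (Plus (Var 6) (Var 7)) r1 ?m1 := eval (Lit 1) r1 ?m1)"
      assume rs: "\<forall>i<40. r1 i = r i" "\<forall>i<40. r2 i = r1 i"
        "\<forall>i<40. r3 i = (r2(17 := eval (Plus (Var 3) (Lit 1)) r2 ?m2)) i"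
      have "matrix_memory m0 base n (Suc u) (S u) ?m1"
        using matrix_memory_row[of m0 base n u "S u" m] I u by (simp add: I_def R_def)
      then have "matrix_memory m0 base n (Suc u) (insert (u, u) (S u)) ?m2"
        using matrix_memory_set[of m0 base n "Suc u" "S u" ?m1 u u] I u rs by (simp add: I_def R_def)
      then have J: "J u 0 r3 ?m2" and r14: "r3 14 = r 14"
        using I rs unfolding J_def I_def R_def by auto
      show "run (Seq (repeat_prog 15 (Mem (Var 3))
              (Seq (store_exp (Plus (Var 6) (Mem (Var 17))) (Lit 1)) (assign 17 (Plus (Var 17) (Lit 1))))) ?tail)
          (r3, ?m2) (?t1 + ?t2) (\<lambda>s. fst s 14 = r 14 \<and> I (Suc u) (fst s) (snd s))"
      proof (rule run_Seq[OF inner[OF J u]])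
        fix s assume s: "fst s 14 = r3 14 \<and> J u (length (As ! u)) (fst s) (snd s)"
        then have "run ?tail (fst s, snd s) ?t2 (\<lambda>s'. fst s' 14 = fst s 14 \<and> I (Suc u) (fst s') (snd s'))"
          by (intro tail u) blast
        then show "run ?tail s ?t2 (\<lambda>s. fst s 14 = r 14 \<and> I (Suc u) (fst s) (snd s))"
          using s r14 by simp
      qed
    qed
    then show ?thesis by (rule run_mono) simp_all
  qed
  have loop: "run (repeat_prog 14 (Var 1) ?body) (r, m)
      (exp_time 0 (Var 1) + 2 + ((\<Sum>u<n. (60 + 25 * length (As ! u)) + 7) + 1)) (\<lambda>s. I n (fst s) (snd s))"
    if I0: "I 0 r m" for r m
    by (rule run_repeat[where I=I])
      (use I0 body in \<open>simp_all add: I_def R_def\<close>)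
  have "run matrix_prog (r, m0) (exp_time 0 (Var 3) + 2 + (exp_time 0 (Plus (Var 5) (Var 1)) + 2 +
      (exp_time 0 (Lit 2) + 2 + (exp_time 0 (Lit 0) + 2 +
      (exp_time 0 (Var 1) + 2 + ((\<Sum>u<n. (60 + 25 * length (As ! u)) + 7) + 1)))))) (\<lambda>s. I n (fst s) (snd s))"
    unfolding matrix_prog_def
  proof (rule run_Seq_assign, simp, simp, simp, rule run_Seq_assign, simp, simp, simp,
      rule run_Seq_assign, simp, simp, simp, rule run_Seq_assign, simp, simp, simp, rule loop)
    fix r1 r2 r3 r4 assume rs: "\<forall>i<40. r1 i = (r(5 := eval (Var 3) r m0)) i"
      "\<forall>i<40. r2 i = (r1(6 := eval (Plus (Var 5) (Var 1)) r1 m0)) i"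
      "\<forall>i<40. r3 i = (r2(3 := eval (Lit 2) r2 m0)) i" "\<forall>i<40. r4 i = (r3(7 := eval (Lit 0) r3 m0)) i"
    have "matrix_memory m0 base n 0 (S 0) m0"
      using mem(4) by (auto simp: matrix_memory_def S_def base_def)
    then show "I 0 r4 m0" using rs r by (simp add: I_def R_def base_def)
  qed
  then show ?thesis
  proof (rule run_mono)
    show "exp_time 0 (Var 3) + 2 + (exp_time 0 (Plus (Var 5) (Var 1)) + 2 +
      (exp_time 0 (Lit 2) + 2 + (exp_time 0 (Lit 0) + 2 +
      (exp_time 0 (Var 1) + 2 + ((\<Sum>u<n. (60 + 25 * length (As ! u)) + 7) + 1)))))
      \<le> 40 + (\<Sum>u<n. 70 + 25 * length (As ! u))"
      by (simp add: sum.distrib)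
    fix s assume I: "I n (fst s) (snd s)"
    obtain r' m where s: "s = (r', m)" by (cases s)
    have mm: "matrix_memory m0 base n n (S n) m" and R: "R r'" and r6: "r' 6 = base + n + n * n"
      using I by (auto simp: I_def s)
    have "\<forall>t<length Ls. stores_list m (address Ls t) (Ls ! t)"
      using stores mm by (auto simp: matrix_memory_def)
    moreover have "stores_graph m base n E"
      using mm by (simp add: stores_graph_def matrix_memory_def S_def)
    \<comment> \<open>The zero cell behind the matrix reads as an empty list. Register 6 ends there
      and supplies the empty bag in front of the path.\<close>
    moreover have "stores_list m (base + n + n * n) []"
      using mm by (simp add: stores_list_def matrix_memory_def)
    ultimately show "case s of (r, m) \<Rightarrow> (\<forall>t<length Ls. stores_list m (address Ls t) (Ls ! t)) \<and>
       stores_graph m (r 5) n E \<and> stores_list m (r 6) [] \<and>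
       r 0 = 0 \<and> r 1 = n \<and> r 2 = length Bs \<and> r 4 = address Ls n \<and> r 8 = b"
      using R r6 by (simp add: s R_def)
  qed
qed

definition states_exp :: exp where
  "states_exp = power_exp (Var 16) (mult_exp (Var 16) (Var 9))"

text \<open>For every \<open>d < b\<close> the whole dynamic program is run, and the result grows by
  1 if no state survives. The value 1 given to register 10 is \<open>set_encode {0}\<close>, and
  register 6 points to an empty list, the bag in front of the path.\<close>

definition main_prog :: prog where
  "main_prog = Seq (assign 16 (Plus (Var 8) (Var 8))) (Seq (assign 9 (Lit 0))
     (repeat_prog 14 (Var 8)
       (Seq (assign 13 states_exp) (Seq (assign 10 (Lit 1)) (Seq (assign 11 (Var 6)) (Seq (assign 3 (Var 4))
       (Seq (repeat_prog 15 (Var 2) (Seq (assign 10 step_exp) (Seq (assign 11 (Var 3)) advance)))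
       (Seq (assign 0 (Plus (Var 0) (Ite (Var 10) (Lit 0) (Lit 1)))) (assign 9 (Plus (Var 9) (Lit 1)))))))))))"

lemma reachable_subset: "0 < b \<Longrightarrow> reachable E d b Bs t \<subseteq> {..<(2 * b) ^ (2 * b * d)}"
  by (cases t) auto

lemma set_encode_eq_0_iff: "finite A \<Longrightarrow> set_encode A = 0 \<longleftrightarrow> A = {}"
  by (metis set_decode_zero set_encode_empty set_encode_inverse)

lemma run_main_prog:
  fixes As Bs :: "nat list list" and n b K :: nat
  defines "Ls \<equiv> As @ Bs" and "K \<equiv> (2 * b) ^ (2 * b * b)"
  assumes lenA: "length As = n" and b: "0 < b"
    and stores: "\<And>t. t < length Ls \<Longrightarrow> stores_list m (address Ls t) (Ls ! t)"
    and graph: "stores_graph m (r 5) n E" and zero: "stores_list m (r 6) []"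
    and bags: "\<And>B. B \<in> set Bs \<Longrightarrow> length B \<le> b \<and> set B \<subseteq> {..<n}"
    and r: "r 0 = 0" "r 2 = length Bs" "r 4 = address Ls n" "r 8 = b"
  shows "run main_prog (r, m)
    (20 + b * (exp_time K states_exp + 60 + length Bs * (exp_time K step_exp + 30)))
    (\<lambda>s. fst s 0 = card {d. d < b \<and> reachable E d b Bs (length Bs) = {}})"
proof -
  have pow: "k \<le> (2 * b) ^ k" for k
  proof -
    have "k < 2 ^ k" by (rule less_exp)
    also have "(2::nat) ^ k \<le> (2 * b) ^ k" using b by (intro power_mono) auto
    finally show ?thesis by simp
  qed
  \<comment> \<open>\<open>K\<close> is the number of states for \<open>d = b\<close> and dominates
    those of all smaller dimensions.\<close>
  have K: "2 * b * d \<le> K" "(2 * b) ^ (2 * b * d) \<le> K" if "d < b" for d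
  proof -
    have le: "2 * b * d \<le> 2 * b * b" using that by (intro mult_left_mono) auto
    then show "2 * b * d \<le> K" unfolding K_def using pow[of "2 * b * b"] by (rule le_trans)
    show "(2 * b) ^ (2 * b * d) \<le> K" unfolding K_def using le b by (intro power_increasing) auto
  qed
  have "2 * b \<le> 2 * b * b" using b by simp
  then have K2: "2 * b \<le> K" unfolding K_def using pow[of "2 * b * b"] by linarith
  define R where "R r' \<longleftrightarrow> r' 2 = length Bs \<and> r' 4 = address Ls n \<and> r' 5 = r 5 \<and> r' 6 = r 6 \<and>
      r' 8 = b \<and> r' 16 = 2 * b" for r' :: "nat \<Rightarrow> nat"
  define I where "I d r' m' \<longleftrightarrow> m' = m \<and> R r' \<and> r' 9 = d \<and>
      r' 0 = card {d'. d' < d \<and> reachable E d' b Bs (length Bs) = {}}" for d and r' m' :: "nat \<Rightarrow> nat"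
  define J where "J d t r' m' \<longleftrightarrow> I d r' m' \<and> r' 13 = (2 * b) ^ (2 * b * d) \<and>
      r' 10 = set_encode (reachable E d b Bs t) \<and> r' 3 = address Ls (n + t) \<and>
      stores_list m (r' 11) (prev_bag Bs t)" for d t and r' m' :: "nat \<Rightarrow> nat"
  have cong_I: "I d r2 m'" if "I d r1 m'" "\<And>j. j < 40 \<Longrightarrow> j \<notin> {14, 15} \<Longrightarrow> r2 j = r1 j" for d r1 r2 m'
  proof -
    have "r2 0 = r1 0" "r2 2 = r1 2" "r2 4 = r1 4" "r2 5 = r1 5" "r2 6 = r1 6" "r2 8 = r1 8" "r2 9 = r1 9"
      "r2 16 = r1 16" by (rule that(2); simp)+
    then show ?thesis using that(1) unfolding I_def R_def by (simp only:)
  qed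
  have cong_J: "J d t r2 m'" if "J d t r1 m'" "\<And>j. j < 40 \<Longrightarrow> j \<notin> {14, 15} \<Longrightarrow> r2 j = r1 j" for d t r1 r2 m'
  proof -
    have "r2 13 = r1 13" "r2 10 = r1 10" "r2 3 = r1 3" "r2 11 = r1 11" by (rule that(2); simp)+
    moreover have "I d r2 m'" by (rule cong_I[of d r1]) (use that in \<open>simp_all add: J_def\<close>)
    ultimately show ?thesis using that(1) unfolding J_def by (simp only:)
  qed
  have inner: "run (repeat_prog 15 (Var 2) (Seq (assign 10 step_exp) (Seq (assign 11 (Var 3)) advance))) (r1, m)
      (exp_time 0 (Var 2) + 2 + ((\<Sum>t<length Bs. (exp_time K step_exp + 16) + 7) + 1))
      (\<lambda>s. fst s 14 = r1 14 \<and> J d (length Bs) (fst s) (snd s))"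
    if J0: "J d 0 r1 m" and d: "d < b" for d r1
  proof (rule run_repeat[where I="\<lambda>t r' m'. r' 14 = r1 14 \<and> J d t r' m'"])
    fix t r2 m' assume t: "t < length Bs" and J': "r2 14 = r1 14 \<and> J d t r2 m'"
    then have J: "J d t r2 m" and [simp]: "m' = m" by (auto simp: J_def I_def)
    have st: "stores_list m (address Ls (n + t)) (Ls ! (n + t))" "Ls ! (n + t) = Bs ! t"
      using stores[of "n + t"] t lenA by (auto simp: Ls_def)
    have bag: "length (Bs ! t) \<le> b" "set (Bs ! t) \<subseteq> {..<n}" using bags t by auto
    have prev: "length (prev_bag Bs t) \<le> b" using bags t by (auto simp: prev_bag_def)
    have ctx: "step_context n E d b (prev_bag Bs t) (Bs ! t) r2 m"
      using J b graph st bag by (simp add: step_context_def J_def I_def R_def)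
    have enc: "r2 10 = set_encode (reachable E d b Bs t)" "reachable E d b Bs t \<subseteq> {..<r2 13}"
      using J reachable_subset[OF b] by (auto simp: J_def)
    have lb: "loops_bounded K step_exp r2 m"
      using J K[OF d] K2 by (intro loops_bounded_step_exp[OF ctx enc prev bag(1)]) (auto simp: J_def)
    have ev: "eval step_exp r2 m = set_encode (reachable E d b Bs (Suc t))"
      using eval_step_exp[OF ctx enc] J by (simp add: J_def)
    have "run (Seq (assign 10 step_exp) (Seq (assign 11 (Var 3)) advance)) (r2, m)
        (exp_time K step_exp + 2 + (exp_time 0 (Var 3) + 2 + 10))
        (\<lambda>s. fst s 15 = r2 15 \<and> fst s 14 = r1 14 \<and> J d (Suc t) (fst s) (snd s))"
    proof (rule run_Seq_assign[OF wf_step_exp _ lb], simp, rule run_Seq_assign, simp, simp, simp,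
        rule run_advance[OF st(1)])
      fix r3 r4 assume r34: "\<forall>i<40. r3 i = (r2(10 := eval step_exp r2 m)) i"
        "\<forall>i<40. r4 i = (r3(11 := eval (Var 3) r3 m)) i"
      then show "r4 3 = address Ls (n + t)" using J by (simp add: J_def)
      fix r5 assume r5: "\<forall>i<40. r5 i = (r4(3 := address Ls (Suc (n + t)))) i"
      have "stores_list m (address Ls (n + t)) (prev_bag Bs (Suc t))"
        using st by (simp add: prev_bag_def)
      then show "fst (r5, m) 15 = r2 15 \<and> fst (r5, m) 14 = r1 14 \<and> J d (Suc t) (fst (r5, m)) (snd (r5, m))"
        using J J' r34 r5 unfolding ev J_def I_def R_def by (simp del: reachable.simps)
    qed
    then show "run (Seq (assign 10 step_exp) (Seq (assign 11 (Var 3)) advance)) (r2, m')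
        (exp_time K step_exp + 16)
        (\<lambda>s. fst s 15 = r2 15 \<and> fst s 14 = r1 14 \<and> J d (Suc t) (fst s) (snd s))"
      by (simp add: add.commute)
  next
    fix t r2 r3 m' assume J: "r2 14 = r1 14 \<and> J d t r2 m'" and r3: "\<And>j. j < 40 \<Longrightarrow> j \<noteq> 15 \<Longrightarrow> r3 j = r2 j"
    have "r3 14 = r2 14" by (rule r3) simp_all
    moreover have "J d t r3 m'" by (rule cong_J[of d t r2]) (use J r3 in simp_all)
    ultimately show "r3 14 = r1 14 \<and> J d t r3 m'" using J by simp
  next
    show "eval (Var 2) r1 m = length Bs" using J0 by (simp add: J_def I_def R_def)
  qed (use J0 in simp_all)
  let ?tail = "Seq (assign 0 (Plus (Var 0) (Ite (Var 10) (Lit 0) (Lit 1)))) (assign 9 (Plus (Var 9) (Lit 1)))"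
  let ?t2 = "exp_time 0 (Plus (Var 0) (Ite (Var 10) (Lit 0) (Lit 1))) + 2 + (exp_time 0 (Plus (Var 9) (Lit 1)) + 2)"
  have tail: "run ?tail (r1, m) ?t2 (\<lambda>s. fst s 14 = r1 14 \<and> I (Suc d) (fst s) (snd s))"
    if J: "J d (length Bs) r1 m" for d r1
  proof (rule run_Seq_assign, simp, simp, simp, rule run_assign, simp, simp, simp)
    fix r2 r3 assume r23: "\<forall>i<40. r2 i = (r1(0 := eval (Plus (Var 0) (Ite (Var 10) (Lit 0) (Lit 1))) r1 m)) i"
      "\<forall>i<40. r3 i = (r2(9 := eval (Plus (Var 9) (Lit 1)) r2 m)) i"
    have "finite (reachable E d b Bs (length Bs))"
      by (rule finite_subset[OF reachable_subset[OF b] finite_lessThan])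
    then have z: "r1 10 = 0 \<longleftrightarrow> reachable E d b Bs (length Bs) = {}"
      using J set_encode_eq_0_iff by (simp add: J_def)
    have "{d'. d' < Suc d \<and> reachable E d' b Bs (length Bs) = {}} =
        {d'. d' < d \<and> reachable E d' b Bs (length Bs) = {}} \<union>
        (if reachable E d b Bs (length Bs) = {} then {d} else {})"
      by (auto simp: less_Suc_eq)
    then have "card {d'. d' < Suc d \<and> reachable E d' b Bs (length Bs) = {}} =
        eval (Plus (Var 0) (Ite (Var 10) (Lit 0) (Lit 1))) r1 m"
      using J z by (auto simp: J_def I_def)
    then show "fst (r3, m) 14 = r1 14 \<and> I (Suc d) (fst (r3, m)) (snd (r3, m))"
      using J r23 unfolding J_def I_def R_def by simp
  qed
  let ?loop = "repeat_prog 15 (Var 2) (Seq (assign 10 step_exp) (Seq (assign 11 (Var 3)) advance))"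
  let ?t1 = "exp_time 0 (Var 2) + 2 + ((\<Sum>t<length Bs. (exp_time K step_exp + 16) + 7) + 1)"
  let ?body = "Seq (assign 13 states_exp) (Seq (assign 10 (Lit 1)) (Seq (assign 11 (Var 6)) (Seq (assign 3 (Var 4))
       (Seq ?loop ?tail))))"
  let ?T = "exp_time K states_exp + 50 + length Bs * (exp_time K step_exp + 30)"
  have body: "run ?body (r1, m') ?T (\<lambda>s. fst s 14 = r1 14 \<and> I (Suc d) (fst s) (snd s))"
    if I: "I d r1 m'" and d: "d < b" for d r1 m'
  proof -
    have [simp]: "m' = m" using I by (simp add: I_def)
    have wf: "wf_exp 40 states_exp" by (simp add: states_exp_def)
    have lb: "loops_bounded K states_exp r1 m"
      unfolding states_exp_def using I K[OF d] K2
      by (intro loops_bounded_power_exp loops_bounded_mult_exp) (simp_all add: I_def R_def)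
    have ev: "eval states_exp r1 m = (2 * b) ^ (2 * b * d)"
      using I by (simp add: states_exp_def I_def R_def)
    have "run ?body (r1, m) (exp_time K states_exp + 2 + (exp_time 0 (Lit 1) + 2 + (exp_time 0 (Var 6) + 2 +
        (exp_time 0 (Var 4) + 2 + (?t1 + ?t2))))) (\<lambda>s. fst s 14 = r1 14 \<and> I (Suc d) (fst s) (snd s))"
    proof (rule run_Seq_assign[OF wf _ lb], simp, rule run_Seq_assign, simp, simp, simp,
        rule run_Seq_assign, simp, simp, simp, rule run_Seq_assign, simp, simp, simp)
      fix r2 r3 r4 r5 assume rs: "\<forall>i<40. r2 i = (r1(13 := eval states_exp r1 m)) i"
        "\<forall>i<40. r3 i = (r2(10 := eval (Lit 1) r2 m)) i" "\<forall>i<40. r4 i = (r3(11 := eval (Var 6) r3 m)) i"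
        "\<forall>i<40. r5 i = (r4(3 := eval (Var 4) r4 m)) i"
      have J: "J d 0 r5 m" and r14: "r5 14 = r1 14"
        using I rs zero unfolding ev J_def I_def R_def by (simp_all add: prev_bag_def set_encode_def)
      show "run (Seq ?loop ?tail) (r5, m) (?t1 + ?t2) (\<lambda>s. fst s 14 = r1 14 \<and> I (Suc d) (fst s) (snd s))"
      proof (rule run_Seq[OF inner[OF J d]])
        fix s assume s: "fst s 14 = r5 14 \<and> J d (length Bs) (fst s) (snd s)"
        then obtain r6 where s': "s = (r6, m)" unfolding J_def I_def by (metis prod.collapse)
        then have "run ?tail (r6, m) ?t2 (\<lambda>s'. fst s' 14 = r6 14 \<and> I (Suc d) (fst s') (snd s'))"
          using s by (intro tail) simp
        then show "run ?tail s ?t2 (\<lambda>s. fst s 14 = r1 14 \<and> I (Suc d) (fst s) (snd s))"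
          using s r14 s' by simp
      qed
    qed
    then show ?thesis unfolding \<open>m' = m\<close> by (rule run_mono) (simp_all add: algebra_simps)
  qed
  have loop: "run (repeat_prog 14 (Var 8) ?body) (r1, m) (exp_time 0 (Var 8) + 2 + ((\<Sum>d<b. ?T + 7) + 1))
      (\<lambda>s. I b (fst s) (snd s))" if I0: "I 0 r1 m" for r1
  proof (rule run_repeat[where I=I])
    fix d r2 r3 m' assume I: "I d r2 m'" and r3: "\<And>j. j < 40 \<Longrightarrow> j \<noteq> 14 \<Longrightarrow> r3 j = r2 j"
    show "I d r3 m'" by (rule cong_I[OF I]) (use r3 in simp)
  next
    show "eval (Var 8) r1 m = b" using I0 by (simp add: I_def R_def)
  qed (use I0 body in simp_all)
  have "run main_prog (r, m) (exp_time 0 (Plus (Var 8) (Var 8)) + 2 + (exp_time 0 (Lit 0) + 2 +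
      (exp_time 0 (Var 8) + 2 + ((\<Sum>d<b. ?T + 7) + 1)))) (\<lambda>s. I b (fst s) (snd s))"
    unfolding main_prog_def
  proof (rule run_Seq_assign, simp, simp, simp, rule run_Seq_assign, simp, simp, simp, rule loop)
    fix r1 r2 assume "\<forall>i<40. r1 i = (r(16 := eval (Plus (Var 8) (Var 8)) r m)) i"
      "\<forall>i<40. r2 i = (r1(9 := eval (Lit 0) r1 m)) i"
    then show "I 0 r2 m" using r by (simp add: I_def R_def)
  qed
  then show ?thesis
    by (rule run_mono) (simp_all add: I_def algebra_simps)
qed

definition boxicity_prog :: prog where
  "boxicity_prog = Seq scan_prog (Seq matrix_prog main_prog)"

lemma run_boxicity_prog:
  fixes As Bs :: "nat list list" and n :: nat
  defines "b \<equiv> Max (insert 0 (length ` set Bs))"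
  defines "K \<equiv> (2 * b) ^ (2 * b * b)"
  assumes adj: "adjacency_lists n E As" and graph: "simple_graph {..<n} E" and b: "0 < b"
    and bags: "\<And>B. B \<in> set Bs \<Longrightarrow> set B \<subseteq> {..<n}"
  shows "run boxicity_prog (initial_state (encode_input As Bs))
    ((60 + 17 * n + 40 * length Bs) + ((40 + (\<Sum>u<n. 70 + 25 * length (As ! u))) +
      (20 + b * (exp_time K states_exp + 60 + length Bs * (exp_time K step_exp + 30)))))
    (\<lambda>s. result s = card {d. d < b \<and> reachable E d b Bs (length Bs) = {}})"
proof -
  have lenA: "length As = n" using adj by (simp add: adjacency_lists_def)
  define m0 where "m0 = snd (initial_state (encode_input As Bs))"
  let ?Q = "\<lambda>s. result s = card {d. d < b \<and> reachable E d b Bs (length Bs) = {}}"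
  show ?thesis
    unfolding boxicity_prog_def lenA[symmetric]
  proof (rule run_Seq[OF run_scan_prog], unfold lenA)
    fix s :: state
    assume s: "snd s = snd (initial_state (encode_input As Bs)) \<and> fst s 0 = 0 \<and> fst s 1 = n \<and>
      fst s 2 = length Bs \<and> fst s 3 = address (As @ Bs) (length (As @ Bs)) \<and>
      fst s 4 = address (As @ Bs) n \<and> fst s 8 = Max (insert 0 (length ` set Bs))"
    then obtain r where r: "s = (r, m0)" unfolding m0_def by (metis prod.collapse)
    have rr: "r 0 = 0" "r 1 = n" "r 2 = length Bs" "r 3 = address (As @ Bs) (length (As @ Bs))"
      "r 4 = address (As @ Bs) n" "r 8 = b" using s by (simp_all add: r b_def)
    show "run (Seq matrix_prog main_prog) s ((40 + (\<Sum>u<n. 70 + 25 * length (As ! u))) +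
      (20 + b * (exp_time K states_exp + 60 + length Bs * (exp_time K step_exp + 30)))) ?Q"
      unfolding r m0_def
    proof (rule run_Seq[OF run_matrix_prog[OF adj graph rr]])
      fix s' :: state
      assume s': "case s' of (r, m) \<Rightarrow>
        (\<forall>t<length (As @ Bs). stores_list m (address (As @ Bs) t) ((As @ Bs) ! t)) \<and>
        stores_graph m (r 5) n E \<and> stores_list m (r 6) [] \<and>
        r 0 = 0 \<and> r 1 = n \<and> r 2 = length Bs \<and> r 4 = address (As @ Bs) n \<and> r 8 = b"
      obtain r' m where rm: "s' = (r', m)" by (cases s')
      note * = s'[unfolded rm prod.case]
      have "length B \<le> b" if "B \<in> set Bs" for B
        unfolding b_def using that by (intro Max_ge) auto
      then show "run main_prog s'
        (20 + b * (exp_time K states_exp + 60 + length Bs * (exp_time K step_exp + 30))) ?Q"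
        unfolding rm result_def K_def using * bags
        by (intro run_main_prog[OF lenA b]) auto
    qed
  qed
qed

section \<open>Size of the input and running time\<close>

text \<open>The input lists the bags without immediate repetitions, so the analysis takes place on
  that sequence. Indices are pulled back along the monotone surjection \<open>f\<close>; strict
  inequalities between images lift to preimages.\<close>

lemma path_decomposition_remdups_adj:
  assumes "path_decomposition V E Ws" shows "path_decomposition V E (remdups_adj Ws)"
proof -
  let ?Vs = "remdups_adj Ws"
  obtain f :: "nat \<Rightarrow> nat" where f: "mono f" "f ` {0..<length Ws} = {0..<length ?Vs}"
      "\<And>i. i < length Ws \<Longrightarrow> Ws ! i = ?Vs ! f i"
    using iffD1[OF remdups_adj_altdef refl, of Ws] by blast
  have conv: "Ws ! i \<inter> Ws ! j \<subseteq> Ws ! k" if "i \<le> k" "k \<le> j" "j < length Ws" for i j k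
    using assms that unfolding path_decomposition_def by blast
  have "?Vs ! i \<inter> ?Vs ! j \<subseteq> ?Vs ! k" if ijk: "i \<le> k" "k \<le> j" "j < length ?Vs" for i j k
  proof (cases "i = k \<or> k = j")
    case False
    then have ik: "i < k" "k < j" using ijk by auto
    have "\<exists>i'<length Ws. f i' = x" if "x < length ?Vs" for x
    proof -
      have "x \<in> f ` {0..<length Ws}" unfolding f(2) using that by simp
      then show ?thesis by auto
    qed
    then obtain i' j' k' where *: "i' < length Ws" "f i' = i" "j' < length Ws" "f j' = j" "k' < length Ws" "f k' = k"
      using ijk(3) ik by (metis less_trans)
    have "i' < k'" "k' < j'" using * ik f(1) by (meson monoD not_le)+
    then have "Ws ! i' \<inter> Ws ! j' \<subseteq> Ws ! k'" using * by (intro conv) auto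
    then show ?thesis using f(3) * by simp
  qed auto
  then show ?thesis using assms unfolding path_decomposition_def by simp
qed

text \<open>Between consecutive distinct bags some vertex enters or leaves. By convexity a vertex
  enters at most once and leaves at most once, so there are at most \<open>2 * card V\<close>
  changes; the \<open>+ 1\<close> counts the first bag.\<close>

lemma length_path_decomposition_le:
  assumes pd: "path_decomposition V E Ws" and "finite V" and adj: "distinct_adj Ws"
  shows "length Ws \<le> 2 * card V + 1"
proof -
  have "Ws ! i \<inter> Ws ! j \<subseteq> Ws ! k" if "i \<le> k" "k \<le> j" "j < length Ws" for i j k
    using pd that unfolding path_decomposition_def by blast
  then have conv: "v \<in> Ws ! k" if "v \<in> Ws ! i" "v \<in> Ws ! j" "i \<le> k" "k \<le> j" "j < length Ws" for v i j k
    using that by (meson IntI subsetD)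
  have "\<Union>(set Ws) = V" using pd unfolding path_decomposition_def by simp
  then have sub: "Ws ! i \<subseteq> V" if "i < length Ws" for i
    using that by (metis Union_upper nth_mem)
  \<comment> \<open>A pair \<open>(v, True)\<close> records that \<open>v\<close> leaves after bag
    \<open>t\<close>, a pair \<open>(v, False)\<close> that it enters.\<close>
  define P where "P t p \<longleftrightarrow> (case p of (v, e) \<Rightarrow>
      if e then v \<in> Ws ! t - Ws ! Suc t else v \<in> Ws ! Suc t - Ws ! t)" for t and p :: "'a \<times> bool"
  have "\<exists>p\<in>V \<times> UNIV. P t p" if t: "Suc t < length Ws" for t
  proof -
    have "Ws ! t \<noteq> Ws ! Suc t" using adj t by (simp add: distinct_adj_conv_nth)
    then obtain v where "v \<in> Ws ! t - Ws ! Suc t \<or> v \<in> Ws ! Suc t - Ws ! t" by blast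
    moreover from this have "v \<in> V" using sub[of t] sub[of "Suc t"] t by auto
    ultimately have "P t (v, v \<in> Ws ! t)" "(v, v \<in> Ws ! t) \<in> V \<times> UNIV" by (auto simp: P_def)
    then show ?thesis by blast
  qed
  then obtain h where h: "\<And>t. Suc t < length Ws \<Longrightarrow> h t \<in> V \<times> UNIV" "\<And>t. Suc t < length Ws \<Longrightarrow> P t (h t)"
    by metis
  have P_less: False if P: "P t p" "P t' p" and t: "t < t'" "Suc t' < length Ws" for t t' p
  proof -
    obtain v e where p: "p = (v, e)" by (cases p)
    show False
    proof (cases e)
      case True
      then show False using P t conv[of v t t' "Suc t"] by (auto simp: P_def p)
    next
      case False
      then show False using P t conv[of v "Suc t" "Suc t'" t'] by (auto simp: P_def p)
    qed
  qed
  have "inj_on h {..<length Ws - 1}"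
  proof (rule inj_onI)
    fix t t' assume *: "t \<in> {..<length Ws - 1}" "t' \<in> {..<length Ws - 1}" "h t = h t'"
    then have t: "Suc t < length Ws" "Suc t' < length Ws" by auto
    then have "P t (h t)" "P t' (h t)" using h(2)[of t] h(2)[of t'] *(3) by auto
    then show "t = t'" using P_less[of t "h t" t'] P_less[of t' "h t" t] t
      by (cases t t' rule: linorder_cases) auto
  qed
  moreover have "h ` {..<length Ws - 1} \<subseteq> V \<times> UNIV" using h(1) by (simp add: image_subset_iff)
  ultimately have "card {..<length Ws - 1} \<le> card (V \<times> (UNIV :: bool set))"
    using assms(2) by (intro card_inj_on_le) auto
  then show ?thesis by (simp add: card_cartesian_product)
qed

text \<open>Every ordered pair of adjacent vertices lies in a bag, and a bag holds at most
  \<open>b * b\<close> ordered pairs. This makes the construction of the matrix linear in the number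
  of vertices for fixed width.\<close>

lemma sum_degrees_le:
  assumes adj: "adjacency_lists n E As" and graph: "simple_graph {..<n} E"
    and pd: "path_decomposition {..<n} E (map set Bs)" and len: "\<And>B. B \<in> set Bs \<Longrightarrow> length B \<le> b"
  shows "(\<Sum>u<n. length (As ! u)) \<le> length Bs * (b * b)"
proof -
  let ?pairs = "SIGMA u:{..<n}. set (As ! u)"
  have "length (As ! u) = card (set (As ! u))" if "u < n" for u
    using adj that by (metis adjacency_lists_def distinct_card)
  then have "(\<Sum>u<n. length (As ! u)) = (\<Sum>u<n. card (set (As ! u)))"
    by (intro sum.cong) auto
  also have "\<dots> = card ?pairs" by simp
  also have "\<dots> \<le> card (\<Union>i<length Bs. set (Bs ! i) \<times> set (Bs ! i))"
  proof (rule card_mono)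
    show "?pairs \<subseteq> (\<Union>i<length Bs. set (Bs ! i) \<times> set (Bs ! i))"
    proof clarify
      fix u v assume "u < n" "v \<in> set (As ! u)"
      then have "{u, v} \<in> E" using adj by (simp add: adjacency_lists_def)
      moreover have "\<forall>e\<in>E. \<exists>W\<in>set (map set Bs). e \<subseteq> W" using pd unfolding path_decomposition_def by simp
      ultimately obtain W where "W \<in> set (map set Bs)" "{u, v} \<subseteq> W" by blast
      then obtain B where B: "B \<in> set Bs" "u \<in> set B" "v \<in> set B" by auto
      from B(1) obtain i where "i < length Bs" "Bs ! i = B" unfolding in_set_conv_nth by blast
      with B(2,3) show "(u, v) \<in> (\<Union>i<length Bs. set (Bs ! i) \<times> set (Bs ! i))" by blast
    qed
  qed auto
  also have "\<dots> \<le> (\<Sum>i<length Bs. card (set (Bs ! i) \<times> set (Bs ! i)))"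
    by (rule card_UN_le) simp
  also have "\<dots> \<le> (\<Sum>i<length Bs. b * b)"
  proof (rule sum_mono)
    fix i assume "i \<in> {..<length Bs}"
    then have "card (set (Bs ! i)) \<le> b" using len[of "Bs ! i"] card_length[of "Bs ! i"] by simp
    then show "card (set (Bs ! i) \<times> set (Bs ! i)) \<le> b * b"
      by (simp add: card_cartesian_product mult_le_mono)
  qed
  finally show ?thesis by simp
qed

text \<open>The binary logarithm of \<open>C * (2 * K) ^ D\<close> for \<open>b = w + 1\<close> and
  \<open>K = (2 * b) ^ (2 * b * b)\<close>; here \<open>2 * K\<close> serves as a bound for
  \<open>K + 1\<close>.\<close>

definition time_exponent :: "real \<Rightarrow> real \<Rightarrow> nat \<Rightarrow> real" where
  "time_exponent C D w = log 2 C + D * (1 + 2 * (real w + 1)\<^sup>2 * log 2 (2 * (real w + 1)))"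

lemma time_exponent_bigo: "time_exponent C D \<in> O(\<lambda>w. (real w)\<^sup>2 * log 2 (real w))"
proof (rule bigoI[where c="\<bar>log 2 C\<bar> + 25 * \<bar>D\<bar>"])
  have "norm (time_exponent C D w) \<le> (\<bar>log 2 C\<bar> + 25 * \<bar>D\<bar>) * norm ((real w)\<^sup>2 * log 2 (real w))"
    if w: "2 \<le> w" for w
  proof -
    let ?x = "real w" and ?l = "log 2 (real w)"
    have x: "2 \<le> ?x" using w by simp
    have l: "1 \<le> ?l" using x by simp
    \<comment> \<open>This bounds the logarithm of \<open>2 * (?x + 1)\<close> by
      \<open>3 * ?l\<close>. Together with \<open>(?x + 1)\<^sup>2 \<le> 4 * ?x\<^sup>2\<close> the
      product is at most 24 times \<open>?x\<^sup>2 * ?l\<close>, and the summand 1 in the exponent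
      turns 24 into 25.\<close>
    have "2 * (?x + 1) \<le> ?x ^ 3"
    proof -
      have a: "4 * ?x \<le> ?x\<^sup>2 * ?x" using power_mono[of 2 ?x 2] x by (intro mult_right_mono) auto
      have c: "2 * (?x + 1) \<le> 4 * ?x" using x by simp
      have eq: "?x ^ 3 = ?x\<^sup>2 * ?x" by (simp add: eval_nat_numeral)
      show ?thesis unfolding eq using c a by (rule order_trans)
    qed
    then have "log 2 (2 * (?x + 1)) \<le> log 2 (?x ^ 3)" using x by (subst log_le_cancel_iff) auto
    also have "\<dots> = 3 * ?l" using x by (simp add: log_nat_power)
    finally have l3: "log 2 (2 * (?x + 1)) \<le> 3 * ?l" .
    have "(?x + 1)\<^sup>2 \<le> (2 * ?x)\<^sup>2" using x by (intro power_mono) auto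
    then have sq: "2 * (?x + 1)\<^sup>2 \<le> 8 * ?x\<^sup>2" by (simp add: power_mult_distrib)
    have l0: "0 \<le> log 2 (2 * (?x + 1))" using x by simp
    have "2 * (?x + 1)\<^sup>2 * log 2 (2 * (?x + 1)) \<le> (8 * ?x\<^sup>2) * (3 * ?l)"
      by (intro mult_mono sq l3 l0) simp
    then have ub: "2 * (?x + 1)\<^sup>2 * log 2 (2 * (?x + 1)) \<le> 24 * (?x\<^sup>2 * ?l)" by simp
    have lb: "0 \<le> 2 * (?x + 1)\<^sup>2 * log 2 (2 * (?x + 1))" using l0 by simp
    have "1 * 1 \<le> ?x\<^sup>2 * ?l" using l power_mono[of 1 ?x 2] x by (intro mult_mono) auto
    then have one: "1 \<le> ?x\<^sup>2 * ?l" by simp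
    have "\<bar>time_exponent C D w\<bar> \<le> \<bar>log 2 C\<bar> + \<bar>D\<bar> * (1 + 2 * (?x + 1)\<^sup>2 * log 2 (2 * (?x + 1)))"
      unfolding time_exponent_def using lb by (intro order_trans[OF abs_triangle_ineq]) (simp add: abs_mult)
    also have "\<dots> \<le> \<bar>log 2 C\<bar> * (?x\<^sup>2 * ?l) + \<bar>D\<bar> * (25 * (?x\<^sup>2 * ?l))"
    proof (intro add_mono mult_left_mono)
      show "\<bar>log 2 C\<bar> \<le> \<bar>log 2 C\<bar> * (?x\<^sup>2 * ?l)" using mult_left_mono[OF one, of "\<bar>log 2 C\<bar>"] by simp
    qed (use ub one in auto)
    also have "\<dots> = (\<bar>log 2 C\<bar> + 25 * \<bar>D\<bar>) * (?x\<^sup>2 * ?l)" by (simp add: algebra_simps)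
    finally show ?thesis using one by simp
  qed
  then show "\<forall>\<^sub>F w in at_top. norm (time_exponent C D w) \<le>
      (\<bar>log 2 C\<bar> + 25 * \<bar>D\<bar>) * norm ((real w)\<^sup>2 * log 2 (real w))"
    unfolding eventually_at_top_linorder by blast
qed

lemma powr_time_exponent:
  assumes "0 < b" "0 < C"
  shows "C * real ((2 * b) ^ (2 * b * b) + 1) ^ D \<le> 2 powr time_exponent C (real D) (b - 1)"
proof -
  let ?K = "real ((2 * b) ^ (2 * b * b))"
  have K: "?K = 2 powr (2 * (real b)\<^sup>2 * log 2 (2 * real b))"
  proof -
    have "?K = (2 * real b) powr real (2 * b * b)"
      using assms(1) by (simp only: powr_realpow of_nat_power) (simp add: powr_realpow)
    also have "\<dots> = 2 powr (log 2 (2 * real b) * real (2 * b * b))"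
      using assms(1) by (simp add: powr_powr[symmetric])
    finally show ?thesis by (simp add: power2_eq_square mult_ac)
  qed
  have "1 \<le> (2 * b) ^ (2 * b * b)" using assms(1) by (intro one_le_power) auto
  then have "1 \<le> ?K" by (metis of_nat_1 of_nat_mono)
  then have "real ((2 * b) ^ (2 * b * b) + 1) \<le> 2 * ?K"
    unfolding of_nat_add of_nat_1 by linarith
  also have "\<dots> = 2 powr (1 + 2 * (real b)\<^sup>2 * log 2 (2 * real b))"
    unfolding K by (simp add: powr_add)
  finally have "real ((2 * b) ^ (2 * b * b) + 1) ^ D \<le>
      (2 powr (1 + 2 * (real b)\<^sup>2 * log 2 (2 * real b))) ^ D"
    by (intro power_mono) auto
  also have "\<dots> = 2 powr (real D * (1 + 2 * (real b)\<^sup>2 * log 2 (2 * real b)))"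
    by (simp add: powr_realpow[symmetric] powr_powr mult.commute)
  finally have "C * real ((2 * b) ^ (2 * b * b) + 1) ^ D \<le>
      2 powr (log 2 C) * 2 powr (real D * (1 + 2 * (real b)\<^sup>2 * log 2 (2 * real b)))"
    using assms(2) by (simp add: mult_left_mono)
  moreover have "real (b - 1) + 1 = real b" using assms(1) by simp
  ultimately show ?thesis by (simp add: time_exponent_def powr_add)
qed

lemma boxicity_prog_time:
  "\<exists>C D. \<forall>n b L S. 0 < n \<and> 0 < b \<and> L \<le> 3 * n \<and> S \<le> L * (b * b) \<longrightarrow>
     (let K = (2 * b) ^ (2 * b * b) in
     (60 + 17 * n + 40 * L) + ((40 + (70 * n + 25 * S)) +
      (20 + b * (exp_time K states_exp + 60 + L * (exp_time K step_exp + 30)))) \<le> C * (K + 1) ^ D * n)"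
proof -
  obtain A1 D1 where A1: "\<And>K. exp_time K states_exp \<le> A1 * (K + 1) ^ D1"
    using exp_time_polynomial by blast
  obtain A2 D2 where A2: "\<And>K. exp_time K step_exp \<le> A2 * (K + 1) ^ D2"
    using exp_time_polynomial by blast
  \<comment> \<open>The exponent covers the time of either expression together with a factor
    \<open>b\<close>, and also \<open>b * b\<close>, as \<open>b \<le> K + 1\<close>. The number 552
    collects the numerical coefficients below, and the 3 comes from
    \<open>L \<le> 3 * n\<close>.\<close>
  let ?D = "D1 + D2 + 2" and ?C = "(552 + A1 + 3 * A2)"
  have "(60 + 17 * n + 40 * L) + ((40 + (70 * n + 25 * S)) +
      (20 + b * (exp_time K states_exp + 60 + L * (exp_time K step_exp + 30)))) \<le> ?C * (K + 1) ^ ?D * n"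
    if n: "0 < n" and b: "0 < b" and L: "L \<le> 3 * n" and S: "S \<le> L * (b * b)" and K: "K = (2 * b) ^ (2 * b * b)"
    for n b L S K
  proof -
    define X where "X = K + 1"
    define Y where "Y = X ^ ?D * n"
    have X1: "1 \<le> X" by (simp add: X_def)
    have "b \<le> (2 * b) ^ 1" by simp
    also have "\<dots> \<le> K" unfolding K using b by (intro power_increasing) auto
    finally have bX: "b \<le> X" by (simp add: X_def)
    have Xpow: "X ^ i \<le> X ^ ?D" if "i \<le> ?D" for i
      using that X1 by (rule power_increasing)
    have "1 \<le> X ^ ?D" using X1 by (rule one_le_power)
    then have nY: "n \<le> Y" using mult_le_mono1[of 1 "X ^ ?D" n] by (simp add: Y_def)
    have "b * b * n \<le> X ^ 2 * n" using bX by (intro mult_le_mono1) (simp add: power2_eq_square mult_le_mono)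
    also have "\<dots> \<le> Y" unfolding Y_def by (intro mult_le_mono1 Xpow) simp
    finally have bbY: "b * b * n \<le> Y" .
    have "b \<le> b * b" using b by simp
    then have bY: "b * n \<le> Y" using bbY mult_le_mono1[of b "b * b" n] by linarith
    have "S \<le> 3 * n * (b * b)" using S L mult_le_mono1[OF L, of "b * b"] by linarith
    then have SY: "S \<le> 3 * Y" using bbY by (simp add: mult_ac)
    have "b * exp_time K states_exp \<le> X * (A1 * X ^ D1)"
      using bX A1[of K] unfolding X_def by (intro mult_le_mono) auto
    also have "\<dots> = A1 * X ^ Suc D1" by simp
    also have "\<dots> \<le> A1 * X ^ ?D" by (intro mult_le_mono2 Xpow) simp
    also have "\<dots> \<le> A1 * Y" unfolding Y_def using n by (intro mult_le_mono2) simp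
    finally have T1: "b * exp_time K states_exp \<le> A1 * Y" .
    have "b * exp_time K step_exp \<le> X * (A2 * X ^ D2)"
      using bX A2[of K] unfolding X_def by (intro mult_le_mono) auto
    also have "\<dots> = A2 * X ^ Suc D2" by simp
    also have "\<dots> \<le> A2 * X ^ ?D" by (intro mult_le_mono2 Xpow) simp
    finally have "b * exp_time K step_exp * L \<le> A2 * X ^ ?D * (3 * n)"
      using L by (rule mult_le_mono)
    then have T2: "b * exp_time K step_exp * L \<le> 3 * A2 * Y" by (simp add: Y_def mult_ac)
    have "b * L \<le> 3 * (b * n)" using L by simp
    then have T3: "b * L \<le> 3 * Y" using bY by linarith
    have b1: "b \<le> Y" using bY n mult_le_mono2[of 1 n b] by linarith
    have "(60 + 17 * n + 40 * L) + ((40 + (70 * n + 25 * S)) +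
      (20 + b * (exp_time K states_exp + 60 + L * (exp_time K step_exp + 30)))) =
      120 + 87 * n + 40 * L + 25 * S + b * exp_time K states_exp + 60 * b +
      b * exp_time K step_exp * L + 30 * (b * L)" by (simp add: algebra_simps)
    also have "\<dots> \<le> 120 * Y + 87 * Y + 120 * Y + 75 * Y + A1 * Y + 60 * Y + 3 * A2 * Y + 90 * Y"
      using n L nY SY T1 T2 T3 b1 by linarith
    also have "\<dots> = ?C * (K + 1) ^ ?D * n" by (simp add: Y_def X_def algebra_simps)
    finally show ?thesis .
  qed
  then show ?thesis by (intro exI[of _ ?C] exI[of _ ?D]) (auto simp: Let_def)
qed

text \<open>The unsolvable dimensions form an initial segment since solvability is monotone in
  \<open>d\<close>, and \<open>b\<close> is already solvable. Counting those below \<open>b\<close>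
  therefore yields the least solvable dimension.\<close>

lemma boxicity_prog_correct:
  fixes n :: nat and Bs :: "nat list list"
  defines "b \<equiv> Max (insert 0 (length ` set Bs))"
  assumes pd: "path_decomposition {..<n} E (map set Bs)" and dist: "\<And>B. B \<in> set Bs \<Longrightarrow> distinct B"
    and b: "0 < b"
  defines "d \<equiv> card {d. d < b \<and> reachable E d b Bs (length Bs) = {}}"
  shows "d \<le> boxicity {..<n} E" "boxicity {..<n} E \<le> d + 1"
proof -
  let ?loc = "local_boxicity_le E (map set Bs)"
  have len: "length B \<le> b" if "B \<in> set Bs" for B
    unfolding b_def using that by (intro Max_ge) auto
  have conv: "set (Bs ! i) \<inter> set (Bs ! j) \<subseteq> set (Bs ! k)" if "i \<le> k" "k \<le> j" "j < length Bs" for i j k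
  proof -
    have "\<forall>i j k. i \<le> k \<and> k \<le> j \<and> j < length (map set Bs) \<longrightarrow>
        map set Bs ! i \<inter> map set Bs ! j \<subseteq> map set Bs ! k"
      using pd unfolding path_decomposition_def by (elim conjE)
    from this[rule_format, of i k j] that show ?thesis by simp
  qed
  have reach: "reachable E d' b Bs (length Bs) = {} \<longleftrightarrow> \<not> ?loc d'" for d'
  proof -
    have "reachable E d' b Bs (length Bs) \<noteq> {} \<longleftrightarrow> ?loc d'"
      using conv dist len b by (rule reachable_nonempty_iff)
    then show ?thesis by blast
  qed
  have "card W \<le> b" if W: "W \<in> set (map set Bs)" for W
  proof -
    obtain B where "B \<in> set Bs" "W = set B" using W by auto
    then show ?thesis using len[of B] card_length[of B] by simp
  qed
  then have locb: "?loc b" by (rule local_boxicity_le_bag_size[OF pd])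
  define d0 where "d0 = (LEAST d. ?loc d)"
  have d0: "?loc d0" unfolding d0_def using locb by (rule LeastI)
  have least: "d0 \<le> d'" if "?loc d'" for d' unfolding d0_def using that by (rule Least_le)
  have "{d. d < b \<and> reachable E d b Bs (length Bs) = {}} = {..<d0}"
  proof -
    have "?loc d' \<longleftrightarrow> d0 \<le> d'" for d' using least local_boxicity_le_mono[OF d0] by blast
    then have "d' < b \<and> reachable E d' b Bs (length Bs) = {} \<longleftrightarrow> d' < d0" for d'
      unfolding reach using least[OF locb] by (simp only: not_le) linarith
    then show ?thesis by (simp only: lessThan_def)
  qed
  then have "d = d0" by (simp add: d_def)
  then show "d \<le> boxicity {..<n} E" "boxicity {..<n} E \<le> d + 1"
    using boxicity_approximation[OF pd d0 least] by simp_all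
qed

theorem theorem7:
  "\<exists>(P :: prog) (g :: nat \<Rightarrow> real).
     g \<in> O(\<lambda>w. (real w)\<^sup>2 * log 2 (real w)) \<and>
     (\<forall>(n :: nat) (E :: nat set set) (Ws :: nat set list) (xs :: nat list).
        n \<ge> 1 \<and> simple_graph {..<n} E \<and> path_decomposition {..<n} E Ws \<and>
        is_encoding xs n E Ws \<longrightarrow>
        (\<exists>k s d. exec P (initial_state xs) k s \<and>
           real k \<le> 2 powr g (width Ws) * real n \<and>
           d = result s \<and>
           d \<le> boxicity {..<n} E \<and> boxicity {..<n} E \<le> d + 1))"
proof -
  obtain C D where time: "\<And>n b L S. 0 < n \<Longrightarrow> 0 < b \<Longrightarrow> L \<le> 3 * n \<Longrightarrow> S \<le> L * (b * b) \<Longrightarrow>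
     (60 + 17 * n + 40 * L) + ((40 + (70 * n + 25 * S)) +
      (20 + b * (exp_time ((2 * b) ^ (2 * b * b)) states_exp + 60 +
        L * (exp_time ((2 * b) ^ (2 * b * b)) step_exp + 30)))) \<le> C * ((2 * b) ^ (2 * b * b) + 1) ^ D * n"
    using boxicity_prog_time unfolding Let_def by blast
  \<comment> \<open>\<open>C + 1\<close> is positive, as the use of its logarithm requires.\<close>
  define g where "g = time_exponent (real (C + 1)) (real D)"
  have "\<exists>k s d. exec boxicity_prog (initial_state xs) k s \<and> real k \<le> 2 powr g (width Ws) * real n \<and>
      d = result s \<and> d \<le> boxicity {..<n} E \<and> boxicity {..<n} E \<le> d + 1"
    if n: "n \<ge> 1" and graph: "simple_graph {..<n} E" and pd: "path_decomposition {..<n} E Ws"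
      and enc: "is_encoding xs n E Ws" for n E Ws xs
  proof -
    obtain As Bs where adj: "adjacency_lists n E As" and Bs: "map set Bs = remdups_adj Ws"
        and dist: "\<And>B. B \<in> set Bs \<Longrightarrow> distinct B" and xs: "xs = encode_input As Bs"
      using enc unfolding is_encoding_def bag_lists_def by blast
    have pd': "path_decomposition {..<n} E (map set Bs)"
      unfolding Bs using pd by (rule path_decomposition_remdups_adj)
    then have union: "\<Union>(set (map set Bs)) = {..<n}" unfolding path_decomposition_def by (elim conjE)
    have sub: "set B \<subseteq> {..<n}" if "B \<in> set Bs" for B using union that by auto
    have L: "length Bs \<le> 3 * n"
    proof -
      have "distinct_adj (map set Bs)" unfolding Bs by simp
      then have "length (map set Bs) \<le> 2 * card {..<n} + 1"
        using pd' by (intro length_path_decomposition_le) simp_all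
      then show ?thesis using n by simp
    qed
    define b where "b = Max (insert 0 (length ` set Bs))"
    have len: "length B \<le> b" if "B \<in> set Bs" for B
      unfolding b_def using that by (intro Max_ge) auto
    \<comment> \<open>Vertex 0 exists, so some bag is nonempty; hence \<open>b\<close> is positive
      and \<open>b - 1\<close> does not truncate.\<close>
    have "0 \<in> \<Union>(set (map set Bs))" using union n by simp
    then obtain B where B: "B \<in> set Bs" "0 \<in> set B" by auto
    then have b: "0 < b" using len[OF B(1)] length_pos_if_in_set[OF B(2)] by linarith
    \<comment> \<open>Removing repetitions keeps the set of bags, and distinct lists are as long as
      their sets are large, so \<open>b\<close> is the maximal bag size of \<open>Ws\<close> as
      well.\<close>
    have "card ` set Ws = card ` set (map set Bs)" unfolding Bs by simp
    also have "\<dots> = length ` set Bs"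
      using dist by (auto simp: image_image distinct_card intro!: image_cong)
    finally have "Max (card ` set Ws) = Max (length ` set Bs)" by simp
    also have "\<dots> = b" unfolding b_def using B(1) by (subst Max_insert) auto
    finally have width: "width Ws = b - 1" by (simp add: width_def)
    define K where "K = (2 * b) ^ (2 * b * b)"
    define T where "T = (60 + 17 * n + 40 * length Bs) + ((40 + (\<Sum>u<n. 70 + 25 * length (As ! u))) +
      (20 + b * (exp_time K states_exp + 60 + length Bs * (exp_time K step_exp + 30))))"
    have "run boxicity_prog (initial_state xs) T
        (\<lambda>s. result s = card {d. d < b \<and> reachable E d b Bs (length Bs) = {}})"
      unfolding xs T_def K_def b_def
      by (rule run_boxicity_prog[OF adj graph]) (use b sub in \<open>simp_all add: b_def\<close>)
    then obtain k s where s: "exec boxicity_prog (initial_state xs) k s" "k \<le> T"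
        "result s = card {d. d < b \<and> reachable E d b Bs (length Bs) = {}}"
      unfolding run_def by blast
    have "(\<Sum>u<n. 70 + 25 * length (As ! u)) = 70 * n + 25 * (\<Sum>u<n. length (As ! u))"
      by (simp add: sum.distrib sum_distrib_left)
    moreover have "(\<Sum>u<n. length (As ! u)) \<le> length Bs * (b * b)"
      using adj graph pd' len by (rule sum_degrees_le)
    ultimately have "T \<le> C * (K + 1) ^ D * n"
      using time[of n b "length Bs" "\<Sum>u<n. length (As ! u)"] n b L unfolding T_def K_def by simp
    then have "real k \<le> real (C * (K + 1) ^ D * n)" using s(2) by linarith
    also have "\<dots> \<le> (real (C + 1) * real (K + 1) ^ D) * real n"
      by (simp add: mult_right_mono)
    also have "\<dots> \<le> 2 powr g (width Ws) * real n"
      unfolding g_def width K_def using b by (intro mult_right_mono powr_time_exponent) auto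
    finally have "real k \<le> 2 powr g (width Ws) * real n" .
    moreover have "result s \<le> boxicity {..<n} E" "boxicity {..<n} E \<le> result s + 1"
      unfolding s(3) b_def using pd' dist b by (intro boxicity_prog_correct; simp add: b_def)+
    ultimately show ?thesis using s(1) by blast
  qed
  then show ?thesis
    using time_exponent_bigo[of "real (C + 1)" "real D"] unfolding g_def by blast
qed

end
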